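(* Let $d\in\mathbb{N}$ and let $q$ be a hereditary rational nc function in the variables $X_1,\dots,X_d$. If $q\ge 0$ on the noncommutative polydisc $\mathbb{D}^d_{\rm nc}$, then there exist finitely many nc rational functions $r_1,\dots,r_K$ and $s_1,\dots,s_L$, and indices $k(1),\dots,k(K)\in\{1,\dots,d\}$, such that $$q \equiv \sum_{i=1}^{K} r_i^*\,\bigl(1-X_{k(i)}^*X_{k(i)}\bigr)\,r_i+\sum_{j=1}^{L}s_j^*s_j .$$
   Context: For $n\in\mathbb{N}$, $\mathbb{M}_n$ is the space of $n\times n$ complex matrices with the operator norm, $\mathbb{M}_n^d$ is the set of $d$-tuples $\underline{X}=(X_1,\dots,X_d)$ of such matrices, $\mathbb{M}^d=\bigsqcup_{n\ge1}\mathbb{M}_n^d$, and $\|\underline{X}\|=\max_i\|X_i\|$. The noncommutative polydisc is $\mathbb{D}^d_{\rm nc}=\{\underline{X}\in\mathbb{M}^d:\|\underline{X}\|<1\}$. An nc rational expression (respectively, a $*$-nc rational expression) is an expression built from the noncommuting symbols $X_1,\dots,X_d$ (respectively, $X_1,\dots,X_d,X_1^*,\dots,X_d^*$) using addition, multiplication, scalar multiplication and inverses. It is evaluated at tuples of matrices of any size where all the inverses occurring exist, with $X_i^*$ evaluated as the adjoint of $X_i$ and scalars as multiples of the identity. A ($*$-)nc rational function is an equivalence class of ($*$-)nc rational expressions with nonempty domains, two expressions being identified if they agree on the intersection of their domains; $\equiv$ denotes equality as $*$-nc rational functions. A $*$-nc rational function $q$ is hereditary if $q\equiv\sum_{\text{finite}}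 a_i^*b_i$ with all $a_i,b_i$ nc rational functions (no adjoints of variables), where $a^*(\underline{X})=a(\underline{X})^*$. "$q\ge0$ on $\mathbb{D}^d_{\rm nc}$" means that $q$ is defined on $\mathbb{D}^d_{\rm nc}$ and $q(\underline{X})$ is positive semidefinite for every $\underline{X}\in\mathbb{D}^d_{\rm nc}$ (of every matrix size $n$). *)

theory Defs
  imports "Jordan_Normal_Form.Schur_Decomposition" "HOL-Analysis.L2_Norm"
begin

section \<open>Rational expressions\<close>

text \<open>
  Expressions over an arbitrary set of symbols \<open>'x\<close>. Scalars are expressions in their own right
  (multiples of the identity), so scalar multiplication is \<open>Mult (Const c) e\<close>. The variables
  $X_1,\dots,X_d$ are the elements of a finite type \<open>'d\<close>, so that \<open>d = CARD('d)\<close>.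
\<close>

datatype 'x rat_expr =
    Const complex
  | Sym 'x
  | Add "'x rat_expr" "'x rat_expr"
  | Mult "'x rat_expr" "'x rat_expr"
  | Inv "'x rat_expr"

datatype 'd star_sym = Var 'd | VarAdj 'd

type_synonym 'd nc_expr = "'d rat_expr"
type_synonym 'd star_expr = "'d star_sym rat_expr"

abbreviation star_of :: "'d nc_expr \<Rightarrow> 'd star_expr" where
  "star_of \<equiv> map_rat_expr Var"

primrec adj_sym :: "'d star_sym \<Rightarrow> 'd star_sym" where
  "adj_sym (Var i) = VarAdj i"
| "adj_sym (VarAdj i) = Var i"

text \<open>The formal adjoint; lemma \<open>eval_star_adj_expr\<close> below shows that its value is the adjoint matrix.\<close>

primrec adj_expr :: "'d star_expr \<Rightarrow> 'd star_expr" where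
  "adj_expr (Const c) = Const (cnj c)"
| "adj_expr (Sym x) = Sym (adj_sym x)"
| "adj_expr (Add a b) = Add (adj_expr a) (adj_expr b)"
| "adj_expr (Mult a b) = Mult (adj_expr b) (adj_expr a)"
| "adj_expr (Inv a) = Inv (adj_expr a)"

definition sum_expr :: "'x rat_expr list \<Rightarrow> 'x rat_expr" where
  "sum_expr es = foldr Add es (Const 0)"

section \<open>Evaluation\<close>

text \<open>
  The matrix size \<open>n\<close> is needed to evaluate scalars; the result is \<open>None\<close> if some inverse does
  not exist.
\<close>

primrec eval_expr :: "nat \<Rightarrow> ('x \<Rightarrow> complex mat) \<Rightarrow> 'x rat_expr \<Rightarrow> complex mat option" where
  "eval_expr n \<rho> (Const c) = Some (c \<cdot>\<^sub>m 1\<^sub>m n)"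
| "eval_expr n \<rho> (Sym x) = Some (\<rho> x)"
| "eval_expr n \<rho> (Add a b) =
     Option.bind (eval_expr n \<rho> a) (\<lambda>A. Option.bind (eval_expr n \<rho> b) (\<lambda>B. Some (A + B)))"
| "eval_expr n \<rho> (Mult a b) =
     Option.bind (eval_expr n \<rho> a) (\<lambda>A. Option.bind (eval_expr n \<rho> b) (\<lambda>B. Some (A * B)))"
| "eval_expr n \<rho> (Inv a) = Option.bind (eval_expr n \<rho> a) mat_inverse"

primrec sym_val :: "('d \<Rightarrow> complex mat) \<Rightarrow> 'd star_sym \<Rightarrow> complex mat" where
  "sym_val X (Var i) = X i"
| "sym_val X (VarAdj i) = mat_adjoint (X i)"

definition eval_star :: "nat \<Rightarrow> ('d \<Rightarrow> complex mat) \<Rightarrow> 'd star_expr \<Rightarrow> complex mat option" where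
  "eval_star n X e = eval_expr n (sym_val X) e"

definition mat_tuples :: "nat \<Rightarrow> ('d \<Rightarrow> complex mat) set" where
  "mat_tuples n = {X. \<forall>i. X i \<in> carrier_mat n n}"

definition nc_dom :: "'d nc_expr \<Rightarrow> (nat \<times> ('d \<Rightarrow> complex mat)) set" where
  "nc_dom e = {(n, X). 0 < n \<and> X \<in> mat_tuples n \<and> eval_expr n X e \<noteq> None}"

definition star_dom :: "'d star_expr \<Rightarrow> (nat \<times> ('d \<Rightarrow> complex mat)) set" where
  "star_dom e = {(n, X). 0 < n \<and> X \<in> mat_tuples n \<and> eval_star n X e \<noteq> None}"

lemma eval_star_star_of: "eval_star n X (star_of e) = eval_expr n X e"
  unfolding eval_star_def by (induction e) auto

lemma star_dom_star_of: "star_dom (star_of e) = nc_dom e"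
  unfolding star_dom_def nc_dom_def eval_star_star_of ..

section \<open>Rational functions\<close>

definition star_rel :: "('d star_expr \<times> 'd star_expr) set" where
  "star_rel = {(e, e'). star_dom e \<noteq> {} \<and> star_dom e' \<noteq> {} \<and>
     (\<forall>(n, X) \<in> star_dom e \<inter> star_dom e'. eval_star n X e = eval_star n X e')}"

definition star_rat_funs :: "'d star_expr set set" where
  "star_rat_funs = {e. star_dom e \<noteq> {}} // star_rel"

definition star_class :: "'d star_expr \<Rightarrow> 'd star_expr set" where
  "star_class e = star_rel `` {e}"

text \<open>
  An nc rational function is named by an expression \<open>a\<close> in the variables only, with
  \<open>nc_dom a \<noteq> {}\<close>; as a $*$-nc rational function it is \<open>star_class (star_of a)\<close>.
\<close>

definition hereditary :: "'d star_expr set \<Rightarrow> bool" where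
  "hereditary q \<longleftrightarrow> q \<in> star_rat_funs \<and>
     (\<exists>(m::nat) a b. (\<forall>i<m. nc_dom (a i) \<noteq> {} \<and> nc_dom (b i) \<noteq> {}) \<and>
        q = star_class (sum_expr
          (map (\<lambda>i. Mult (adj_expr (star_of (a i))) (star_of (b i))) [0..<m])))"

section \<open>The noncommutative polydisc\<close>

definition cvec_norm :: "complex vec \<Rightarrow> real" where
  "cvec_norm v = L2_set (\<lambda>i. cmod (v $ i)) {..<dim_vec v}"

definition op_norm :: "complex mat \<Rightarrow> real" where
  "op_norm A = (SUP v \<in> {v \<in> carrier_vec (dim_col A). cvec_norm v \<le> 1}. cvec_norm (A *\<^sub>v v))"

definition tuple_norm :: "('d::finite \<Rightarrow> complex mat) \<Rightarrow> real" where
  "tuple_norm X = Max (range (\<lambda>i. op_norm (X i)))"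

definition nc_polydisc :: "(nat \<times> ('d::finite \<Rightarrow> complex mat)) set" where
  "nc_polydisc = {(n, X). 0 < n \<and> X \<in> mat_tuples n \<and> tuple_norm X < 1}"

text \<open>The order on \<open>complex\<close> makes \<open>0 \<le> z\<close> mean that \<open>z\<close> is real and nonnegative.\<close>

definition psd :: "nat \<Rightarrow> complex mat \<Rightarrow> bool" where
  "psd n A \<longleftrightarrow> A \<in> carrier_mat n n \<and> (\<forall>v \<in> carrier_vec n. 0 \<le> (A *\<^sub>v v) \<bullet>c v)"

text \<open>
  A rational function is defined at a point if one of its representing expressions is, and its
  value there is the value of any such expression; different points may need different
  representatives.
\<close>

definition nonneg_on_polydisc :: "'d::finite star_expr set \<Rightarrow> bool" where
  "nonneg_on_polydisc q \<longleftrightarrow> (\<forall>(n, X) \<in> nc_polydisc.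
     (\<exists>e \<in> q. eval_star n X e \<noteq> None) \<and>
     (\<forall>e \<in> q. \<forall>A. eval_star n X e = Some A \<longrightarrow> psd n A))"

definition defect_expr :: "'d \<Rightarrow> 'd star_expr" where
  "defect_expr k = Add (Const 1) (Mult (Const (- 1)) (Mult (Sym (VarAdj k)) (Sym (Var k))))"

section \<open>The formal adjoint evaluates to the adjoint\<close>

lemma mat_adjoint_dim [simp]:
  "dim_row (mat_adjoint A) = dim_col A" "dim_col (mat_adjoint A) = dim_row A"
  by (simp_all add: mat_adjoint_def)

lemma mat_adjoint_carrier: "A \<in> carrier_mat n m \<Longrightarrow> mat_adjoint A \<in> carrier_mat m n"
  by (auto intro: carrier_matI)

lemma mat_adjoint_index [simp]:
  assumes "i < dim_col A" "j < dim_row A"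
  shows "mat_adjoint A $$ (i, j) = conjugate (A $$ (j, i))"
  using assms by (simp add: mat_adjoint_def mat_of_rows_def)

lemma mat_adjoint_adjoint [simp]: "mat_adjoint (mat_adjoint A) = A" for A :: "complex mat"
  by (rule eq_matI) auto

lemma mat_adjoint_one [simp]: "mat_adjoint (1\<^sub>m n) = (1\<^sub>m n :: complex mat)"
  by (rule eq_matI) auto

lemma mat_adjoint_add:
  fixes A B :: "complex mat"
  assumes "A \<in> carrier_mat n m" "B \<in> carrier_mat n m"
  shows "mat_adjoint (A + B) = mat_adjoint A + mat_adjoint B"
  using assms by (intro eq_matI) auto

lemma mat_adjoint_mult:
  fixes A B :: "complex mat"
  assumes "A \<in> carrier_mat n m" "B \<in> carrier_mat m l"
  shows "mat_adjoint (A * B) = mat_adjoint B * mat_adjoint A"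
  using assms
  by (intro eq_matI) (auto simp: scalar_prod_def mult.commute intro!: sum.cong)

lemma mat_inverse_eq_Some_iff:
  fixes A :: "complex mat"
  assumes A: "A \<in> carrier_mat n n"
  shows "mat_inverse A = Some B \<longleftrightarrow> B \<in> carrier_mat n n \<and> A * B = 1\<^sub>m n \<and> B * A = 1\<^sub>m n"
proof
  assume "mat_inverse A = Some B"
  with mat_inverse(2)[OF A] show "B \<in> carrier_mat n n \<and> A * B = 1\<^sub>m n \<and> B * A = 1\<^sub>m n" by blast
next
  assume B: "B \<in> carrier_mat n n \<and> A * B = 1\<^sub>m n \<and> B * A = 1\<^sub>m n"
  then have "A \<in> Units (ring_mat TYPE(complex) n ())"
    using A by (auto simp: Units_def ring_mat_def)
  with mat_inverse(1)[OF A] obtain C where C: "mat_inverse A = Some C" by fastforce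
  with mat_inverse(2)[OF A] have C': "A * C = 1\<^sub>m n" "C \<in> carrier_mat n n" by blast+
  have "C = (B * A) * C" using B C' by simp
  also have "\<dots> = B * (A * C)" using A B C' by (intro assoc_mult_mat) auto
  also have "\<dots> = B" using B C'(1) right_mult_one_mat[of B n n] by simp
  finally show "mat_inverse A = Some B" using C by simp
qed

lemma mat_inverse_adjoint:
  fixes A :: "complex mat"
  assumes A: "A \<in> carrier_mat n n"
  shows "mat_inverse (mat_adjoint A) = map_option mat_adjoint (mat_inverse A)"
proof -
  have *: "mat_inverse (mat_adjoint A) = Some (mat_adjoint B)"
    if "A \<in> carrier_mat n n" "mat_inverse A = Some B" for A B :: "complex mat"
  proof -
    from that have B: "B \<in> carrier_mat n n" "A * B = 1\<^sub>m n" "B * A = 1\<^sub>m n"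
      by (simp_all add: mat_inverse_eq_Some_iff)
    have "mat_adjoint A * mat_adjoint B = 1\<^sub>m n" "mat_adjoint B * mat_adjoint A = 1\<^sub>m n"
      using that(1) B by (metis mat_adjoint_mult mat_adjoint_one)+
    then show ?thesis
      using that(1) B by (simp add: mat_inverse_eq_Some_iff[of _ n] mat_adjoint_carrier)
  qed
  show ?thesis
  proof (cases "mat_inverse A")
    case None
    have "mat_inverse (mat_adjoint A) = None"
    proof (cases "mat_inverse (mat_adjoint A)")
      case (Some C)
      from *[OF mat_adjoint_carrier[OF A] this] None show ?thesis by simp
    qed
    with None show ?thesis by simp
  next
    case (Some B)
    from *[OF A this] Some show ?thesis by simp
  qed
qed

lemma eval_star_carrier:
  assumes "X \<in> mat_tuples n" "eval_star n X e = Some A"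
  shows "A \<in> carrier_mat n n"
  using assms(2) unfolding eval_star_def
proof (induction e arbitrary: A)
  case (Sym x)
  with assms(1) show ?case by (cases x) (auto simp: mat_tuples_def intro: mat_adjoint_carrier)
next
  case (Inv e)
  then obtain B where "eval_expr n (sym_val X) e = Some B" "mat_inverse B = Some A"
    by (auto simp: bind_eq_Some_conv)
  with Inv.IH show ?case by (simp add: mat_inverse_eq_Some_iff)
qed (auto simp: bind_eq_Some_conv)

lemma eval_star_adj_expr:
  assumes X: "X \<in> mat_tuples n"
  shows "eval_star n X (adj_expr e) = map_option mat_adjoint (eval_star n X e)"
proof (induction e)
  case (Const c)
  have "mat_adjoint (c \<cdot>\<^sub>m 1\<^sub>m n) = cnj c \<cdot>\<^sub>m (1\<^sub>m n :: complex mat)"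
    by (rule eq_matI) auto
  then show ?case by (simp add: eval_star_def)
next
  case (Sym x)
  show ?case by (cases x) (simp_all add: eval_star_def)
next
  case (Add a b)
  then show ?case
    using eval_star_carrier[OF X, of a] eval_star_carrier[OF X, of b]
    by (cases "eval_star n X a"; cases "eval_star n X b")
      (auto simp: eval_star_def mat_adjoint_add)
next
  case (Mult a b)
  then show ?case
    using eval_star_carrier[OF X, of a] eval_star_carrier[OF X, of b]
    by (cases "eval_star n X a"; cases "eval_star n X b")
      (auto simp: eval_star_def mat_adjoint_mult)
next
  case (Inv a)
  then show ?case
    using eval_star_carrier[OF X, of a]
    by (cases "eval_star n X a") (auto simp: eval_star_def mat_inverse_adjoint)
qed

end

theory Submission
  imports Defs "HOL-Analysis.Function_Topology" "HOL-Library.Function_Algebras"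
begin

text \<open>
  Write \<open>q = \<Sum> a\<^sub>i\<^sup>* b\<^sub>i\<close>. While an expression is being evaluated, variables are
  applied only to the values of finitely many expressions, collected by \<open>var_args\<close>. Let \<open>V\<close> be the
  span of those that belong to the \<open>a\<^sub>i\<close> and \<open>b\<^sub>i\<close>, and let \<open>V'\<close> be the span of \<open>V\<close>, all \<open>X\<^sub>k V\<close>, and
  the \<open>a\<^sub>i\<close> and \<open>b\<^sub>i\<close> themselves. It suffices to show that \<open>q\<close> lies in the convex cone generated by
  the \<open>s\<^sup>* s\<close> with \<open>s \<in> V'\<close> and the \<open>r\<^sup>* (1 - X\<^sub>k\<^sup>* X\<^sub>k) r\<close> with \<open>r \<in> V\<close>, which lives in a
  finite-dimensional space of hereditary functions.

  The whole cone can be studied at one tuple \<open>Y\<close> of strict contractions. Finitely many points detect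
  whether a member of a finite-dimensional space of functions vanishes, and evaluation respects
  direct sums, so the direct sum of those points detects it alone (\<open>determining_point\<close>). At \<open>Y\<close> the
  trace of a generator dominates the square of the norm of its coefficients, because every
  \<open>1 - Y\<^sub>k\<^sup>* Y\<^sub>k\<close> is bounded below. This makes the cone closed, and a point outside it is separated
  from it by a linear functional (\<open>cone_of_squares_separation\<close>, \<open>hereditary_alternative\<close>).

  Suppose a functional \<open>L\<close> is nonnegative on the cone and negative at \<open>q(Y)\<close>. Then, after adding a
  small multiple of the trace, \<open>\<langle>f, g\<rangle> = L(g\<^sup>* f)\<close> is an inner product on \<open>V'\<close> for which
  multiplication by \<open>X\<^sub>k\<close> is a strict contraction from \<open>V\<close> to \<open>V'\<close>. As in the
  Gelfand--Naimark--Segal construction, extending these maps to a larger space yields strict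
  contractions \<open>T\<^sub>k\<close> and a vector \<open>x\<close> with \<open>\<langle>b(T) x, a(T) x\<rangle> = \<langle>b, a\<rangle>\<close>
  (\<open>contractive_model\<close>). Hence \<open>\<langle>q(T) x, x\<rangle> < 0\<close>, which contradicts \<open>q \<ge> 0\<close>
  (\<open>negative_functional_point\<close>).

  The expressions \<open>a\<^sub>i\<close> and \<open>b\<^sub>i\<close> may be singular at points of the polydisc where \<open>q\<close> is defined, so
  \<open>T\<close> has to avoid their singularities. The possible extensions contain a line of tuples that agree
  on \<open>V\<close>. One member of the line is similar to a direct sum of copies of \<open>Y\<close>, where everything is
  defined; hence everything is defined at all but finitely many members, since only zeros of nonzero
  polynomials are excluded (\<open>eval_expr_cofinite\<close>). Members close to the one that vanishes on a
  complement of \<open>V\<close> are strict contractions (\<open>line_generic\<close>).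

  The same line argument shows that expressions with nonempty domains have a common domain, and
  that two expressions agree as soon as they agree at the strict contractions in a common domain
  (\<open>eval_star_eq_of_strict_dom\<close>). Therefore equality at the points considered is equality of
  rational functions.
\<close>

section \<open>Evaluation along polynomial families and under homomorphisms\<close>

lemma eval_expr_carrier:
  assumes "\<And>x. \<rho> x \<in> carrier_mat n n" "eval_expr n \<rho> e = Some A"
  shows "A \<in> carrier_mat n n"
  using assms(2)
proof (induction e arbitrary: A)
  case (Inv e)
  then obtain B where "eval_expr n \<rho> e = Some B" "mat_inverse B = Some A"
    by (auto simp: bind_eq_Some_conv)
  with Inv.IH show ?case by (simp add: mat_inverse_eq_Some_iff)
qed (use assms(1) in \<open>auto simp: bind_eq_Some_conv\<close>)

abbreviation poly_mat :: "complex \<Rightarrow> complex poly mat \<Rightarrow> complex mat" where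
  "poly_mat t P \<equiv> map_mat (\<lambda>p. poly p t) P"

lemma poly_mat_mult:
  "P \<in> carrier_mat n m \<Longrightarrow> Q \<in> carrier_mat m l \<Longrightarrow> poly_mat t (P * Q) = poly_mat t P * poly_mat t Q"
  by (rule semiring_hom.mat_hom_mult[OF poly_hom.semiring_hom_axioms])

lemma poly_mat_det: "det (poly_mat t P) = poly (det P) t"
  by (rule comm_ring_hom.hom_det[OF poly_hom.comm_ring_hom_axioms])

lemma poly_mat_smult_one: "poly_mat t (p \<cdot>\<^sub>m 1\<^sub>m n) = poly p t \<cdot>\<^sub>m 1\<^sub>m n"
  by (rule eq_matI) auto

lemma mat_smult_smult: "a \<cdot>\<^sub>m (b \<cdot>\<^sub>m A) = (a * b) \<cdot>\<^sub>m A" for a :: "'a :: semigroup_mult"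
  by (rule eq_matI) (auto simp: mult.assoc)

text \<open>
  Along a polynomial family of arguments, values are polynomial matrices divided by one common
  polynomial. Inverses stay in this class by Cramer's rule, which multiplies the denominator by a
  determinant. That determinant is nonzero at \<open>t0\<close> because the inverse exists there, so the
  denominator remains a nonzero polynomial.
\<close>

lemma eval_expr_poly_family:
  fixes R :: "'x \<Rightarrow> complex poly mat"
  assumes R: "\<And>x. R x \<in> carrier_mat n n"
    and "eval_expr n (\<lambda>x. poly_mat t0 (R x)) e \<noteq> None"
  shows "\<exists>p P. P \<in> carrier_mat n n \<and> poly p t0 \<noteq> 0 \<and>
    (\<forall>t. poly p t \<noteq> 0 \<longrightarrow>
      eval_expr n (\<lambda>x. poly_mat t (R x)) e = Some (inverse (poly p t) \<cdot>\<^sub>m poly_mat t P))"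
  using assms(2)
proof (induction e)
  case (Const c)
  have "inverse (poly 1 t) \<cdot>\<^sub>m poly_mat t ([:c:] \<cdot>\<^sub>m 1\<^sub>m n) = c \<cdot>\<^sub>m 1\<^sub>m n" for t
    by (rule eq_matI) auto
  then show ?case by (intro exI[of _ 1] exI[of _ "[:c:] \<cdot>\<^sub>m 1\<^sub>m n"]) auto
next
  case (Sym x)
  have "inverse (poly 1 t) \<cdot>\<^sub>m poly_mat t (R x) = poly_mat t (R x)" for t
    by (rule eq_matI) auto
  then show ?case using R[of x] by (intro exI[of _ 1] exI[of _ "R x"]) auto
next
  case (Add a b)
  then obtain p P p' P' where P: "P \<in> carrier_mat n n" "poly p t0 \<noteq> 0"
    "\<And>t. poly p t \<noteq> 0 \<Longrightarrow> eval_expr n (\<lambda>x. poly_mat t (R x)) a = Some (inverse (poly p t) \<cdot>\<^sub>m poly_mat t P)"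
    and P': "P' \<in> carrier_mat n n" "poly p' t0 \<noteq> 0"
    "\<And>t. poly p' t \<noteq> 0 \<Longrightarrow> eval_expr n (\<lambda>x. poly_mat t (R x)) b = Some (inverse (poly p' t) \<cdot>\<^sub>m poly_mat t P')"
    by (auto simp: bind_eq_None_conv)
  have "inverse (poly p t) \<cdot>\<^sub>m poly_mat t P + inverse (poly p' t) \<cdot>\<^sub>m poly_mat t P' =
      inverse (poly (p * p') t) \<cdot>\<^sub>m poly_mat t (p' \<cdot>\<^sub>m P + p \<cdot>\<^sub>m P')" if "poly (p * p') t \<noteq> 0" for t
    by (rule eq_matI) (use P(1) P'(1) that in \<open>auto simp: field_simps\<close>)
  then show ?case using P P'
    by (intro exI[of _ "p * p'"] exI[of _ "p' \<cdot>\<^sub>m P + p \<cdot>\<^sub>m P'"]) auto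
next
  case (Mult a b)
  then obtain p P p' P' where P: "P \<in> carrier_mat n n" "poly p t0 \<noteq> 0"
    "\<And>t. poly p t \<noteq> 0 \<Longrightarrow> eval_expr n (\<lambda>x. poly_mat t (R x)) a = Some (inverse (poly p t) \<cdot>\<^sub>m poly_mat t P)"
    and P': "P' \<in> carrier_mat n n" "poly p' t0 \<noteq> 0"
    "\<And>t. poly p' t \<noteq> 0 \<Longrightarrow> eval_expr n (\<lambda>x. poly_mat t (R x)) b = Some (inverse (poly p' t) \<cdot>\<^sub>m poly_mat t P')"
    by (auto simp: bind_eq_None_conv)
  have "(inverse (poly p t) \<cdot>\<^sub>m poly_mat t P) * (inverse (poly p' t) \<cdot>\<^sub>m poly_mat t P') =
      inverse (poly (p * p') t) \<cdot>\<^sub>m poly_mat t (P * P')" for t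
  proof -
    have "poly_mat t (P * P') = poly_mat t P * poly_mat t P'"
      by (rule poly_mat_mult[OF P(1) P'(1)])
    moreover have "(inverse (poly p t) \<cdot>\<^sub>m poly_mat t P) * (inverse (poly p' t) \<cdot>\<^sub>m poly_mat t P') =
        inverse (poly p t) \<cdot>\<^sub>m (inverse (poly p' t) \<cdot>\<^sub>m (poly_mat t P * poly_mat t P'))"
      using P(1) P'(1) by (subst mult_smult_assoc_mat[of _ n n _ n], simp, simp, subst mult_smult_distrib[of _ n n _ n]) auto
    ultimately show ?thesis by (simp add: mat_smult_smult)
  qed
  then show ?case using P P'
    by (intro exI[of _ "p * p'"] exI[of _ "P * P'"]) auto
next
  case (Inv a)
  then obtain p P where P: "P \<in> carrier_mat n n" "poly p t0 \<noteq> 0"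
    "\<And>t. poly p t \<noteq> 0 \<Longrightarrow> eval_expr n (\<lambda>x. poly_mat t (R x)) a = Some (inverse (poly p t) \<cdot>\<^sub>m poly_mat t P)"
    by (auto simp: bind_eq_None_conv)
  define Q where "Q = (p * p) \<cdot>\<^sub>m adj_mat P"
  note adj = adj_mat[OF P(1)]
  have Q: "Q \<in> carrier_mat n n" using adj by (simp add: Q_def)
  have det_hom: "poly (det P) t = det (poly_mat t P)" for t by (rule poly_mat_det[symmetric])
  have inv: "mat_inverse (inverse (poly p t) \<cdot>\<^sub>m poly_mat t P) = Some (inverse (poly (p * det P) t) \<cdot>\<^sub>m poly_mat t Q)"
    if t: "poly (p * det P) t \<noteq> 0" for t
  proof -
    let ?A = "inverse (poly p t) \<cdot>\<^sub>m poly_mat t P"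
    let ?B = "inverse (poly (p * det P) t) \<cdot>\<^sub>m poly_mat t Q"
    have nz: "poly p t \<noteq> 0" "poly (det P) t \<noteq> 0" using t by auto
    have hom1: "poly_mat t P * poly_mat t (adj_mat P) = poly (det P) t \<cdot>\<^sub>m 1\<^sub>m n"
      "poly_mat t (adj_mat P) * poly_mat t P = poly (det P) t \<cdot>\<^sub>m 1\<^sub>m n"
      using arg_cong[OF adj(2), of "poly_mat t"] arg_cong[OF adj(3), of "poly_mat t"]
        poly_mat_mult[OF P(1) adj(1), of t] poly_mat_mult[OF adj(1) P(1), of t]
      by (auto simp: poly_mat_smult_one)
    have B: "?B = (poly p t / poly (det P) t) \<cdot>\<^sub>m poly_mat t (adj_mat P)"
      by (rule eq_matI) (use nz in \<open>auto simp: Q_def field_simps\<close>)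
    have "?A * ?B = 1\<^sub>m n"
      unfolding B using P(1) adj(1) nz
      by (subst mult_smult_assoc_mat[of _ n n _ n], simp, simp, subst mult_smult_distrib[of _ n n _ n])
        (auto simp: hom1 mat_smult_smult intro!: eq_matI)
    moreover have "?B * ?A = 1\<^sub>m n"
      unfolding B using P(1) adj(1) nz
      by (subst mult_smult_assoc_mat[of _ n n _ n], simp, simp, subst mult_smult_distrib[of _ n n _ n])
        (auto simp: hom1 mat_smult_smult intro!: eq_matI)
    ultimately show ?thesis
      using P(1) Q by (subst mat_inverse_eq_Some_iff[of _ n]) auto
  qed
  have "poly (det P) t0 \<noteq> 0"
  proof
    assume "poly (det P) t0 = 0"
    then have d: "det (poly_mat t0 P) = 0" by (simp add: det_hom)
    from Inv.prems P(2) P(3)[of t0] obtain B where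
      "mat_inverse (inverse (poly p t0) \<cdot>\<^sub>m poly_mat t0 P) = Some B" by auto
    then have B: "B \<in> carrier_mat n n" "(inverse (poly p t0) \<cdot>\<^sub>m poly_mat t0 P) * B = 1\<^sub>m n"
      using P(1) by (subst (asm) mat_inverse_eq_Some_iff[of _ n]; simp)+
    then have "det (inverse (poly p t0) \<cdot>\<^sub>m poly_mat t0 P) * det B = 1"
      using P(1) det_mult[of "inverse (poly p t0) \<cdot>\<^sub>m poly_mat t0 P" n B] by simp
    then show False using d by (simp add: det_smult)
  qed
  then show ?case using P inv Q
    by (intro exI[of _ "p * det P"] exI[of _ Q]) auto
qed

lemma eval_expr_cofinite:
  fixes R :: "'x \<Rightarrow> complex poly mat"
  assumes "\<And>x. R x \<in> carrier_mat n n" "eval_expr n (\<lambda>x. poly_mat t0 (R x)) e \<noteq> None"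
  shows "finite {t. eval_expr n (\<lambda>x. poly_mat t (R x)) e = None}"
proof -
  obtain p P where p: "poly p t0 \<noteq> 0" "\<And>t. poly p t \<noteq> 0 \<Longrightarrow>
      eval_expr n (\<lambda>x. poly_mat t (R x)) e = Some (inverse (poly p t) \<cdot>\<^sub>m poly_mat t P)"
    using eval_expr_poly_family[OF assms] by blast
  then have "p \<noteq> 0" by auto
  then have "finite {t. poly p t = 0}" by (rule poly_roots_finite)
  then show ?thesis by (rule finite_subset[rotated]) (use p(2) in force)
qed

text \<open>
  Cross-multiplying the two quotients of polynomials turns agreement at infinitely many parameters
  into a polynomial identity, which then holds at \<open>t0\<close> as well.
\<close>

lemma eval_expr_identity:
  fixes R :: "'x \<Rightarrow> complex poly mat"
  assumes R: "\<And>x. R x \<in> carrier_mat n n"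
    and e: "eval_expr n (\<lambda>x. poly_mat t0 (R x)) e \<noteq> None"
    and e': "eval_expr n (\<lambda>x. poly_mat t0 (R x)) e' \<noteq> None"
    and S: "infinite S"
      "\<And>t. t \<in> S \<Longrightarrow> eval_expr n (\<lambda>x. poly_mat t (R x)) e = eval_expr n (\<lambda>x. poly_mat t (R x)) e'"
  shows "eval_expr n (\<lambda>x. poly_mat t0 (R x)) e = eval_expr n (\<lambda>x. poly_mat t0 (R x)) e'"
proof -
  obtain p P where p: "P \<in> carrier_mat n n" "poly p t0 \<noteq> 0" "\<And>t. poly p t \<noteq> 0 \<Longrightarrow>
      eval_expr n (\<lambda>x. poly_mat t (R x)) e = Some (inverse (poly p t) \<cdot>\<^sub>m poly_mat t P)"
    using eval_expr_poly_family[OF R e] by blast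
  obtain p' P' where p': "P' \<in> carrier_mat n n" "poly p' t0 \<noteq> 0" "\<And>t. poly p' t \<noteq> 0 \<Longrightarrow>
      eval_expr n (\<lambda>x. poly_mat t (R x)) e' = Some (inverse (poly p' t) \<cdot>\<^sub>m poly_mat t P')"
    using eval_expr_poly_family[OF R e'] by blast
  have "p \<noteq> 0" "p' \<noteq> 0" using p(2) p'(2) by auto
  then have "finite ({t. poly p t = 0} \<union> {t. poly p' t = 0})"
    by (simp add: poly_roots_finite)
  with S(1) have inf: "infinite (S - ({t. poly p t = 0} \<union> {t. poly p' t = 0}))"
    by (rule Diff_infinite_finite[rotated])
  have "inverse (poly p t0) \<cdot>\<^sub>m poly_mat t0 P = inverse (poly p' t0) \<cdot>\<^sub>m poly_mat t0 P'"
  proof (rule eq_matI)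
    fix i j assume "i < dim_row (inverse (poly p' t0) \<cdot>\<^sub>m poly_mat t0 P')"
      "j < dim_col (inverse (poly p' t0) \<cdot>\<^sub>m poly_mat t0 P')"
    then have ij: "i < n" "j < n" using p'(1) by auto
    define r where "r = P $$ (i, j) * p' - P' $$ (i, j) * p"
    have "poly r t = 0" if "t \<in> S - ({t. poly p t = 0} \<union> {t. poly p' t = 0})" for t
    proof -
      have nz: "poly p t \<noteq> 0" "poly p' t \<noteq> 0" using that by auto
      have "inverse (poly p t) \<cdot>\<^sub>m poly_mat t P = inverse (poly p' t) \<cdot>\<^sub>m poly_mat t P'"
        using S(2)[of t] p(3)[OF nz(1)] p'(3)[OF nz(2)] that by simp
      from arg_cong[OF this, of "\<lambda>A. A $$ (i, j)"] ij p(1) p'(1) nz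
      show ?thesis by (simp add: r_def field_simps)
    qed
    then have "infinite {t. poly r t = 0}"
      using inf by (rule_tac infinite_super) auto
    then have "r = 0" using poly_roots_finite by blast
    then have "poly r t0 = 0" by simp
    then show "(inverse (poly p t0) \<cdot>\<^sub>m poly_mat t0 P) $$ (i, j) =
        (inverse (poly p' t0) \<cdot>\<^sub>m poly_mat t0 P') $$ (i, j)"
      using ij p p' by (simp add: r_def field_simps)
  qed (use p(1) p'(1) in auto)
  then show ?thesis using p p' by simp
qed

lemma eval_expr_hom:
  assumes \<rho>: "\<And>x. \<rho> x \<in> carrier_mat n n"
    and \<pi>: "\<And>A. A \<in> carrier_mat n n \<Longrightarrow> \<pi> A \<in> carrier_mat l l"
    and scalar: "\<And>c. \<pi> (c \<cdot>\<^sub>m 1\<^sub>m n) = c \<cdot>\<^sub>m 1\<^sub>m l"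
    and add: "\<And>A B. A \<in> carrier_mat n n \<Longrightarrow> B \<in> carrier_mat n n \<Longrightarrow> \<pi> (A + B) = \<pi> A + \<pi> B"
    and mult: "\<And>A B. A \<in> carrier_mat n n \<Longrightarrow> B \<in> carrier_mat n n \<Longrightarrow> \<pi> (A * B) = \<pi> A * \<pi> B"
    and "eval_expr n \<rho> e = Some E"
  shows "eval_expr l (\<lambda>x. \<pi> (\<rho> x)) e = Some (\<pi> E)"
proof -
  have c\<rho>: "A \<in> carrier_mat n n" if "eval_expr n \<rho> e = Some A" for e A
    using that by (rule eval_expr_carrier[rotated]) (rule \<rho>)
  show ?thesis
    using assms(6)
  proof (induction e arbitrary: E)
    case (Const c)
    then show ?case by (auto simp: scalar)
  next
    case (Sym x)
    then show ?case by simp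
  next
    case (Add a b)
    then show ?case using c\<rho> by (auto simp: bind_eq_Some_conv add)
  next
    case (Mult a b)
    then show ?case using c\<rho> by (auto simp: bind_eq_Some_conv mult)
  next
    case (Inv a)
    then obtain A where A: "eval_expr n \<rho> a = Some A" "mat_inverse A = Some E"
      by (auto simp: bind_eq_Some_conv)
    have cA: "A \<in> carrier_mat n n" using c\<rho>[OF A(1)] .
    have E: "E \<in> carrier_mat n n" "A * E = 1\<^sub>m n" "E * A = 1\<^sub>m n"
      using A(2) by (simp_all add: mat_inverse_eq_Some_iff[OF cA])
    have one: "1 \<cdot>\<^sub>m 1\<^sub>m k = (1\<^sub>m k :: complex mat)" for k by (rule eq_matI) auto
    have "\<pi> A * \<pi> E = 1\<^sub>m l" "\<pi> E * \<pi> A = 1\<^sub>m l"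
      using scalar[of 1] E cA by (simp_all add: one flip: mult)
    then have "mat_inverse (\<pi> A) = Some (\<pi> E)"
      using \<pi>[OF cA] \<pi>[OF E(1)] by (simp add: mat_inverse_eq_Some_iff)
    then show ?case using Inv.IH[OF A(1)] by simp
  qed
qed

section \<open>Direct sums\<close>

text \<open>
  Direct sums serve two purposes: points of different sizes are brought to a common size by taking
  copies, and finitely many points are merged into a single one.
\<close>

definition block_sum :: "complex mat \<Rightarrow> complex mat \<Rightarrow> complex mat" where
  "block_sum A B = four_block_mat A (0\<^sub>m (dim_row A) (dim_col B)) (0\<^sub>m (dim_row B) (dim_col A)) B"

lemma block_sum_carrier: "A \<in> carrier_mat n n \<Longrightarrow> B \<in> carrier_mat m m \<Longrightarrow> block_sum A B \<in> carrier_mat (n + m) (n + m)"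
  by (simp add: block_sum_def)

lemma block_sum_mult:
  assumes "A \<in> carrier_mat n n" "B \<in> carrier_mat m m" "A' \<in> carrier_mat n n" "B' \<in> carrier_mat m m"
  shows "block_sum A B * block_sum A' B' = block_sum (A * A') (B * B')"
proof -
  have "block_sum A B * block_sum A' B' =
      four_block_mat (A * A' + 0\<^sub>m n m * 0\<^sub>m m n) (A * 0\<^sub>m n m + 0\<^sub>m n m * B')
        (0\<^sub>m m n * A' + B * 0\<^sub>m m n) (0\<^sub>m m n * 0\<^sub>m n m + B * B')"
    using assms unfolding block_sum_def by (simp add: mult_four_block_mat[of _ n n _ m _ m _ _ n _ m])
  then show ?thesis using assms by (simp add: block_sum_def)
qed

lemma block_sum_add:
  assumes "A \<in> carrier_mat n n" "B \<in> carrier_mat m m" "A' \<in> carrier_mat n n" "B' \<in> carrier_mat m m"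
  shows "block_sum A B + block_sum A' B' = block_sum (A + A') (B + B')"
  by (rule eq_matI) (use assms in \<open>auto simp: block_sum_def\<close>)

lemma block_sum_smult_one: "block_sum (c \<cdot>\<^sub>m 1\<^sub>m n) (c \<cdot>\<^sub>m 1\<^sub>m m) = c \<cdot>\<^sub>m 1\<^sub>m (n + m)"
  by (rule eq_matI) (auto simp: block_sum_def)

lemma block_sum_one: "block_sum (1\<^sub>m n) (1\<^sub>m m) = 1\<^sub>m (n + m)"
  by (simp add: block_sum_def)

lemma block_sum_adjoint:
  assumes "A \<in> carrier_mat n n" "B \<in> carrier_mat m m"
  shows "mat_adjoint (block_sum A B) = block_sum (mat_adjoint A) (mat_adjoint B)"
  by (rule eq_matI) (use assms in \<open>auto simp: block_sum_def\<close>)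

lemma block_sum_eqD:
  assumes eq: "block_sum A B = block_sum A' B'" and "A \<in> carrier_mat n n" "A' \<in> carrier_mat n n"
    "B \<in> carrier_mat m m" "B' \<in> carrier_mat m m"
  shows "A = A'"
proof (rule eq_matI)
  fix i j assume "i < dim_row A'" "j < dim_col A'"
  with arg_cong[OF eq, of "\<lambda>M. M $$ (i, j)"] assms(2-)
  show "A $$ (i, j) = A' $$ (i, j)" by (auto simp: block_sum_def)
qed (use assms in auto)

lemma eval_expr_block_sum:
  assumes \<rho>: "\<And>x. \<rho> x \<in> carrier_mat n n" and \<sigma>: "\<And>x. \<sigma> x \<in> carrier_mat m m"
    and "eval_expr n \<rho> e = Some E" "eval_expr m \<sigma> e = Some F"
  shows "eval_expr (n + m) (\<lambda>x. block_sum (\<rho> x) (\<sigma> x)) e = Some (block_sum E F)"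
proof -
  have c\<rho>: "A \<in> carrier_mat n n" if "eval_expr n \<rho> e = Some A" for e A
    using that by (rule eval_expr_carrier[rotated]) (rule \<rho>)
  have c\<sigma>: "A \<in> carrier_mat m m" if "eval_expr m \<sigma> e = Some A" for e A
    using that by (rule eval_expr_carrier[rotated]) (rule \<sigma>)
  show ?thesis
    using assms(3,4)
  proof (induction e arbitrary: E F)
    case (Const c)
    then show ?case by (auto simp: block_sum_smult_one)
  next
    case (Sym x)
    then show ?case by simp
  next
    case (Add a b)
    then show ?case using c\<rho> c\<sigma>
      by (auto simp: bind_eq_Some_conv block_sum_add[of _ n _ m])
  next
    case (Mult a b)
    then show ?case using c\<rho> c\<sigma>
      by (auto simp: bind_eq_Some_conv block_sum_mult[of _ n _ m])
  next
    case (Inv a)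
    then obtain A B where A: "eval_expr n \<rho> a = Some A" "mat_inverse A = Some E"
      and B: "eval_expr m \<sigma> a = Some B" "mat_inverse B = Some F"
      by (auto simp: bind_eq_Some_conv)
    have cA: "A \<in> carrier_mat n n" and cB: "B \<in> carrier_mat m m"
      using c\<rho>[OF A(1)] c\<sigma>[OF B(1)] .
    have E: "E \<in> carrier_mat n n" "A * E = 1\<^sub>m n" "E * A = 1\<^sub>m n"
      using A(2) by (simp_all add: mat_inverse_eq_Some_iff[OF cA])
    have F: "F \<in> carrier_mat m m" "B * F = 1\<^sub>m m" "F * B = 1\<^sub>m m"
      using B(2) by (simp_all add: mat_inverse_eq_Some_iff[OF cB])
    have "mat_inverse (block_sum A B) = Some (block_sum E F)"
      using cA cB E F
      by (subst mat_inverse_eq_Some_iff[of _ "n + m"])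
        (simp_all add: block_sum_carrier block_sum_mult[of _ n _ m] block_sum_one)
    then show ?case using Inv.IH[OF A(1) B(1)] by simp
  qed
qed

lemma mat_tuples_dim: "X \<in> mat_tuples n \<Longrightarrow> dim_row (X i) = n" "X \<in> mat_tuples n \<Longrightarrow> dim_col (X i) = n"
  using carrier_matD[of "X i" n n] by (simp_all add: mat_tuples_def)

lemma block_sum_tuple: "X \<in> mat_tuples n \<Longrightarrow> Y \<in> mat_tuples m \<Longrightarrow> (\<lambda>i. block_sum (X i) (Y i)) \<in> mat_tuples (n + m)"
  by (auto simp: mat_tuples_def intro: block_sum_carrier)

lemma sym_val_carrier: "X \<in> mat_tuples n \<Longrightarrow> sym_val X x \<in> carrier_mat n n"
  by (cases x) (auto simp: mat_tuples_def intro: mat_adjoint_carrier)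

lemma eval_star_block_sum:
  assumes X: "X \<in> mat_tuples n" and Y: "Y \<in> mat_tuples m"
    and "eval_star n X e = Some E" "eval_star m Y e = Some F"
  shows "eval_star (n + m) (\<lambda>i. block_sum (X i) (Y i)) e = Some (block_sum E F)"
proof -
  have "sym_val (\<lambda>i. block_sum (X i) (Y i)) x = block_sum (sym_val X x) (sym_val Y x)" for x
    using X Y by (cases x) (auto simp: mat_tuples_def block_sum_adjoint[of _ n _ m])
  then have "sym_val (\<lambda>i. block_sum (X i) (Y i)) = (\<lambda>x. block_sum (sym_val X x) (sym_val Y x))" by blast
  then show ?thesis
    using eval_expr_block_sum[OF sym_val_carrier[OF X] sym_val_carrier[OF Y]] assms(3,4)
    by (simp add: eval_star_def)
qed

text \<open>
  There are \<open>Suc k\<close> summands in \<open>copies k A\<close>, so that no matrix of size zero occurs.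
\<close>

primrec copies :: "nat \<Rightarrow> complex mat \<Rightarrow> complex mat" where
  "copies 0 A = A"
| "copies (Suc k) A = block_sum A (copies k A)"

lemma copies_tuple: "X \<in> mat_tuples n \<Longrightarrow> (\<lambda>i. copies k (X i)) \<in> mat_tuples (Suc k * n)"
proof (induction k)
  case (Suc k)
  show ?case using block_sum_tuple[OF Suc.prems Suc.IH[OF Suc.prems]] by simp
qed simp

lemma eval_star_copies:
  assumes X: "X \<in> mat_tuples n" and e: "eval_star n X e = Some E"
  shows "eval_star (Suc k * n) (\<lambda>i. copies k (X i)) e = Some (copies k E)"
proof (induction k)
  case (Suc k)
  show ?case using eval_star_block_sum[OF X copies_tuple[OF X] e Suc.IH] by simp
qed (use e in simp)

lemma copies_carrier: "A \<in> carrier_mat n n \<Longrightarrow> copies k A \<in> carrier_mat (Suc k * n) (Suc k * n)"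
proof (induction k)
  case (Suc k)
  show ?case using block_sum_carrier[OF Suc.prems Suc.IH[OF Suc.prems]] by simp
qed simp

lemma copies_eqD:
  assumes "copies k A = copies k B" "A \<in> carrier_mat n n" "B \<in> carrier_mat n n"
  shows "A = B"
proof (cases k)
  case (Suc k')
  then show ?thesis
    using assms block_sum_eqD[of A "copies k' A" B "copies k' B" n "Suc k' * n"] copies_carrier
    by simp
qed (use assms in simp)

section \<open>Strict contractions\<close>

text \<open>
  A uniform bound \<open>c < 1\<close> on vectors is more convenient than a bound on the operator norm, which is a
  supremum; it implies that bound.
\<close>

definition strict_contraction :: "complex mat \<Rightarrow> bool" where
  "strict_contraction A \<longleftrightarrow> (\<exists>c. 0 \<le> c \<and> c < 1 \<and>
     (\<forall>v \<in> carrier_vec (dim_col A). cvec_norm (A *\<^sub>v v) \<le> c * cvec_norm v))"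

lemma cvec_norm_nonneg: "0 \<le> cvec_norm v"
  by (simp add: cvec_norm_def L2_set_nonneg)

lemma cvec_norm_square: "(cvec_norm v)\<^sup>2 = (\<Sum>i<dim_vec v. (cmod (v $ i))\<^sup>2)"
  by (simp add: cvec_norm_def L2_set_def sum_nonneg)

lemma cvec_norm_add:
  assumes "v \<in> carrier_vec n" "w \<in> carrier_vec n"
  shows "cvec_norm (v + w) \<le> cvec_norm v + cvec_norm w"
proof -
  have "cvec_norm (v + w) = L2_set (\<lambda>i. cmod (v $ i + w $ i)) {..<n}"
    unfolding cvec_norm_def using assms by (intro L2_set_cong) auto
  also have "\<dots> \<le> L2_set (\<lambda>i. cmod (v $ i) + cmod (w $ i)) {..<n}"
    by (intro L2_set_mono) (auto intro: norm_triangle_ineq)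
  also have "\<dots> \<le> L2_set (\<lambda>i. cmod (v $ i)) {..<n} + L2_set (\<lambda>i. cmod (w $ i)) {..<n}"
    by (rule L2_set_triangle_ineq)
  finally show ?thesis using assms by (simp add: cvec_norm_def)
qed

lemma cvec_norm_smult: "cvec_norm (c \<cdot>\<^sub>v v) = cmod c * cvec_norm v"
proof -
  have "cvec_norm (c \<cdot>\<^sub>v v) = L2_set (\<lambda>i. cmod c * cmod (v $ i)) {..<dim_vec v}"
    unfolding cvec_norm_def by (intro L2_set_cong) (auto simp: norm_mult)
  then show ?thesis by (simp add: cvec_norm_def L2_set_right_distrib)
qed

lemma cvec_norm_mult_mat_le:
  assumes v: "v \<in> carrier_vec (dim_col A)"
  shows "cvec_norm (A *\<^sub>v v) \<le> (\<Sum>i<dim_row A. \<Sum>j<dim_col A. cmod (A $$ (i, j))) * cvec_norm v"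
proof -
  have "cvec_norm (A *\<^sub>v v) \<le> (\<Sum>i<dim_row A. cmod ((A *\<^sub>v v) $ i))"
    unfolding cvec_norm_def dim_mult_mat_vec by (rule L2_set_le_sum) simp
  also have "\<dots> \<le> (\<Sum>i<dim_row A. \<Sum>j<dim_col A. cmod (A $$ (i, j)) * cvec_norm v)"
  proof (intro sum_mono)
    fix i assume "i \<in> {..<dim_row A}"
    then have "(A *\<^sub>v v) $ i = (\<Sum>j<dim_col A. A $$ (i, j) * v $ j)"
      using v by (simp add: scalar_prod_def atLeast0LessThan)
    also have "cmod \<dots> \<le> (\<Sum>j<dim_col A. cmod (A $$ (i, j)) * cmod (v $ j))"
      by (rule order_trans[OF norm_sum]) (simp add: norm_mult)
    also have "\<dots> \<le> (\<Sum>j<dim_col A. cmod (A $$ (i, j)) * cvec_norm v)"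
    proof (intro sum_mono mult_left_mono)
      fix j assume "j \<in> {..<dim_col A}"
      then show "cmod (v $ j) \<le> cvec_norm v"
        unfolding cvec_norm_def using v member_le_L2_set[of "{..<dim_vec v}" j "\<lambda>i. cmod (v $ i)"] by auto
    qed auto
    finally show "cmod ((A *\<^sub>v v) $ i) \<le> (\<Sum>j<dim_col A. cmod (A $$ (i, j)) * cvec_norm v)" .
  qed
  finally show ?thesis by (simp add: sum_distrib_right)
qed

lemma strict_contraction_zero: "strict_contraction (0\<^sub>m n n)"
  unfolding strict_contraction_def
proof (intro exI[of _ 0] conjI ballI)
  fix v :: "complex vec" assume "v \<in> carrier_vec (dim_col (0\<^sub>m n n :: complex mat))"
  then show "cvec_norm (0\<^sub>m n n *\<^sub>v v) \<le> 0 * cvec_norm v"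
    using cvec_norm_mult_mat_le[of v "0\<^sub>m n n"] by simp
qed auto

lemma strict_contraction_op_norm:
  assumes "strict_contraction A"
  shows "op_norm A < 1"
proof -
  obtain c where c: "0 \<le> c" "c < 1" "\<And>v. v \<in> carrier_vec (dim_col A) \<Longrightarrow> cvec_norm (A *\<^sub>v v) \<le> c * cvec_norm v"
    using assms unfolding strict_contraction_def by blast
  have "op_norm A \<le> c"
    unfolding op_norm_def
  proof (rule cSUP_least)
    have "0\<^sub>v (dim_col A) \<in> {v \<in> carrier_vec (dim_col A). cvec_norm v \<le> 1}"
      by (simp add: cvec_norm_def L2_set_def)
    then show "{v \<in> carrier_vec (dim_col A). cvec_norm v \<le> 1} \<noteq> {}" by blast
    fix v assume "v \<in> {v \<in> carrier_vec (dim_col A). cvec_norm v \<le> 1}"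
    then have "cvec_norm (A *\<^sub>v v) \<le> c * cvec_norm v" "cvec_norm v \<le> 1" using c(3) by auto
    then show "cvec_norm (A *\<^sub>v v) \<le> c" using c(1) mult_left_le[of "cvec_norm v" c] by linarith
  qed
  with c(2) show ?thesis by simp
qed

lemma strict_contraction_polydisc:
  fixes X :: "'d::finite \<Rightarrow> complex mat"
  assumes "0 < n" "X \<in> mat_tuples n" "\<And>i. strict_contraction (X i)"
  shows "(n, X) \<in> nc_polydisc"
  using assms strict_contraction_op_norm
  by (auto simp: nc_polydisc_def tuple_norm_def)

lemma sum_lessThan_add: "(\<Sum>i<n + m. f i) = (\<Sum>i<n. f i) + (\<Sum>i<m. f (n + i))" for f :: "nat \<Rightarrow> 'a::comm_monoid_add"
  by (induction m) (auto simp: ac_simps)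

lemma strict_contraction_block_sum:
  assumes cA: "A \<in> carrier_mat n n" and cB: "B \<in> carrier_mat m m"
    and "strict_contraction A" "strict_contraction B"
  shows "strict_contraction (block_sum A B)"
proof -
  obtain c where c: "0 \<le> c" "c < 1" "\<And>v. v \<in> carrier_vec n \<Longrightarrow> cvec_norm (A *\<^sub>v v) \<le> c * cvec_norm v"
    using assms(3) cA unfolding strict_contraction_def by auto
  obtain d where d: "0 \<le> d" "d < 1" "\<And>v. v \<in> carrier_vec m \<Longrightarrow> cvec_norm (B *\<^sub>v v) \<le> d * cvec_norm v"
    using assms(4) cB unfolding strict_contraction_def by auto
  define b where "b = max c d"
  have b: "0 \<le> b" "b < 1" "c \<le> b" "d \<le> b" using c d by (auto simp: b_def)
  have "cvec_norm (block_sum A B *\<^sub>v v) \<le> b * cvec_norm v" if v: "v \<in> carrier_vec (n + m)" for v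
  proof -
    define v1 where "v1 = vec n (\<lambda>i. v $ i)"
    define v2 where "v2 = vec m (\<lambda>i. v $ (n + i))"
    have i1: "(block_sum A B *\<^sub>v v) $ i = (A *\<^sub>v v1) $ i" if "i < n" for i
    proof -
      have "(block_sum A B *\<^sub>v v) $ i = (\<Sum>j<n + m. block_sum A B $$ (i, j) * v $ j)"
        using that v cA cB by (simp add: scalar_prod_def atLeast0LessThan block_sum_def)
      also have "\<dots> = (\<Sum>j<n. A $$ (i, j) * v $ j)"
        unfolding sum_lessThan_add using that cA cB by (simp add: block_sum_def)
      finally show ?thesis using that cA by (simp add: scalar_prod_def atLeast0LessThan v1_def)
    qed
    have i2: "(block_sum A B *\<^sub>v v) $ (n + i) = (B *\<^sub>v v2) $ i" if "i < m" for i
    proof -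
      have "(block_sum A B *\<^sub>v v) $ (n + i) = (\<Sum>j<n + m. block_sum A B $$ (n + i, j) * v $ j)"
        using that v cA cB by (simp add: scalar_prod_def atLeast0LessThan block_sum_def)
      also have "\<dots> = (\<Sum>j<m. B $$ (i, j) * v $ (n + j))"
        unfolding sum_lessThan_add using that cA cB by (simp add: block_sum_def)
      finally show ?thesis using that cB by (simp add: scalar_prod_def atLeast0LessThan v2_def)
    qed
    have "(cvec_norm (block_sum A B *\<^sub>v v))\<^sup>2 = (cvec_norm (A *\<^sub>v v1))\<^sup>2 + (cvec_norm (B *\<^sub>v v2))\<^sup>2"
      using cA cB i1 i2 by (simp add: cvec_norm_square sum_lessThan_add block_sum_def[of A B])
    also have "\<dots> \<le> (b * cvec_norm v1)\<^sup>2 + (b * cvec_norm v2)\<^sup>2"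
    proof (intro add_mono power_mono)
      have "cvec_norm (A *\<^sub>v v1) \<le> c * cvec_norm v1" by (rule c(3)) (simp add: v1_def)
      also have "\<dots> \<le> b * cvec_norm v1" by (intro mult_right_mono b cvec_norm_nonneg)
      finally show "cvec_norm (A *\<^sub>v v1) \<le> b * cvec_norm v1" .
      have "cvec_norm (B *\<^sub>v v2) \<le> d * cvec_norm v2" by (rule d(3)) (simp add: v2_def)
      also have "\<dots> \<le> b * cvec_norm v2" by (intro mult_right_mono b cvec_norm_nonneg)
      finally show "cvec_norm (B *\<^sub>v v2) \<le> b * cvec_norm v2" .
    qed (rule cvec_norm_nonneg)+
    also have "\<dots> = (b * cvec_norm v)\<^sup>2"
      using v by (simp add: power_mult_distrib cvec_norm_square sum_lessThan_add v1_def v2_def distrib_left)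
    finally show ?thesis by (rule power2_le_imp_le) (intro mult_nonneg_nonneg b cvec_norm_nonneg)
  qed
  then show ?thesis
    unfolding strict_contraction_def using b(1,2) cA cB
    by (intro exI[of _ b]) (auto simp: block_sum_def)
qed

lemma strict_contraction_copies:
  assumes "A \<in> carrier_mat n n" "strict_contraction A"
  shows "strict_contraction (copies k A)"
proof (induction k)
  case (Suc k)
  show ?case using strict_contraction_block_sum[OF assms(1) copies_carrier[OF assms(1)] assms(2) Suc.IH] by simp
qed (use assms in simp)

text \<open>
  The entrywise sum norm of \<open>D\<close> bounds its effect on vectors, so a small multiple of \<open>D\<close> uses up only
  a part of the gap \<open>1 - c\<close>.
\<close>

lemma strict_contraction_perturb:
  assumes cA: "A \<in> carrier_mat n n" and cD: "D \<in> carrier_mat n n" and A: "strict_contraction A"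
  shows "\<exists>\<delta>>0. \<forall>s::real. \<bar>s\<bar> < \<delta> \<longrightarrow> strict_contraction (A + complex_of_real s \<cdot>\<^sub>m D)"
proof -
  obtain c where c: "0 \<le> c" "c < 1" "\<And>v. v \<in> carrier_vec n \<Longrightarrow> cvec_norm (A *\<^sub>v v) \<le> c * cvec_norm v"
    using A cA unfolding strict_contraction_def by auto
  define F where "F = (\<Sum>i<n. \<Sum>j<n. cmod (D $$ (i, j)))"
  have F: "0 \<le> F" by (simp add: F_def sum_nonneg)
  define \<delta> where "\<delta> = (1 - c) / (F + 1)"
  have \<delta>: "\<delta> > 0" using c F by (simp add: \<delta>_def)
  have "strict_contraction (A + complex_of_real s \<cdot>\<^sub>m D)" if s: "\<bar>s\<bar> < \<delta>" for s
  proof -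
    have "\<bar>s\<bar> * F \<le> \<bar>s\<bar> * (F + 1)" by (intro mult_left_mono) auto
    also have "\<dots> < \<delta> * (F + 1)" using s F by (intro mult_strict_right_mono) auto
    also have "\<dots> = 1 - c" using F by (simp add: \<delta>_def)
    finally have lt: "c + \<bar>s\<bar> * F < 1" by simp
    have "cvec_norm ((A + complex_of_real s \<cdot>\<^sub>m D) *\<^sub>v v) \<le> (c + \<bar>s\<bar> * F) * cvec_norm v"
      if v: "v \<in> carrier_vec n" for v
    proof -
      have "(A + complex_of_real s \<cdot>\<^sub>m D) *\<^sub>v v = A *\<^sub>v v + complex_of_real s \<cdot>\<^sub>v (D *\<^sub>v v)"
        by (rule eq_vecI)
          (use cA cD v in \<open>auto simp: scalar_prod_def algebra_simps sum.distrib sum_distrib_left\<close>)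
      also have "cvec_norm \<dots> \<le> cvec_norm (A *\<^sub>v v) + cvec_norm (complex_of_real s \<cdot>\<^sub>v (D *\<^sub>v v))"
        by (rule cvec_norm_add[of _ n]) (use cA cD v in auto)
      also have "\<dots> \<le> c * cvec_norm v + \<bar>s\<bar> * (F * cvec_norm v)"
        unfolding cvec_norm_smult F_def
        using c(3)[OF v] cvec_norm_mult_mat_le[of v D] cD v by (intro add_mono mult_mono) (auto simp: cvec_norm_nonneg)
      finally show ?thesis by (simp add: algebra_simps)
    qed
    then show ?thesis
      unfolding strict_contraction_def using lt c F cA cD
      by (intro exI[of _ "c + \<bar>s\<bar> * F"]) auto
  qed
  with \<delta> show ?thesis by blast
qed

section \<open>Lines of matrix tuples\<close>

definition line :: "('d \<Rightarrow> complex mat) \<Rightarrow> ('d \<Rightarrow> complex mat) \<Rightarrow> real \<Rightarrow> 'd \<Rightarrow> complex mat" where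
  "line X Y s = (\<lambda>i. X i + complex_of_real s \<cdot>\<^sub>m (Y i - X i))"

lemma line_tuple: "X \<in> mat_tuples n \<Longrightarrow> Y \<in> mat_tuples n \<Longrightarrow> line X Y s \<in> mat_tuples n"
  unfolding mat_tuples_def line_def
  by (auto intro!: add_carrier_mat smult_carrier_mat minus_carrier_mat)

lemma line_1: "X \<in> mat_tuples n \<Longrightarrow> Y \<in> mat_tuples n \<Longrightarrow> line X Y 1 = Y"
  unfolding line_def by (intro ext eq_matI) (auto simp: mat_tuples_dim)

lemma line_0: "X \<in> mat_tuples n \<Longrightarrow> Y \<in> mat_tuples n \<Longrightarrow> line X Y 0 = X"
  unfolding line_def by (intro ext eq_matI) (auto simp: mat_tuples_dim)

text \<open>
  The parameter of a line is real, so that the adjoint of a point is polynomial in the parameter too: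
  conjugation only affects the coefficients.
\<close>

primrec line_poly :: "nat \<Rightarrow> ('d \<Rightarrow> complex mat) \<Rightarrow> ('d \<Rightarrow> complex mat) \<Rightarrow> 'd star_sym \<Rightarrow> complex poly mat" where
  "line_poly n X Y (Var i) = mat n n (\<lambda>(a, b). [:X i $$ (a, b), Y i $$ (a, b) - X i $$ (a, b):])"
| "line_poly n X Y (VarAdj i) = mat n n (\<lambda>(a, b). [:cnj (X i $$ (b, a)), cnj (Y i $$ (b, a) - X i $$ (b, a)):])"

lemma line_poly_carrier: "line_poly n X Y x \<in> carrier_mat n n"
  by (cases x) auto

lemma eval_star_line:
  assumes "X \<in> mat_tuples n" "Y \<in> mat_tuples n"
  shows "eval_star n (line X Y s) e = eval_expr n (\<lambda>x. poly_mat (complex_of_real s) (line_poly n X Y x)) e"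
proof -
  have "sym_val (line X Y s) x = poly_mat (complex_of_real s) (line_poly n X Y x)" for x
    using assms by (cases x) (auto simp: line_def mat_tuples_dim intro!: eq_matI)
  then have "sym_val (line X Y s) = (\<lambda>x. poly_mat (complex_of_real s) (line_poly n X Y x))" by blast
  then show ?thesis by (simp add: eval_star_def)
qed

lemma line_finite_undefined:
  assumes X: "X \<in> mat_tuples n" and Y: "Y \<in> mat_tuples n"
    and "eval_star n (line X Y s0) e \<noteq> None"
  shows "finite {s. eval_star n (line X Y s) e = None}"
proof -
  have "finite {t. eval_expr n (\<lambda>x. poly_mat t (line_poly n X Y x)) e = None}"
    using assms(3) unfolding eval_star_line[OF X Y] by (rule eval_expr_cofinite[OF line_poly_carrier])
  then have "finite (complex_of_real -` {t. eval_expr n (\<lambda>x. poly_mat t (line_poly n X Y x)) e = None})"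
    by (rule finite_vimageI) (simp add: inj_on_def)
  then show ?thesis by (simp add: eval_star_line[OF X Y] vimage_def)
qed

text \<open>
  Openness of the strict contractions and cofiniteness of the domains meet on a line that starts at a
  strict contraction: it suffices that each expression is defined at one of the two ends.
\<close>

lemma line_generic:
  fixes X :: "'d::finite \<Rightarrow> complex mat"
  assumes X: "X \<in> mat_tuples n" and Y: "Y \<in> mat_tuples n"
    and strict: "\<And>i. strict_contraction (X i)"
    and es: "finite es" "\<And>e. e \<in> es \<Longrightarrow> eval_star n X e \<noteq> None \<or> eval_star n Y e \<noteq> None"
  shows "infinite {s. (\<forall>i. strict_contraction (line X Y s i)) \<and> (\<forall>e\<in>es. eval_star n (line X Y s) e \<noteq> None)}"
    (is "infinite ?S")
proof -
  have "\<exists>\<delta>>0. \<forall>s::real. \<bar>s\<bar> < \<delta> \<longrightarrow> strict_contraction (line X Y s i)" for i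
    unfolding line_def using X Y
    by (intro strict_contraction_perturb[of _ n] strict) (auto simp: mat_tuples_def intro: minus_carrier_mat)
  then obtain \<delta> where \<delta>: "\<And>i. \<delta> i > 0" "\<And>i s. \<bar>s\<bar> < \<delta> i \<Longrightarrow> strict_contraction (line X Y s i)"
    by metis
  define \<delta>0 where "\<delta>0 = Min (range \<delta>)"
  have "\<delta>0 > 0" using \<delta>(1) by (auto simp: \<delta>0_def)
  then have inf: "infinite {0<..<\<delta>0}" by (rule infinite_Ioo)
  define bad where "bad = (\<Union>e\<in>es. {s. eval_star n (line X Y s) e = None})"
  have "finite {s. eval_star n (line X Y s) e = None}" if "e \<in> es" for e
    using es(2)[OF that] line_finite_undefined[OF X Y, of 0 e] line_finite_undefined[OF X Y, of 1 e]
    by (auto simp: line_0[OF X Y] line_1[OF X Y])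
  then have "finite bad" using es(1) by (simp add: bad_def)
  with inf have "infinite ({0<..<\<delta>0} - bad)" by simp
  moreover have "{0<..<\<delta>0} - bad \<subseteq> ?S"
  proof
    fix s assume s: "s \<in> {0<..<\<delta>0} - bad"
    have "\<delta>0 \<le> \<delta> i" for i by (simp add: \<delta>0_def)
    then have "\<bar>s\<bar> < \<delta> i" for i using s by (smt (verit) Diff_iff greaterThanLessThan_iff)
    then show "s \<in> ?S" using \<delta>(2) s by (auto simp: bad_def)
  qed
  ultimately show ?thesis by (rule infinite_super[rotated])
qed

section \<open>Common domains\<close>

definition strict_dom :: "'d star_expr set \<Rightarrow> (nat \<times> ('d \<Rightarrow> complex mat)) set" where
  "strict_dom es = {(n, X). 0 < n \<and> X \<in> mat_tuples n \<and> (\<forall>i. strict_contraction (X i)) \<and>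
     (\<forall>e\<in>es. eval_star n X e \<noteq> None)}"

lemma strict_dom_copies:
  assumes "(n, X) \<in> strict_dom es"
  shows "(Suc k * n, \<lambda>i. copies k (X i)) \<in> strict_dom es"
  using assms unfolding strict_dom_def
  by (auto simp: copies_tuple eval_star_copies simp del: mult_Suc
      intro!: strict_contraction_copies[of _ n]) (auto simp: mat_tuples_def)

text \<open>
  A point for a finite set of expressions and a point for one more expression have copies of equal
  size, and the line between these copies contains a common point.
\<close>

lemma strict_dom_nonempty:
  fixes es :: "'d::finite star_expr set"
  assumes "finite es" "\<And>e. e \<in> es \<Longrightarrow> star_dom e \<noteq> {}"
  shows "strict_dom es \<noteq> {}"
  using assms
proof (induction es rule: finite_induct)
  case empty
  have "(1, \<lambda>_. 0\<^sub>m 1 1) \<in> strict_dom {}"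
    by (auto simp: strict_dom_def mat_tuples_def strict_contraction_zero)
  then show ?case by blast
next
  case (insert e es)
  obtain n X where X: "(n, X) \<in> strict_dom es" using insert by fastforce
  obtain m Y where Y: "(m, Y) \<in> star_dom e" using insert.prems[of e] by fastforce
  have nm: "0 < n" "0 < m" and X': "X \<in> mat_tuples n" and Y': "Y \<in> mat_tuples m"
    using X Y by (auto simp: strict_dom_def star_dom_def)
  define N where "N = n * m"
  define X2 where "X2 = (\<lambda>i. copies (m - 1) (X i))"
  define Y2 where "Y2 = (\<lambda>i. copies (n - 1) (Y i))"
  have N: "Suc (m - 1) * n = N" "Suc (n - 1) * m = N" using nm by (simp_all add: N_def del: mult_Suc)
  have X2: "(N, X2) \<in> strict_dom es"
    using strict_dom_copies[OF X, of "m - 1"] by (simp only: N X2_def)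
  have Y2: "Y2 \<in> mat_tuples N" using copies_tuple[OF Y', of "n - 1"] by (simp only: N Y2_def)
  have Ye: "eval_star N Y2 e \<noteq> None"
    using Y eval_star_copies[OF Y', of e _ "n - 1"] unfolding N Y2_def by (auto simp: star_dom_def)
  have X2': "X2 \<in> mat_tuples N" "\<And>i. strict_contraction (X2 i)" using X2 by (auto simp: strict_dom_def)
  have "infinite {s. (\<forall>i. strict_contraction (line X2 Y2 s i)) \<and>
      (\<forall>e\<in>insert e es. eval_star N (line X2 Y2 s) e \<noteq> None)}"
    by (rule line_generic[OF X2'(1) Y2 X2'(2)])
      (use Ye X2 insert.hyps in \<open>auto simp: strict_dom_def\<close>)
  then obtain s where "\<And>i. strict_contraction (line X2 Y2 s i)"
    "\<And>e'. e' \<in> insert e es \<Longrightarrow> eval_star N (line X2 Y2 s) e' \<noteq> None"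
    using not_finite_existsD by blast
  then have "(N, line X2 Y2 s) \<in> strict_dom (insert e es)"
    using nm line_tuple[OF X2'(1) Y2, of s] by (auto simp: strict_dom_def N_def)
  then show ?case by blast
qed

text \<open>
  The given point and a strictly contractive point of the common domain have copies of equal size. On
  the line from the second to the first, the two expressions agree at infinitely many members near the
  start, and therefore agree at the end.
\<close>

theorem eval_star_eq_of_strict_dom:
  fixes e e' :: "'d::finite star_expr"
  assumes "finite es" "\<And>f. f \<in> es \<Longrightarrow> star_dom f \<noteq> {}"
    and agree: "\<And>n X. (n, X) \<in> strict_dom es \<Longrightarrow> eval_star n X e \<noteq> None \<Longrightarrow> eval_star n X e' \<noteq> None \<Longrightarrow>
      eval_star n X e = eval_star n X e'"
    and X: "(n, X) \<in> star_dom e" "(n, X) \<in> star_dom e'"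
  shows "eval_star n X e = eval_star n X e'"
proof -
  have "strict_dom (insert e (insert e' es)) \<noteq> {}"
    by (rule strict_dom_nonempty) (use assms in auto)
  then obtain m Z where Z: "(m, Z) \<in> strict_dom (insert e (insert e' es))" by fast
  have nm: "0 < n" "0 < m" and X': "X \<in> mat_tuples n" and Z': "Z \<in> mat_tuples m"
    using X Z by (auto simp: strict_dom_def star_dom_def)
  obtain E E' where E: "eval_star n X e = Some E" "eval_star n X e' = Some E'"
    using X by (auto simp: star_dom_def)
  define N where "N = n * m"
  define X2 where "X2 = (\<lambda>i. copies (m - 1) (X i))"
  define Z2 where "Z2 = (\<lambda>i. copies (n - 1) (Z i))"
  have N: "Suc (m - 1) * n = N" "Suc (n - 1) * m = N" using nm by (simp_all add: N_def del: mult_Suc)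
  have Z2: "(N, Z2) \<in> strict_dom (insert e (insert e' es))"
    using strict_dom_copies[OF Z, of "n - 1"] by (simp only: N Z2_def)
  have X2: "X2 \<in> mat_tuples N" using copies_tuple[OF X', of "m - 1"] by (simp only: N X2_def)
  have E2: "eval_star N X2 e = Some (copies (m - 1) E)" "eval_star N X2 e' = Some (copies (m - 1) E')"
    using eval_star_copies[OF X' E(1), of "m - 1"] eval_star_copies[OF X' E(2), of "m - 1"]
    by (simp_all only: N X2_def)
  have Z2': "Z2 \<in> mat_tuples N" using Z2 by (auto simp: strict_dom_def)
  define S where "S = {s. (\<forall>i. strict_contraction (line Z2 X2 s i)) \<and>
      (\<forall>f\<in>insert e (insert e' es). eval_star N (line Z2 X2 s) f \<noteq> None)}"
  have S: "infinite S"
    unfolding S_def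
    by (rule line_generic[OF Z2' X2]) (use Z2 assms(1) in \<open>auto simp: strict_dom_def\<close>)
  have "(N, line Z2 X2 s) \<in> strict_dom (insert e (insert e' es))" if "s \<in> S" for s
    using that nm line_tuple[OF Z2' X2, of s] by (auto simp: strict_dom_def S_def N_def)
  then have eq: "eval_star N (line Z2 X2 s) e = eval_star N (line Z2 X2 s) e'" if "s \<in> S" for s
    using that by (intro agree) (auto simp: strict_dom_def)
  note ev = eval_star_line[OF Z2' X2, of 1, unfolded line_1[OF Z2' X2], symmetric]
  have "eval_expr N (\<lambda>x. poly_mat (complex_of_real 1) (line_poly N Z2 X2 x)) e =
      eval_expr N (\<lambda>x. poly_mat (complex_of_real 1) (line_poly N Z2 X2 x)) e'"
  proof (rule eval_expr_identity[where S = "complex_of_real ` S"])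
    show "infinite (complex_of_real ` S)" using S by (simp add: finite_image_iff inj_on_def)
    show "eval_expr N (\<lambda>x. poly_mat (complex_of_real 1) (line_poly N Z2 X2 x)) e \<noteq> None"
      "eval_expr N (\<lambda>x. poly_mat (complex_of_real 1) (line_poly N Z2 X2 x)) e' \<noteq> None"
      unfolding ev using E2 by auto
    fix t assume "t \<in> complex_of_real ` S"
    then obtain s where "s \<in> S" "t = complex_of_real s" by blast
    then show "eval_expr N (\<lambda>x. poly_mat t (line_poly N Z2 X2 x)) e =
        eval_expr N (\<lambda>x. poly_mat t (line_poly N Z2 X2 x)) e'"
      using eq[of s] by (simp only: eval_star_line[OF Z2' X2])
  qed (rule line_poly_carrier)
  then have "copies (m - 1) E = copies (m - 1) E'"
    unfolding ev E2 by simp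
  then have "E = E'"
    by (rule copies_eqD) (use eval_star_carrier[OF X'] E in auto)
  with E show ?thesis by simp
qed

lemma star_relI:
  fixes e e' :: "'d::finite star_expr"
  assumes "star_dom e \<noteq> {}" "star_dom e' \<noteq> {}" "finite es" "\<And>f. f \<in> es \<Longrightarrow> star_dom f \<noteq> {}"
    and "\<And>n X. (n, X) \<in> strict_dom es \<Longrightarrow> eval_star n X e \<noteq> None \<Longrightarrow> eval_star n X e' \<noteq> None \<Longrightarrow>
      eval_star n X e = eval_star n X e'"
  shows "(e, e') \<in> star_rel"
  unfolding star_rel_def using assms eval_star_eq_of_strict_dom[of es e e'] by blast

lemma star_relD:
  assumes "(e, f) \<in> star_rel" "(n, X) \<in> star_dom e" "(n, X) \<in> star_dom f"
  shows "eval_star n X e = eval_star n X f"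
  using assms unfolding star_rel_def by auto

lemma star_rel_sym: "(e, f) \<in> star_rel \<Longrightarrow> (f, e) \<in> star_rel"
proof -
  assume r: "(e, f) \<in> star_rel"
  have "eval_star n X f = eval_star n X e" if "(n, X) \<in> star_dom f" "(n, X) \<in> star_dom e" for n X
    using star_relD[OF r that(2,1)] by simp
  moreover have "star_dom e \<noteq> {}" "star_dom f \<noteq> {}" using r by (auto simp: star_rel_def)
  ultimately show ?thesis unfolding star_rel_def by auto
qed

text \<open>
  The domains of \<open>e\<close> and \<open>g\<close> may meet where \<open>f\<close> is undefined; the identity principle bridges this.
\<close>

lemma star_rel_trans:
  fixes e f g :: "'d::finite star_expr"
  assumes "(e, f) \<in> star_rel" "(f, g) \<in> star_rel"
  shows "(e, g) \<in> star_rel"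
proof (rule star_relI[where es = "{f}"])
  fix n X assume "(n, X) \<in> strict_dom {f}" "eval_star n X e \<noteq> None" "eval_star n X g \<noteq> None"
  then have "(n, X) \<in> star_dom e" "(n, X) \<in> star_dom f" "(n, X) \<in> star_dom g"
    by (auto simp: strict_dom_def star_dom_def)
  then show "eval_star n X e = eval_star n X g"
    using star_relD[OF assms(1)] star_relD[OF assms(2)] by simp
qed (use assms in \<open>auto simp: star_rel_def\<close>)

lemma star_class_eqI:
  fixes e f :: "'d::finite star_expr"
  assumes "(e, f) \<in> star_rel"
  shows "star_class e = star_class f"
  using assms star_rel_sym[OF assms] unfolding star_class_def by (auto intro: star_rel_trans)

section \<open>Hermitian forms and Gram--Schmidt\<close>

definition cscale :: "complex \<Rightarrow> ('i \<Rightarrow> complex) \<Rightarrow> 'i \<Rightarrow> complex" where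
  "cscale c f = (\<lambda>i. c * f i)"

lemma cscale_apply [simp]: "cscale c f i = c * f i"
  by (simp add: cscale_def)

text \<open>
  Functions into the complex numbers serve as coefficient vectors, as matrices (indexed by pairs), and
  as functions on a set of matrix points.
\<close>

interpretation cfun: vector_space "cscale :: complex \<Rightarrow> ('i \<Rightarrow> complex) \<Rightarrow> 'i \<Rightarrow> complex"
  by unfold_locales (auto simp: fun_eq_iff algebra_simps)

lemma sum_fun_apply: "(\<Sum>a\<in>A. f a) x = (\<Sum>a\<in>A. f a x)" for f :: "'a \<Rightarrow> 'i \<Rightarrow> 'b::comm_monoid_add"
  by (induction A rule: infinite_finite_induct) auto

locale herm_space = vector_space scale
  for scale :: "complex \<Rightarrow> 'v \<Rightarrow> 'v::ab_group_add" (infixr "*s" 75) +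
  fixes B :: "'v \<Rightarrow> 'v \<Rightarrow> complex"
  assumes add_left: "B (f + g) h = B f h + B g h"
    and scale_left: "B (c *s f) h = c * B f h"
    and sym: "B g f = cnj (B f g)"
begin

lemma add_right: "B h (f + g) = B h f + B h g"
  by (metis add_left complex_cnj_add sym)

lemma scale_right: "B h (c *s f) = cnj c * B h f"
  by (metis complex_cnj_mult scale_left sym)

lemma zero_left: "B 0 h = 0"
  using scale_left[of 0 0 h] by simp

lemma diff_left: "B (f - g) h = B f h - B g h"
  by (metis add_diff_cancel_right' diff_add_cancel add_left)

lemma diff_right: "B h (f - g) = B h f - B h g"
  by (metis add_diff_cancel_right' diff_add_cancel add_right)

lemma sum_left: "B (\<Sum>a\<in>A. f a) h = (\<Sum>a\<in>A. B (f a) h)"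
  by (induction A rule: infinite_finite_induct) (auto simp: zero_left add_left)

lemma sum_right: "B h (\<Sum>a\<in>A. f a) = (\<Sum>a\<in>A. B h (f a))"
  using arg_cong[OF sum_left[of f A h], of cnj]
  by (simp flip: sym)

lemmas sesquilinear = add_left add_right diff_left diff_right scale_left scale_right sum_left sum_right

lemma diag: "B f f = complex_of_real (Re (B f f))"
  using sym[of f f] by (simp add: complex_eq_iff)

text \<open>
  If \<open>B r r = 0\<close>, then \<open>B (x + a r) (x + a r)\<close> is affine in the real and imaginary parts of
  \<open>a\<close>; it can only be bounded below if its slope \<open>B r x\<close> vanishes.
\<close>

lemma null_orthogonal:
  assumes W: "subspace W" and psd: "\<And>f. f \<in> W \<Longrightarrow> 0 \<le> Re (B f f)"
    and r: "r \<in> W" "B r r = 0" and x: "x \<in> W"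
  shows "B r x = 0"
proof (rule ccontr)
  let ?c = "B r x"
  assume c: "?c \<noteq> 0"
  \<comment> \<open>This choice makes the value of the form at \<open>v\<close> equal to \<open>-1\<close>.\<close>
  define t where "t = (Re (B x x) + 1) / (2 * (cmod ?c)\<^sup>2)"
  define v where "v = x + scale (- complex_of_real t * cnj ?c) r"
  have "v \<in> W" unfolding v_def by (intro subspace_add subspace_scale W r x)
  then have "0 \<le> Re (B v v)" by (rule psd)
  also have "B v v = B x x - complex_of_real t * (cnj ?c * B r x + ?c * B x r)"
    unfolding v_def by (simp add: sesquilinear r(2) algebra_simps)
  also have "B x r = cnj ?c" by (rule sym)
  also have "cnj ?c * B r x + ?c * cnj ?c = complex_of_real (2 * (cmod ?c)\<^sup>2)"
    using complex_norm_square[of ?c] by (simp add: mult.commute)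
  also have "Re (B x x - complex_of_real t * complex_of_real (2 * (cmod ?c)\<^sup>2)) = - 1"
    using c by (simp add: t_def)
  finally show False by simp
qed

definition orthonormal :: "(nat \<Rightarrow> 'v) \<Rightarrow> nat \<Rightarrow> bool" where
  "orthonormal e l \<longleftrightarrow> (\<forall>i<l. \<forall>j<l. B (e i) (e j) = (if i = j then 1 else 0))"

definition proj :: "(nat \<Rightarrow> 'v) \<Rightarrow> nat \<Rightarrow> 'v \<Rightarrow> 'v" where
  "proj e l f = (\<Sum>i<l. scale (B f (e i)) (e i))"

lemma orthonormal_comb:
  assumes e: "orthonormal e l"
  shows "B (\<Sum>i<l. x i *s e i) (\<Sum>i<l. x i *s e i) = complex_of_real (\<Sum>i<l. (cmod (x i))\<^sup>2)"
proof -
  let ?f = "\<Sum>i<l. x i *s e i"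
  have right: "B (e i) ?f = cnj (x i)" if i: "i < l" for i
  proof -
    have "B (e i) ?f = (\<Sum>j<l. if j = i then cnj (x j) else 0)"
      unfolding sum_right scale_right using e i by (intro sum.cong) (auto simp: orthonormal_def)
    then show ?thesis using i by simp
  qed
  have "B ?f ?f = (\<Sum>i<l. x i * B (e i) ?f)" by (simp only: sum_left scale_left)
  also have "\<dots> = (\<Sum>i<l. complex_of_real ((cmod (x i))\<^sup>2))"
    unfolding complex_norm_square by (intro sum.cong) (simp_all add: right)
  finally show ?thesis by simp
qed

lemma proj_cong: "(\<And>i. i < l \<Longrightarrow> e i = e' i) \<Longrightarrow> proj e l f = proj e' l f"
  unfolding proj_def by (auto intro!: sum.cong)

lemma proj_residual_orthogonal:
  assumes e: "orthonormal e l" and j: "j < l"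
  shows "B (f - proj e l f) (e j) = 0"
proof -
  have "B (proj e l f) (e j) = (\<Sum>i<l. B f (e i) * (if i = j then 1 else 0))"
    unfolding proj_def sum_left scale_left
    by (intro sum.cong) (use e j in \<open>auto simp: orthonormal_def\<close>)
  also have "\<dots> = B f (e j)" using j by (simp add: if_distrib cong: if_cong)
  finally show ?thesis by (simp add: sesquilinear)
qed

lemma proj_in_subspace:
  "subspace W \<Longrightarrow> (\<And>i. i < l \<Longrightarrow> e i \<in> W) \<Longrightarrow> proj e l f \<in> W"
  unfolding proj_def by (intro subspace_sum subspace_scale) auto

lemma proj_linear:
  shows "proj e l (f + g) = proj e l f + proj e l g"
    and "proj e l (scale c f) = scale c (proj e l f)"
    and "proj e l (f - g) = proj e l f - proj e l g"
  unfolding proj_def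
  by (simp_all add: sesquilinear scale_left_distrib scale_left_diff_distrib sum.distrib
      scale_sum_right sum_subtractf)

text \<open>
  The form is only semidefinite on \<open>W\<close>, and the vectors may be dependent: a residual of length zero
  adds no new vector, since it is orthogonal to all of \<open>W\<close> anyway. For a definite form the conclusion
  says that the orthonormal vectors span; for a semidefinite one it still gives a sum-of-squares
  decomposition. Extending a given system makes it possible to adapt a basis to a subspace.
\<close>

theorem gram_schmidt_extend:
  assumes W: "subspace W" and psd: "\<And>f. f \<in> W \<Longrightarrow> 0 \<le> Re (B f f)"
    and "orthonormal e l" and "\<And>i. i < l \<Longrightarrow> e i \<in> W" and "set us \<subseteq> W"
  shows "\<exists>e' l'. l \<le> l' \<and> (\<forall>i<l. e' i = e i) \<and> orthonormal e' l' \<and>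
    (\<forall>i<l'. e' i \<in> span (e ` {..<l} \<union> set us)) \<and>
    (\<forall>u \<in> span (e ` {..<l} \<union> set us). \<forall>x\<in>W. B (u - proj e' l' u) x = 0)"
  using assms(3-)
proof (induction us arbitrary: e l)
  case Nil
  \<comment> \<open>The projection fixes the span of the given vectors.\<close>
  have "B (u - proj e l u) x = 0" if "u \<in> span (e ` {..<l})" "x \<in> W" for u x
    using that(1)
  proof (induction rule: span_induct_alt)
    case base
    show ?case using proj_linear(2)[of e l 0 0] by (simp add: zero_left)
  next
    case (step c v y)
    then obtain j where j: "j < l" "v = e j" by auto
    have "proj e l v = (\<Sum>i<l. if i = j then e j else 0)"
      unfolding proj_def j(2) using Nil(1) j(1)
      by (intro sum.cong) (auto simp: orthonormal_def)
    also have "\<dots> = v" using j by simp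
    finally have "proj e l v = v" .
    with step.IH show ?case
      by (simp add: proj_linear sesquilinear)
  qed
  then show ?case using Nil
    by (intro exI[of _ e] exI[of _ l]) (auto intro: span_base)
next
  case (Cons u us)
  define r where "r = u - proj e l u"
  have u: "u \<in> W" and us: "set us \<subseteq> W" using Cons.prems by auto
  have r: "r \<in> W"
    unfolding r_def using u Cons.prems(2) by (intro subspace_diff proj_in_subspace W)
  have orth: "B r (e j) = 0" if "j < l" for j
    unfolding r_def by (rule proj_residual_orthogonal[OF Cons.prems(1) that])
  have proj_span: "proj e l u \<in> span (e ` {..<l})"
    by (rule proj_in_subspace) (auto intro: span_base)
  show ?case
  proof (cases "B r r = 0")
    case True
    have null: "B r x = 0" if "x \<in> W" for x
      by (rule null_orthogonal[OF W psd r True that])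
    obtain e' l' where e': "l \<le> l'" "\<forall>i<l. e' i = e i" "orthonormal e' l'"
      "\<forall>i<l'. e' i \<in> span (e ` {..<l} \<union> set us)"
      "\<forall>u \<in> span (e ` {..<l} \<union> set us). \<forall>x\<in>W. B (u - proj e' l' u) x = 0"
      using Cons.IH[OF Cons.prems(1,2) us] by blast
    have e'W: "e' i \<in> W" if "i < l'" for i
    proof -
      have "span (e ` {..<l} \<union> set us) \<subseteq> W"
        using Cons.prems(2) us by (intro span_minimal W) auto
      with e'(4) that show ?thesis by blast
    qed
    have rr: "B (r - proj e' l' r) x = 0" if "x \<in> W" for x
    proof -
      have "proj e' l' r = 0"
        unfolding proj_def by (intro sum.neutral) (auto simp: null e'W)
      then show ?thesis using null that by simp
    qed
    have span_eq: "u' \<in> span (e ` {..<l} \<union> set (u # us)) \<longleftrightarrow>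
        (\<exists>k. u' - scale k u \<in> span (e ` {..<l} \<union> set us))" for u'
      by (simp add: span_breakdown_eq)
    have "B (u' - proj e' l' u') x = 0"
      if u': "u' \<in> span (e ` {..<l} \<union> set (u # us))" and x: "x \<in> W" for u' x
    proof -
      from u' span_eq obtain k where k: "u' - scale k u \<in> span (e ` {..<l} \<union> set us)" by blast
      define w where "w = u' - scale k u + scale k (proj e l u)"
      have "w \<in> span (e ` {..<l} \<union> set us)"
        unfolding w_def
        using k proj_span span_mono[of "e ` {..<l}" "e ` {..<l} \<union> set us"]
        by (intro span_add span_scale) blast+
      then have w: "B (w - proj e' l' w) x = 0" using e'(5) x by blast
      have "u' = w + scale k r" unfolding w_def r_def by (simp add: scale_right_diff_distrib)
      then show ?thesis using w rr[OF x]
        by (simp add: proj_linear sesquilinear algebra_simps)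
    qed
    moreover have "span (e ` {..<l} \<union> set us) \<subseteq> span (e ` {..<l} \<union> set (u # us))"
      by (intro span_mono) auto
    ultimately show ?thesis using e' by blast
  next
    case False
    define a where "a = sqrt (Re (B r r))"
    have "0 < Re (B r r)"
      using psd[OF r] False diag[of r] by (metis less_eq_real_def of_real_0)
    then have a: "a > 0" "complex_of_real a * complex_of_real a = B r r"
      unfolding a_def using diag[of r]
      by (simp_all flip: of_real_mult)
    define f where "f = e(l := scale (1 / complex_of_real a) r)"
    have fl: "f i = e i" if "i < l" for i using that by (simp add: f_def)
    have orth': "B (e j) r = 0" if "j < l" for j
      using orth[OF that] sym[of "e j" r] by simp
    have 1: "orthonormal f (Suc l)"
      using Cons.prems(1) a orth orth'
      unfolding orthonormal_def f_def
      by (auto simp: less_Suc_eq sesquilinear power2_eq_square field_simps)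
    have 2: "f i \<in> W" if "i < Suc l" for i
      using that Cons.prems(2) r W by (auto simp: f_def less_Suc_eq subspace_scale)
    obtain e' l' where e': "Suc l \<le> l'" "\<forall>i<Suc l. e' i = f i" "orthonormal e' l'"
      "\<forall>i<l'. e' i \<in> span (f ` {..<Suc l} \<union> set us)"
      "\<forall>u \<in> span (f ` {..<Suc l} \<union> set us). \<forall>x\<in>W. B (u - proj e' l' u) x = 0"
      using Cons.IH[OF 1 2 us] by blast
    have im: "f ` {..<Suc l} = insert (scale (1 / complex_of_real a) r) (e ` {..<l})"
      by (auto simp: f_def lessThan_Suc)
    have "r \<in> span (e ` {..<l} \<union> set (u # us))"
      unfolding r_def using proj_span span_mono[of "e ` {..<l}" "e ` {..<l} \<union> set (u # us)"]
      by (intro span_diff span_base[of u]) (simp, blast)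
    then have "f ` {..<Suc l} \<union> set us \<subseteq> span (e ` {..<l} \<union> set (u # us))"
      unfolding im by (auto intro: span_base span_scale)
    then have s1: "span (f ` {..<Suc l} \<union> set us) \<subseteq> span (e ` {..<l} \<union> set (u # us))"
      by (rule span_minimal) simp
    have "scale (complex_of_real a) (f l) \<in> span (f ` {..<Suc l} \<union> set us)"
      by (intro span_scale span_base) auto
    moreover have "scale (complex_of_real a) (f l) = r" using a by (simp add: f_def)
    moreover have "e ` {..<l} \<subseteq> f ` {..<Suc l} \<union> set us" unfolding im by auto
    then have es: "span (e ` {..<l}) \<subseteq> span (f ` {..<Suc l} \<union> set us)"
      by (rule span_mono)
    ultimately have "r + proj e l u \<in> span (f ` {..<Suc l} \<union> set us)"
      using proj_span by (intro span_add) auto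
    then have "u \<in> span (f ` {..<Suc l} \<union> set us)" by (simp add: r_def)
    then have "e ` {..<l} \<union> set (u # us) \<subseteq> span (f ` {..<Suc l} \<union> set us)"
      unfolding im by (auto intro: span_base)
    then have s2: "span (e ` {..<l} \<union> set (u # us)) \<subseteq> span (f ` {..<Suc l} \<union> set us)"
      by (rule span_minimal) simp
    have "span (e ` {..<l} \<union> set (u # us)) = span (f ` {..<Suc l} \<union> set us)"
      using s1 s2 by blast
    moreover have "l \<le> l'" using e'(1) by simp
    moreover have "\<forall>i<l. e' i = e i" using e'(2) fl by simp
    ultimately show ?thesis using e'(3-5) by (intro exI[of _ e'] exI[of _ l']) simp
  qed
qed

corollary gram_schmidt:
  assumes "subspace W" "\<And>f. f \<in> W \<Longrightarrow> 0 \<le> Re (B f f)" "set us \<subseteq> W"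
  obtains e l where "orthonormal e l" "\<And>i. i < l \<Longrightarrow> e i \<in> span (set us)"
    "\<And>u x. u \<in> span (set us) \<Longrightarrow> x \<in> W \<Longrightarrow> B (u - proj e l u) x = 0"
proof -
  have 1: "orthonormal (\<lambda>_. 0) 0" by (simp add: orthonormal_def)
  show ?thesis
    using gram_schmidt_extend[OF assms(1,2) 1 _ assms(3)] that by auto
qed

end

section \<open>Positive semidefinite coefficient arrays\<close>

definition psd_array :: "'a set \<Rightarrow> ('a \<times> 'a \<Rightarrow> complex) \<Rightarrow> bool" where
  "psd_array A M \<longleftrightarrow> (\<forall>i\<in>A. \<forall>j\<in>A. M (j, i) = cnj (M (i, j))) \<and>
     (\<forall>x. 0 \<le> Re (\<Sum>i\<in>A. \<Sum>j\<in>A. M (i, j) * cnj (x i) * x j))"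

text \<open>
  Gram--Schmidt for the semidefinite form with matrix \<open>M\<close>, applied to the unit vectors: their
  coefficients are the entries of a factorization of Cholesky type.
\<close>

lemma psd_array_sum_of_squares:
  assumes A: "finite A" and "psd_array A M"
  shows "\<exists>K d. \<forall>i\<in>A. \<forall>j\<in>A. M (i, j) = (\<Sum>k<K. cnj (d k i) * d (k :: nat) j)"
proof -
  define B where "B x y = (\<Sum>i\<in>A. \<Sum>j\<in>A. M (i, j) * cnj (y i) * x j)" for x y :: "'a \<Rightarrow> complex"
  have M: "M (j, i) = cnj (M (i, j))" if "i \<in> A" "j \<in> A" for i j
    using assms that unfolding psd_array_def by blast
  interpret H: herm_space cscale B
  proof
    fix f g h :: "'a \<Rightarrow> complex" and c
    show "B (f + g) h = B f h + B g h" by (simp add: B_def algebra_simps sum.distrib)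
    show "B (cscale c f) h = c * B f h" by (simp add: B_def sum_distrib_left algebra_simps)
    have "cnj (B f g) = (\<Sum>i\<in>A. \<Sum>j\<in>A. cnj (M (i, j)) * g i * cnj (f j))"
      by (simp add: B_def cnj_sum)
    also have "\<dots> = (\<Sum>j\<in>A. \<Sum>i\<in>A. M (j, i) * cnj (f j) * g i)"
      by (subst sum.swap) (intro sum.cong refl, simp add: M[symmetric] ac_simps)
    finally show "B g f = cnj (B f g)" by (simp add: B_def)
  qed
  define u where "u k = (\<lambda>i. if i = k then 1 else 0 :: complex)" for k :: 'a
  have Bu: "B (u j) (u i) = M (i, j)" if "i \<in> A" "j \<in> A" for i j
  proof -
    have "B (u j) (u i) = (\<Sum>i'\<in>A. \<Sum>j'\<in>A. if i' = i then (if j' = j then M (i', j') else 0) else 0)"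
      unfolding B_def u_def by (intro sum.cong) auto
    also have "\<dots> = (\<Sum>i'\<in>A. if i' = i then M (i', j) else 0)"
      using that A by (intro sum.cong) auto
    also have "\<dots> = M (i, j)" using that A by simp
    finally show ?thesis .
  qed
  have psd: "0 \<le> Re (B f f)" for f
    using assms unfolding B_def psd_array_def by blast
  obtain as where as: "set as = A" using finite_list[OF A] by blast
  obtain e l where e: "\<forall>v \<in> cfun.span ({} \<union> set (map u as)). \<forall>x. B (v - H.proj e l v) x = 0"
    using H.gram_schmidt_extend[of UNIV "\<lambda>_. 0" 0 "map u as"] psd by (auto simp: H.orthonormal_def)
  have "M (i, j) = (\<Sum>k<l. cnj (B (u i) (e k)) * B (u j) (e k))" if ij: "i \<in> A" "j \<in> A" for i j
  proof -
    have "u j \<in> cfun.span ({} \<union> set (map u as))" using ij as by (intro cfun.span_base) auto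
    then have "B (u j - H.proj e l (u j)) (u i) = 0" using e by blast
    then have "M (i, j) = B (H.proj e l (u j)) (u i)" using Bu[OF ij] by (simp add: H.diff_left)
    also have "\<dots> = (\<Sum>k<l. B (u j) (e k) * B (e k) (u i))"
      by (simp add: H.proj_def H.sum_left H.scale_left)
    also have "\<dots> = (\<Sum>k<l. cnj (B (u i) (e k)) * B (u j) (e k))"
      by (intro sum.cong refl) (simp add: H.sym[of _ "u i"] mult.commute)
    finally show ?thesis .
  qed
  then show ?thesis by (intro exI[of _ l] exI[of _ "\<lambda>k i. B (u i) (e k)"]) simp
qed

section \<open>Separating a point from a cone of squares\<close>

lemma compact_pointwise_box:
  fixes S :: "'i \<Rightarrow> complex set"
  assumes "\<And>i. compact (S i)"
  shows "compact {f. \<forall>i. f i \<in> S i}"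
proof -
  have "compactin (product_topology (\<lambda>i. euclidean) UNIV) (PiE UNIV S)"
    using assms by (simp add: compactin_PiE)
  then show ?thesis
    by (simp add: euclidean_product_topology PiE_UNIV_domain Pi_def)
qed

definition cdisc :: "real \<Rightarrow> complex set" where
  "cdisc R = {z. cmod z \<le> R}"

text \<open>
  The disc is a closed subset of a square, which is a continuous image of a product of intervals.
\<close>

lemma compact_cdisc: "compact (cdisc R)"
proof -
  have "compact ((\<lambda>(x, y). complex_of_real x + \<i> * complex_of_real y) ` ({- R..R} \<times> {- R..R}))"
    by (intro compact_continuous_image compact_Times compact_Icc)
      (auto intro!: continuous_intros simp: case_prod_unfold)
  moreover have "closed (cdisc R)"
    unfolding cdisc_def by (intro closed_Collect_le continuous_intros)
  ultimately have "compact ((\<lambda>(x, y). complex_of_real x + \<i> * complex_of_real y) ` ({- R..R} \<times> {- R..R}) \<inter> cdisc R)"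
    by (rule compact_Int_closed)
  moreover have "z \<in> (\<lambda>(x, y). complex_of_real x + \<i> * complex_of_real y) ` ({- R..R} \<times> {- R..R})"
    if "z \<in> cdisc R" for z
  proof
    show "z = (\<lambda>(x, y). complex_of_real x + \<i> * complex_of_real y) (Re z, Im z)"
      by (simp add: complex_eq)
    show "(Re z, Im z) \<in> {- R..R} \<times> {- R..R}"
      using that abs_Re_le_cmod[of z] abs_Im_le_cmod[of z] by (auto simp: cdisc_def)
  qed
  then have "(\<lambda>(x, y). complex_of_real x + \<i> * complex_of_real y) ` ({- R..R} \<times> {- R..R}) \<inter> cdisc R = cdisc R"
    by blast
  ultimately show ?thesis by simp
qed

text \<open>
  The cone generated by the quadratic expressions \<open>\<Sum> cnj (x i) x j \<Psi> i j\<close> is the linear image of the cone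
  of positive semidefinite arrays. By the assumption on \<open>\<tau>\<close>, arrays whose images are bounded are
  bounded themselves, hence some image is closest to \<open>h\<close>. If \<open>h\<close> is not in the cone, the
  difference between that closest image and \<open>h\<close> defines a functional that is nonnegative on the cone
  and negative at \<open>h\<close>.
\<close>

theorem cone_of_squares_separation:
  fixes \<Psi> :: "'a \<Rightarrow> 'a \<Rightarrow> 'i \<Rightarrow> complex" and h \<tau> :: "'i \<Rightarrow> complex"
  assumes A: "finite A" and I: "finite I" and \<eta>: "\<eta> > 0"
    and \<tau>: "\<And>x. \<eta> * (\<Sum>i\<in>A. (cmod (x i))\<^sup>2) \<le>
      Re (\<Sum>p\<in>I. \<tau> p * (\<Sum>i\<in>A. \<Sum>j\<in>A. cnj (x i) * x j * \<Psi> i j p))"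
    and no_functional: "\<And>w. (\<And>x. 0 \<le> Re (\<Sum>p\<in>I. w p * (\<Sum>i\<in>A. \<Sum>j\<in>A. cnj (x i) * x j * \<Psi> i j p))) \<Longrightarrow>
      0 \<le> Re (\<Sum>p\<in>I. w p * h p)"
  shows "\<exists>K d. \<forall>p\<in>I. h p = (\<Sum>k<K. \<Sum>i\<in>A. \<Sum>j\<in>A. cnj (d k i) * d (k :: nat) j * \<Psi> i j p)"
proof -
  define \<Phi> where "\<Phi> M p = (\<Sum>i\<in>A. \<Sum>j\<in>A. M (i, j) * \<Psi> i j p)" for M p
  define sq where "sq x = (\<lambda>(i, j). cnj (x i) * x j)" for x :: "'a \<Rightarrow> complex"
  define f where "f M = (\<Sum>p\<in>I. (cmod (h p - \<Phi> M p))\<^sup>2)" for M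
  have \<Phi>sq: "\<Phi> (sq x) p = (\<Sum>i\<in>A. \<Sum>j\<in>A. cnj (x i) * x j * \<Psi> i j p)" for x p
    by (simp add: \<Phi>_def sq_def)
  have \<Phi>_lin: "\<Phi> (\<lambda>q. a * M q + b * M' q) p = a * \<Phi> M p + b * \<Phi> M' p" for a b M M' p
    by (simp add: \<Phi>_def algebra_simps sum.distrib sum_distrib_left)
  have \<Phi>_decomp: "\<Phi> M p = (\<Sum>k<K. \<Phi> (sq (d k)) p)"
    if "\<forall>i\<in>A. \<forall>j\<in>A. M (i, j) = (\<Sum>k<K. cnj (d k i) * d k j)" for M p K and d :: "nat \<Rightarrow> 'a \<Rightarrow> complex"
  proof -
    have "\<Phi> M p = (\<Sum>i\<in>A. \<Sum>j\<in>A. \<Sum>k<K. cnj (d k i) * d k j * \<Psi> i j p)"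
      unfolding \<Phi>_def using that by (intro sum.cong refl) (simp add: sum_distrib_right)
    also have "\<dots> = (\<Sum>i\<in>A. \<Sum>k<K. \<Sum>j\<in>A. cnj (d k i) * d k j * \<Psi> i j p)"
      by (intro sum.cong refl sum.swap)
    also have "\<dots> = (\<Sum>k<K. \<Sum>i\<in>A. \<Sum>j\<in>A. cnj (d k i) * d k j * \<Psi> i j p)"
      by (rule sum.swap)
    finally show ?thesis by (simp add: \<Phi>sq)
  qed
  have psd_zero: "psd_array A (\<lambda>_. 0)" by (simp add: psd_array_def)
  have psd_add: "psd_array A (\<lambda>q. complex_of_real a * M q + complex_of_real b * M' q)"
    if "psd_array A M" "psd_array A M'" "a \<ge> 0" "b \<ge> 0" for a b M M'
  proof -
    have M: "M (j, i) = cnj (M (i, j))" "M' (j, i) = cnj (M' (i, j))" if "i \<in> A" "j \<in> A" for i j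
      using \<open>psd_array A M\<close> \<open>psd_array A M'\<close> that unfolding psd_array_def by blast+
    show ?thesis
      unfolding psd_array_def
    proof (intro conjI ballI allI)
      fix i j assume "i \<in> A" "j \<in> A"
      then show "complex_of_real a * M (j, i) + complex_of_real b * M' (j, i) =
          cnj (complex_of_real a * M (i, j) + complex_of_real b * M' (i, j))"
        by (simp add: M[symmetric])
    next
      fix x
      have "(\<Sum>i\<in>A. \<Sum>j\<in>A. (complex_of_real a * M (i, j) + complex_of_real b * M' (i, j)) * cnj (x i) * x j) =
        complex_of_real a * (\<Sum>i\<in>A. \<Sum>j\<in>A. M (i, j) * cnj (x i) * x j) +
        complex_of_real b * (\<Sum>i\<in>A. \<Sum>j\<in>A. M' (i, j) * cnj (x i) * x j)"
        by (simp add: algebra_simps sum.distrib sum_distrib_left)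
      then have "Re (\<Sum>i\<in>A. \<Sum>j\<in>A. (complex_of_real a * M (i, j) + complex_of_real b * M' (i, j)) * cnj (x i) * x j) =
        a * Re (\<Sum>i\<in>A. \<Sum>j\<in>A. M (i, j) * cnj (x i) * x j) +
        b * Re (\<Sum>i\<in>A. \<Sum>j\<in>A. M' (i, j) * cnj (x i) * x j)"
        by (simp del: Re_sum)
      moreover have "0 \<le> Re (\<Sum>i\<in>A. \<Sum>j\<in>A. M (i, j) * cnj (x i) * x j)"
        "0 \<le> Re (\<Sum>i\<in>A. \<Sum>j\<in>A. M' (i, j) * cnj (x i) * x j)"
        using \<open>psd_array A M\<close> \<open>psd_array A M'\<close> unfolding psd_array_def by blast+
      ultimately show "0 \<le> Re (\<Sum>i\<in>A. \<Sum>j\<in>A. (complex_of_real a * M (i, j) + complex_of_real b * M' (i, j)) * cnj (x i) * x j)"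
        using that(3,4) by (simp del: Re_sum)
    qed
  qed
  have psd_sq: "psd_array A (sq x)" for x
  proof -
    have "(\<Sum>i\<in>A. \<Sum>j\<in>A. sq x (i, j) * cnj (y i) * y j) =
        complex_of_real ((cmod (\<Sum>j\<in>A. x j * y j))\<^sup>2)" for y
    proof -
      have "(\<Sum>i\<in>A. \<Sum>j\<in>A. sq x (i, j) * cnj (y i) * y j) =
          (\<Sum>i\<in>A. cnj (x i * y i)) * (\<Sum>j\<in>A. x j * y j)"
        unfolding sum_product by (intro sum.cong refl) (simp add: sq_def)
      also have "\<dots> = complex_of_real ((cmod (\<Sum>j\<in>A. x j * y j))\<^sup>2)"
        using complex_norm_square[of "\<Sum>j\<in>A. x j * y j"] by (simp add: cnj_sum mult.commute)
      finally show ?thesis .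
    qed
    then show ?thesis by (simp add: psd_array_def sq_def)
  qed

  \<comment> \<open>The weight \<open>\<tau>\<close> bounds every array at least as good as the zero array.\<close>
  define R where "R = (\<Sum>p\<in>I. cmod (\<tau> p) * (cmod (h p) + sqrt (f (\<lambda>_. 0)))) / \<eta>"
  have f_nonneg: "0 \<le> f M" for M by (simp add: f_def sum_nonneg)
  have bound: "cmod (M (i, j)) \<le> R"
    if M: "psd_array A M" and fM: "f M \<le> f (\<lambda>_. 0)" and ij: "i \<in> A" "j \<in> A" for M i j
  proof -
    obtain K d where d: "\<forall>i\<in>A. \<forall>j\<in>A. M (i, j) = (\<Sum>k<K. cnj (d k i) * d (k :: nat) j)"
      using psd_array_sum_of_squares[OF A M] by blast
    define N where "N k = (\<Sum>i\<in>A. (cmod (d k i))\<^sup>2)" for k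
    have le_N: "(cmod (d k i))\<^sup>2 \<le> N k" if "i \<in> A" for k i
      unfolding N_def by (rule member_le_sum) (use that A in auto)
    have "cmod (M (i, j)) \<le> (\<Sum>k<K. cmod (d k i) * cmod (d k j))"
      using d ij by (simp add: norm_mult order_trans[OF norm_sum])
    also have "\<dots> \<le> (\<Sum>k<K. N k)"
    proof (rule sum_mono)
      fix k
      have "cmod (d k i) \<le> sqrt (N k)" "cmod (d k j) \<le> sqrt (N k)"
        using le_N ij by (simp_all add: real_le_rsqrt)
      then have "cmod (d k i) * cmod (d k j) \<le> sqrt (N k) * sqrt (N k)"
        by (intro mult_mono) (auto simp: N_def sum_nonneg)
      then show "cmod (d k i) * cmod (d k j) \<le> N k" by (simp add: N_def sum_nonneg)
    qed
    also have "\<dots> \<le> R"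
    proof -
      have "\<eta> * (\<Sum>k<K. N k) = (\<Sum>k<K. \<eta> * N k)" by (simp add: sum_distrib_left)
      also have "\<dots> \<le> (\<Sum>k<K. Re (\<Sum>p\<in>I. \<tau> p * \<Phi> (sq (d k)) p))"
        unfolding N_def \<Phi>sq by (intro sum_mono \<tau>)
      also have "\<dots> = Re (\<Sum>k<K. \<Sum>p\<in>I. \<tau> p * \<Phi> (sq (d k)) p)" by simp
      also have "(\<Sum>k<K. \<Sum>p\<in>I. \<tau> p * \<Phi> (sq (d k)) p) = (\<Sum>p\<in>I. \<tau> p * \<Phi> M p)"
        by (subst sum.swap) (simp add: \<Phi>_decomp[OF d] sum_distrib_left)
      also have "Re \<dots> \<le> cmod \<dots>" by (rule complex_Re_le_cmod)
      also have "\<dots> \<le> (\<Sum>p\<in>I. cmod (\<tau> p * \<Phi> M p))" by (rule norm_sum)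
      also have "\<dots> \<le> (\<Sum>p\<in>I. cmod (\<tau> p) * (cmod (h p) + sqrt (f (\<lambda>_. 0))))"
        unfolding norm_mult
      proof (intro sum_mono mult_left_mono)
        fix p assume p: "p \<in> I"
        have "(cmod (h p - \<Phi> M p))\<^sup>2 \<le> f M"
          unfolding f_def by (rule member_le_sum[OF p]) (use I in auto)
        then have "cmod (h p - \<Phi> M p) \<le> sqrt (f (\<lambda>_. 0))"
          using fM by (intro real_le_rsqrt) linarith
        moreover have "cmod (\<Phi> M p) \<le> cmod (h p) + cmod (h p - \<Phi> M p)"
          by (metis norm_minus_commute norm_triangle_sub)
        ultimately show "cmod (\<Phi> M p) \<le> cmod (h p) + sqrt (f (\<lambda>_. 0))" by linarith
      qed auto
      finally show ?thesis using \<eta> by (simp add: R_def field_simps)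
    qed
    finally show ?thesis .
  qed

  define box :: "('a \<times> 'a \<Rightarrow> complex) set"
    where "box = {M. \<forall>q. M q \<in> (if fst q \<in> A \<and> snd q \<in> A then cdisc R else {0})}"
  define C where "C = box \<inter> {M. psd_array A M}"
  have "0 \<le> R" using \<eta> f_nonneg by (auto simp: R_def intro!: divide_nonneg_pos sum_nonneg mult_nonneg_nonneg add_nonneg_nonneg)
  then have zero_C: "(\<lambda>_. 0) \<in> C" by (auto simp: C_def box_def psd_zero cdisc_def)
  have "closed {M. psd_array A M}"
    unfolding psd_array_def Ball_def
    by (intro closed_Collect_conj closed_Collect_all closed_Collect_imp open_Collect_const
        closed_Collect_eq closed_Collect_le continuous_intros continuous_on_product_coordinates)
  moreover have "compact box"
    unfolding box_def by (rule compact_pointwise_box) (auto simp: compact_cdisc)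
  ultimately have "compact C" unfolding C_def by (rule compact_Int_closed[rotated])
  moreover have "continuous_on C f"
    unfolding f_def \<Phi>_def
    by (intro continuous_intros continuous_on_subset[OF continuous_on_product_coordinates]) auto
  ultimately obtain M where M: "M \<in> C" "\<And>M'. M' \<in> C \<Longrightarrow> f M \<le> f M'"
    using continuous_attains_inf[of C f] zero_C by blast
  then have psdM: "psd_array A M" by (simp add: C_def)
  have minimal: "f M \<le> f M'" if M': "psd_array A M'" for M'
  proof (cases "f M' \<le> f (\<lambda>_. 0)")
    case True
    define M'' where "M'' = (\<lambda>q. if fst q \<in> A \<and> snd q \<in> A then M' q else 0)"
    have "(\<Sum>i\<in>A. \<Sum>j\<in>A. M'' (i, j) * cnj (x i) * x j) = (\<Sum>i\<in>A. \<Sum>j\<in>A. M' (i, j) * cnj (x i) * x j)" for x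
      by (simp add: M''_def)
    moreover have "M'' (i, j) = M' (i, j)" if "i \<in> A" "j \<in> A" for i j
      using that by (simp add: M''_def)
    ultimately have "psd_array A M''" using M' unfolding psd_array_def by metis
    then have "M'' \<in> C"
      using bound[OF M' True] by (simp add: C_def box_def M''_def cdisc_def)
    moreover have "f M'' = f M'" by (simp add: f_def \<Phi>_def M''_def)
    ultimately show ?thesis using M(2) by metis
  next
    case False
    with M(2)[OF zero_C] show ?thesis by linarith
  qed

  define r where "r p = h p - \<Phi> M p" for p
  \<comment> \<open>First variation of the squared distance in a direction \<open>z\<close>.\<close>
  have variation: "Re (\<Sum>p\<in>I. cnj (r p) * z p) \<le> 0"
    if z: "\<And>t. 0 < t \<Longrightarrow> t < 1 \<Longrightarrow> f M \<le> (\<Sum>p\<in>I. (cmod (r p - complex_of_real t * z p))\<^sup>2)" for z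
  proof (rule ccontr)
    define a where "a = Re (\<Sum>p\<in>I. cnj (r p) * z p)"
    define b where "b = (\<Sum>p\<in>I. (cmod (z p))\<^sup>2)"
    assume "\<not> ?thesis"
    then have a: "a > 0" by (simp add: a_def)
    have b: "b \<ge> 0" by (simp add: b_def sum_nonneg)
    define t where "t = min (1/2) (a / (b + 1))"
    have t: "0 < t" "t < 1" using a b by (auto simp: t_def)
    have "(cmod (r p - complex_of_real t * z p))\<^sup>2 =
        (cmod (r p))\<^sup>2 - 2 * t * Re (cnj (r p) * z p) + t\<^sup>2 * (cmod (z p))\<^sup>2" for p
      unfolding cmod_power2 by (simp add: power2_eq_square algebra_simps)
    then have "(\<Sum>p\<in>I. (cmod (r p - complex_of_real t * z p))\<^sup>2) = f M - 2 * t * a + t\<^sup>2 * b"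
      by (simp add: f_def a_def b_def sum.distrib sum_subtractf flip: sum_distrib_left r_def)
    with z[OF t] have "2 * t * a \<le> t\<^sup>2 * b" by linarith
    then have "2 * a \<le> t * b" using t by (simp add: power2_eq_square)
    also have "t * b \<le> a / (b + 1) * b" using b by (intro mult_right_mono) (auto simp: t_def)
    also have "\<dots> \<le> a" using a b by (simp add: field_simps)
    finally show False using a by simp
  qed
  have var_sq: "Re (\<Sum>p\<in>I. cnj (r p) * \<Phi> (sq x) p) \<le> 0" for x
  proof (rule variation)
    fix t :: real assume t: "0 < t" "t < 1"
    have "f M \<le> f (\<lambda>q. complex_of_real 1 * M q + complex_of_real t * sq x q)"
      using t by (intro minimal psd_add psdM psd_sq) auto
    also have "\<dots> = (\<Sum>p\<in>I. (cmod (r p - complex_of_real t * \<Phi> (sq x) p))\<^sup>2)"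
      unfolding f_def \<Phi>_lin by (simp add: r_def algebra_simps)
    finally show "f M \<le> \<dots>" .
  qed
  \<comment> \<open>Scaling the minimizer down stays in the cone, which bounds its inner product with the residual from below.\<close>
  have var_M: "Re (\<Sum>p\<in>I. cnj (r p) * (- \<Phi> M p)) \<le> 0"
  proof (rule variation)
    fix t :: real assume t: "0 < t" "t < 1"
    have "f M \<le> f (\<lambda>q. complex_of_real (1 - t) * M q + complex_of_real 0 * M q)"
      using t by (intro minimal psd_add psdM) auto
    also have "\<dots> = (\<Sum>p\<in>I. (cmod (r p - complex_of_real t * - \<Phi> M p))\<^sup>2)"
      unfolding f_def \<Phi>_lin by (simp add: r_def algebra_simps)
    finally show "f M \<le> \<dots>" .
  qed
  have "0 \<le> Re (\<Sum>p\<in>I. - cnj (r p) * h p)"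
  proof (rule no_functional)
    fix x
    have "(\<Sum>p\<in>I. - cnj (r p) * (\<Sum>i\<in>A. \<Sum>j\<in>A. cnj (x i) * x j * \<Psi> i j p)) =
        - (\<Sum>p\<in>I. cnj (r p) * \<Phi> (sq x) p)"
      by (simp add: \<Phi>sq sum_negf)
    then show "0 \<le> Re (\<Sum>p\<in>I. - cnj (r p) * (\<Sum>i\<in>A. \<Sum>j\<in>A. cnj (x i) * x j * \<Psi> i j p))"
      using var_sq[of x] by (simp del: Re_sum)
  qed
  moreover have "(\<Sum>p\<in>I. - cnj (r p) * h p) =
      (\<Sum>p\<in>I. cnj (r p) * (- \<Phi> M p)) - complex_of_real (f M)"
  proof -
    have "- cnj (r p) * h p = cnj (r p) * (- \<Phi> M p) - complex_of_real ((cmod (r p))\<^sup>2)" for p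
      using complex_norm_square[of "r p"] by (simp add: r_def algebra_simps)
    then show ?thesis by (simp add: f_def r_def sum_subtractf)
  qed
  ultimately have "f M \<le> 0" using var_M by (simp del: Re_sum)
  then have "f M = 0" using f_nonneg[of M] by simp
  then have "\<forall>p\<in>I. h p = \<Phi> M p" using I by (simp add: f_def sum_nonneg_eq_0_iff)
  moreover obtain K d where d: "\<forall>i\<in>A. \<forall>j\<in>A. M (i, j) = (\<Sum>k<K. cnj (d k i) * d (k :: nat) j)"
    using psd_array_sum_of_squares[OF A psdM] by blast
  ultimately have "\<forall>p\<in>I. h p = (\<Sum>k<K. \<Phi> (sq (d k)) p)" using \<Phi>_decomp[OF d] by simp
  then show ?thesis unfolding \<Phi>sq by blast
qed

section \<open>Intertwining the evaluations at two tuples\<close>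

text \<open>
  The expressions to whose values a variable gets applied when \<open>e\<close> acts on the value of \<open>f\<close>. For an
  inverse, \<open>a\<inverse> f\<close> is characterized by \<open>a (a\<inverse> f) = f\<close>, so the relevant
  argument of \<open>a\<close> is \<open>a\<inverse> f\<close>.
\<close>

primrec var_args :: "'x rat_expr \<Rightarrow> 'x rat_expr \<Rightarrow> 'x rat_expr list" where
  "var_args (Const c) f = []"
| "var_args (Sym x) f = [f]"
| "var_args (Add a b) f = var_args a f @ var_args b f"
| "var_args (Mult a b) f = var_args b f @ var_args a (Mult b f)"
| "var_args (Inv a) f = var_args a (Mult (Inv a) f)"

lemma var_args_defined:
  assumes "eval_expr n \<rho> e \<noteq> None" "eval_expr n \<rho> f \<noteq> None" "g \<in> set (var_args e f)"
  shows "eval_expr n \<rho> g \<noteq> None"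
  using assms
proof (induction e arbitrary: f)
  case (Mult a b)
  have ab: "eval_expr n \<rho> a \<noteq> None" "eval_expr n \<rho> b \<noteq> None"
    using Mult.prems(1) by (auto simp: bind_eq_None_conv)
  moreover have "eval_expr n \<rho> (Mult b f) \<noteq> None"
    using ab Mult.prems(2) by (auto simp: bind_eq_None_conv)
  ultimately show ?case using Mult.IH(1)[of "Mult b f"] Mult.IH(2)[of f] Mult.prems(2,3) by auto
next
  case (Inv a)
  have 1: "eval_expr n \<rho> a \<noteq> None" using Inv.prems(1) by (auto simp: bind_eq_None_conv)
  have 2: "eval_expr n \<rho> (Mult (Inv a) f) \<noteq> None"
    using Inv.prems(1,2) by (auto simp: bind_eq_None_conv bind_eq_Some_conv)
  show ?case by (rule Inv.IH[OF 1 2]) (use Inv.prems(3) in simp)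
qed (auto simp: bind_eq_None_conv bind_eq_Some_conv)

lemma smult_one_mult_vec:
  assumes v: "v \<in> carrier_vec l"
  shows "(c \<cdot>\<^sub>m 1\<^sub>m l) *\<^sub>v v = c \<cdot>\<^sub>v (v :: complex vec)"
proof (rule eq_vecI)
  fix i assume "i < dim_vec (c \<cdot>\<^sub>v v)"
  then have i: "i < l" using v by simp
  have "((c \<cdot>\<^sub>m 1\<^sub>m l) *\<^sub>v v) $ i = (\<Sum>j = 0..<l. (c \<cdot>\<^sub>m 1\<^sub>m l) $$ (i, j) * v $ j)"
    using i v by (auto simp: scalar_prod_def intro!: sum.cong)
  also have "\<dots> = (\<Sum>j = 0..<l. if j = i then c * v $ j else 0)"
    by (intro sum.cong) (use i in auto)
  finally show "((c \<cdot>\<^sub>m 1\<^sub>m l) *\<^sub>v v) $ i = (c \<cdot>\<^sub>v v) $ i" using i v by simp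
qed (use v in simp)

text \<open>
  If \<open>J\<close> intertwines the variables at \<open>Y\<close> and at \<open>T\<close> on the finitely many vectors in \<open>var_args e f\<close>,
  then it intertwines \<open>e\<close> on \<open>f\<close>. It is essential that the variables need not be intertwined on the
  whole space: only their action on a subspace is prescribed.
\<close>

lemma eval_expr_intertwine:
  assumes Y: "\<And>x. Y x \<in> carrier_mat n n" and T: "\<And>x. T x \<in> carrier_mat l l"
    and J: "\<And>F. F \<in> carrier_mat n n \<Longrightarrow> J F \<in> carrier_vec l"
    and J_add: "\<And>F G. F \<in> carrier_mat n n \<Longrightarrow> G \<in> carrier_mat n n \<Longrightarrow> J (F + G) = J F + J G"
    and J_smult: "\<And>c F. F \<in> carrier_mat n n \<Longrightarrow> J (c \<cdot>\<^sub>m F) = c \<cdot>\<^sub>v J F"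
    and "eval_expr n Y e = Some E" "eval_expr l T e = Some E'" "eval_expr n Y f = Some F"
    and "\<And>g G x. g \<in> set (var_args e f) \<Longrightarrow> eval_expr n Y g = Some G \<Longrightarrow> T x *\<^sub>v J G = J (Y x * G)"
  shows "E' *\<^sub>v J F = J (E * F)"
proof -
  have cY: "A \<in> carrier_mat n n" if "eval_expr n Y e = Some A" for e A
    using that by (rule eval_expr_carrier[rotated]) (rule Y)
  have cT: "A \<in> carrier_mat l l" if "eval_expr l T e = Some A" for e A
    using that by (rule eval_expr_carrier[rotated]) (rule T)
  show ?thesis
    using assms(6-)
  proof (induction e arbitrary: E E' f F)
    case (Const c)
    have F: "F \<in> carrier_mat n n" using cY[OF Const.prems(3)] .
    have "(c \<cdot>\<^sub>m 1\<^sub>m l) *\<^sub>v J F = c \<cdot>\<^sub>v J F" by (rule smult_one_mult_vec[OF J[OF F]])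
    moreover have "(c \<cdot>\<^sub>m 1\<^sub>m n) * F = c \<cdot>\<^sub>m F"
      using F mult_smult_assoc_mat[of "1\<^sub>m n" n n F n c] by simp
    ultimately show ?case using Const.prems J_smult[OF F] by auto
  next
    case (Sym x)
    then show ?case by auto
  next
    case (Add a b)
    obtain A B where A: "eval_expr n Y a = Some A" "eval_expr n Y b = Some B" "E = A + B"
      using Add.prems(1) by (auto simp: bind_eq_Some_conv)
    obtain A' B' where A': "eval_expr l T a = Some A'" "eval_expr l T b = Some B'" "E' = A' + B'"
      using Add.prems(2) by (auto simp: bind_eq_Some_conv)
    have F: "F \<in> carrier_mat n n" using cY[OF Add.prems(3)] .
    have "A' *\<^sub>v J F = J (A * F)"
      by (rule Add.IH(1)[OF A(1) A'(1) Add.prems(3)]) (use Add.prems(4) in auto)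
    moreover have "B' *\<^sub>v J F = J (B * F)"
      by (rule Add.IH(2)[OF A(2) A'(2) Add.prems(3)]) (use Add.prems(4) in auto)
    ultimately show ?case
      using cY[OF A(1)] cY[OF A(2)] cT[OF A'(1)] cT[OF A'(2)] F J[OF F]
      by (simp add: A(3) A'(3) add_mult_distrib_mat[of _ n n _ _ n] add_mult_distrib_mat_vec[of _ l l] J_add)
  next
    case (Mult a b)
    obtain A B where A: "eval_expr n Y a = Some A" "eval_expr n Y b = Some B" "E = A * B"
      using Mult.prems(1) by (auto simp: bind_eq_Some_conv)
    obtain A' B' where A': "eval_expr l T a = Some A'" "eval_expr l T b = Some B'" "E' = A' * B'"
      using Mult.prems(2) by (auto simp: bind_eq_Some_conv)
    have F: "F \<in> carrier_mat n n" using cY[OF Mult.prems(3)] .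
    have "B' *\<^sub>v J F = J (B * F)"
      by (rule Mult.IH(2)[OF A(2) A'(2) Mult.prems(3)]) (use Mult.prems(4) in auto)
    moreover have "A' *\<^sub>v J (B * F) = J (A * (B * F))"
    proof (rule Mult.IH(1)[OF A(1) A'(1)])
      show "eval_expr n Y (Mult b f) = Some (B * F)" using A Mult.prems(3) by simp
    qed (use Mult.prems(4) in auto)
    ultimately show ?case
      using cY[OF A(1)] cY[OF A(2)] cT[OF A'(1)] cT[OF A'(2)] F J[OF F]
      by (simp add: A(3) A'(3) assoc_mult_mat[of _ n n _ n _ n] assoc_mult_mat_vec[of _ l l _ l])
  next
    case (Inv a)
    obtain A where A: "eval_expr n Y a = Some A" "mat_inverse A = Some E"
      using Inv.prems(1) by (auto simp: bind_eq_Some_conv)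
    obtain A' where A': "eval_expr l T a = Some A'" "mat_inverse A' = Some E'"
      using Inv.prems(2) by (auto simp: bind_eq_Some_conv)
    have F: "F \<in> carrier_mat n n" using cY[OF Inv.prems(3)] .
    have E: "E \<in> carrier_mat n n" "A * E = 1\<^sub>m n"
      using A(2) by (simp_all add: mat_inverse_eq_Some_iff[OF cY[OF A(1)]])
    have E': "E' \<in> carrier_mat l l" "E' * A' = 1\<^sub>m l"
      using A'(2) by (simp_all add: mat_inverse_eq_Some_iff[OF cT[OF A'(1)]])
    have EF: "E * F \<in> carrier_mat n n" using E(1) F by simp
    have "A' *\<^sub>v J (E * F) = J (A * (E * F))"
    proof (rule Inv.IH[OF A(1) A'(1)])
      show "eval_expr n Y (Mult (Inv a) f) = Some (E * F)" using A Inv.prems(3) by simp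
    qed (use Inv.prems(4) in auto)
    also have "A * (E * F) = F"
      using cY[OF A(1)] E F by (simp flip: assoc_mult_mat[of _ n n _ n _ n])
    finally have "E' *\<^sub>v J F = E' *\<^sub>v (A' *\<^sub>v J (E * F))" by simp
    also have "\<dots> = J (E * F)"
      using cT[OF A'(1)] E' J[OF EF] by (simp flip: assoc_mult_mat_vec[of _ l l _ l])
    finally show ?case .
  qed
qed

section \<open>Square matrices as vectors\<close>

text \<open>
  The square matrices of size \<open>n\<close> form the vector space on which a tuple acts by left multiplication.
  There a matrix is determined by its action on a single vector, the identity.
\<close>

definition entries :: "complex mat \<Rightarrow> nat \<times> nat \<Rightarrow> complex" where
  "entries A = (\<lambda>(i, j). if i < dim_row A \<and> j < dim_col A then A $$ (i, j) else 0)"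

definition act :: "complex mat \<Rightarrow> (nat \<times> nat \<Rightarrow> complex) \<Rightarrow> nat \<times> nat \<Rightarrow> complex" where
  "act A f = (\<lambda>(i, j). if i < dim_row A then \<Sum>c<dim_col A. A $$ (i, c) * f (c, j) else 0)"

definition square_supp :: "nat \<Rightarrow> (nat \<times> nat \<Rightarrow> complex) set" where
  "square_supp n = {f. \<forall>i j. \<not> (i < n \<and> j < n) \<longrightarrow> f (i, j) = 0}"

definition frob :: "nat \<Rightarrow> (nat \<times> nat \<Rightarrow> complex) \<Rightarrow> real" where
  "frob n f = (\<Sum>i<n. \<Sum>j<n. (cmod (f (i, j)))\<^sup>2)"

lemma square_supp_subspace: "cfun.subspace (square_supp n)"
  by (auto simp: cfun.subspace_def square_supp_def)

lemma entries_square_supp: "A \<in> carrier_mat n n \<Longrightarrow> entries A \<in> square_supp n"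
  by (auto simp: entries_def square_supp_def)

lemma entries_add: "A \<in> carrier_mat n m \<Longrightarrow> B \<in> carrier_mat n m \<Longrightarrow> entries (A + B) = entries A + entries B"
  by (auto simp: entries_def fun_eq_iff)

lemma entries_smult: "entries (c \<cdot>\<^sub>m A) = cscale c (entries A)"
  by (auto simp: entries_def fun_eq_iff)

lemma act_entries:
  assumes "A \<in> carrier_mat n m" "F \<in> carrier_mat m l"
  shows "act A (entries F) = entries (A * F)"
  using assms by (auto simp: act_def entries_def fun_eq_iff scalar_prod_def atLeast0LessThan intro!: sum.cong)

lemma act_add: "act A (f + g) = act A f + act A g"
  by (auto simp: act_def fun_eq_iff algebra_simps sum.distrib)

lemma act_cscale: "act A (cscale c f) = cscale c (act A f)"
  by (auto simp: act_def fun_eq_iff algebra_simps sum_distrib_left)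

lemma act_zero: "act A 0 = 0"
  by (auto simp: act_def fun_eq_iff)

lemma act_sum: "act A (\<Sum>k\<in>K. f k) = (\<Sum>k\<in>K. act A (f k))"
  by (induction K rule: infinite_finite_induct) (simp_all only: sum.infinite sum.empty sum.insert act_zero act_add not_False_eq_True)

lemma act_add_mat: "A \<in> carrier_mat n n \<Longrightarrow> B \<in> carrier_mat n n \<Longrightarrow> act (A + B) f = act A f + act B f"
  by (auto simp: act_def fun_eq_iff algebra_simps sum.distrib)

lemma act_mult_mat:
  assumes "A \<in> carrier_mat n n" "B \<in> carrier_mat n n"
  shows "act (A * B) f = act A (act B f)"
proof (rule ext, clarify)
  fix i j
  show "act (A * B) f (i, j) = act A (act B f) (i, j)"
  proof (cases "i < n")
    case True
    then have "act (A * B) f (i, j) = (\<Sum>c<n. \<Sum>k<n. A $$ (i, k) * B $$ (k, c) * f (c, j))"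
      using assms by (simp add: act_def scalar_prod_def atLeast0LessThan sum_distrib_right)
    also have "\<dots> = (\<Sum>k<n. \<Sum>c<n. A $$ (i, k) * B $$ (k, c) * f (c, j))" by (rule sum.swap)
    also have "\<dots> = act A (act B f) (i, j)"
      using True assms by (simp add: act_def sum_distrib_left mult.assoc)
    finally show ?thesis .
  qed (use assms in \<open>simp add: act_def\<close>)
qed

lemma act_smult_one:
  assumes "f \<in> square_supp n"
  shows "act (c \<cdot>\<^sub>m 1\<^sub>m n) f = cscale c f"
proof (rule ext, clarify)
  fix i j
  show "act (c \<cdot>\<^sub>m 1\<^sub>m n) f (i, j) = cscale c f (i, j)"
  proof (cases "i < n")
    case True
    have "act (c \<cdot>\<^sub>m 1\<^sub>m n) f (i, j) = (\<Sum>k<n. (c \<cdot>\<^sub>m 1\<^sub>m n) $$ (i, k) * f (k, j))"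
      using True by (simp add: act_def)
    also have "\<dots> = (\<Sum>k<n. if k = i then c * f (k, j) else 0)"
      by (intro sum.cong) (use True in auto)
    finally show ?thesis using True by simp
  qed (use assms in \<open>auto simp: act_def square_supp_def\<close>)
qed

lemma act_square_supp: "A \<in> carrier_mat n n \<Longrightarrow> f \<in> square_supp n \<Longrightarrow> act A f \<in> square_supp n"
  by (auto simp: act_def square_supp_def)

lemma frob_nonneg: "0 \<le> frob n f"
  by (simp add: frob_def sum_nonneg)

lemma frob_zero_iff: "f \<in> square_supp n \<Longrightarrow> frob n f = 0 \<longleftrightarrow> f = 0"
proof
  assume f: "f \<in> square_supp n" and "frob n f = 0"
  then have "\<forall>i<n. \<forall>j<n. f (i, j) = 0"
    by (simp add: frob_def sum_nonneg_eq_0_iff sum_nonneg)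
  then show "f = 0" using f unfolding square_supp_def by (auto simp: fun_eq_iff)
qed (simp add: frob_def)

definition frob_ip :: "nat \<Rightarrow> (nat \<times> nat \<Rightarrow> complex) \<Rightarrow> (nat \<times> nat \<Rightarrow> complex) \<Rightarrow> complex" where
  "frob_ip n f g = (\<Sum>i<n. \<Sum>j<n. f (i, j) * cnj (g (i, j)))"

lemma frob_ip_diag: "frob_ip n f f = complex_of_real (frob n f)"
  unfolding frob_ip_def frob_def of_real_sum by (simp only: complex_norm_square)

lemma herm_space_frob_ip: "herm_space cscale (frob_ip n)"
  by unfold_locales (simp_all add: frob_ip_def algebra_simps sum.distrib sum_distrib_left cnj_sum)

definition matrix_units :: "nat \<Rightarrow> (nat \<times> nat \<Rightarrow> complex) list" where
  "matrix_units n = map (\<lambda>q. (\<lambda>q'. if q' = q then 1 else 0)) (List.product [0..<n] [0..<n])"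

lemma span_matrix_units: "cfun.span (set (matrix_units n)) = square_supp n"
proof
  show "cfun.span (set (matrix_units n)) \<subseteq> square_supp n"
    by (rule cfun.span_minimal[OF _ square_supp_subspace]) (auto simp: matrix_units_def square_supp_def)
  show "square_supp n \<subseteq> cfun.span (set (matrix_units n))"
  proof
    fix f assume f: "f \<in> square_supp n"
    have "f = (\<Sum>q\<in>{..<n} \<times> {..<n}. cscale (f q) (\<lambda>q'. if q' = q then 1 else 0))"
    proof (rule ext, clarify)
      fix i j
      have "(\<Sum>q\<in>{..<n} \<times> {..<n}. cscale (f q) (\<lambda>q'. if q' = q then 1 else 0)) (i, j) =
          (\<Sum>q\<in>{..<n} \<times> {..<n}. if (i, j) = q then f q else 0)"
        unfolding sum_fun_apply by (intro sum.cong) auto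
      also have "\<dots> = f (i, j)" using f by (auto simp: square_supp_def)
      finally show "f (i, j) = (\<Sum>q\<in>{..<n} \<times> {..<n}. cscale (f q) (\<lambda>q'. if q' = q then 1 else 0)) (i, j)" by simp
    qed
    also have "\<dots> \<in> cfun.span (set (matrix_units n))"
      by (intro cfun.span_sum cfun.span_scale cfun.span_base) (auto simp: matrix_units_def)
    finally show "f \<in> cfun.span (set (matrix_units n))" .
  qed
qed

section \<open>A strictly contractive tuple from a positive form\<close>

text \<open>
  The form \<open>B\<close> makes the span \<open>V'\<close> of \<open>us'\<close> an inner product space, and left multiplication by \<open>Y k\<close> maps
  the span \<open>V\<close> of \<open>us\<close> strictly contractively into \<open>V'\<close>. To obtain operators on one space, \<open>B\<close> is
  extended to an inner product \<open>G\<close> on all matrices, and an orthonormal basis adapted to \<open>V\<close> is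
  chosen. In this basis \<open>T1\<close> is left multiplication, at which every expression is defined, and \<open>T0\<close>
  is left multiplication composed with the projection to \<open>V\<close>, which is strictly contractive. All
  members of the line between them agree with left multiplication on \<open>V\<close>, so the values of the
  expressions at the vector \<open>x\<close> are the same for all members at which they are defined.
\<close>

theorem contractive_model:
  fixes Y :: "'d::finite \<Rightarrow> complex mat" and es :: "'d nc_expr set"
    and us us' :: "(nat \<times> nat \<Rightarrow> complex) list"
  assumes n: "0 < n" and Y: "Y \<in> mat_tuples n"
    and es: "finite es" "\<And>e. e \<in> es \<Longrightarrow> eval_expr n Y e \<noteq> None"
    and B: "herm_space cscale B"
    and us': "set us' \<subseteq> square_supp n" and us: "cfun.span (set us) \<subseteq> cfun.span (set us')"
    and args: "\<And>e g G. e \<in> es \<Longrightarrow> g \<in> set (var_args e (Const 1)) \<Longrightarrow> eval_expr n Y g = Some G \<Longrightarrow>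
      entries G \<in> cfun.span (set us)"
    and vals: "\<And>e E. e \<in> es \<Longrightarrow> eval_expr n Y e = Some E \<Longrightarrow> entries E \<in> cfun.span (set us')"
    and shift: "\<And>k f. f \<in> cfun.span (set us) \<Longrightarrow> act (Y k) f \<in> cfun.span (set us')"
    and pos: "\<epsilon> > 0" "\<And>f. f \<in> cfun.span (set us') \<Longrightarrow> \<epsilon> * frob n f \<le> Re (B f f)"
    and contr: "0 \<le> c" "c < 1"
      "\<And>k f. f \<in> cfun.span (set us) \<Longrightarrow> Re (B (act (Y k) f) (act (Y k) f)) \<le> c\<^sup>2 * Re (B f f)"
  shows "\<exists>l T x. 0 < l \<and> T \<in> mat_tuples l \<and> (\<forall>k. strict_contraction (T k)) \<and> x \<in> carrier_vec l \<and>
    (\<forall>e\<in>es. eval_expr l T e \<noteq> None) \<and>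
    (\<forall>e\<in>es. \<forall>f\<in>es. \<forall>E F E' F'. eval_expr n Y e = Some E \<longrightarrow> eval_expr n Y f = Some F \<longrightarrow>
      eval_expr l T e = Some E' \<longrightarrow> eval_expr l T f = Some F' \<longrightarrow>
      (E' *\<^sub>v x) \<bullet>c (F' *\<^sub>v x) = B (entries E) (entries F))"
proof -
  define S where "S = square_supp n"
  define V where "V = cfun.span (set us)"
  define V' where "V' = cfun.span (set us')"
  have S: "cfun.subspace S" unfolding S_def by (rule square_supp_subspace)
  have V: "cfun.subspace V" and V': "cfun.subspace V'" by (simp_all add: V_def V'_def)
  have V'S: "V' \<subseteq> S" unfolding V'_def S_def by (rule cfun.span_minimal[OF us' square_supp_subspace])
  have VV': "V \<subseteq> V'" using us by (simp add: V_def V'_def)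
  have Yc: "Y k \<in> carrier_mat n n" for k using Y by (simp add: mat_tuples_def)
  have actS: "act A f \<in> S" if "A \<in> carrier_mat n n" "f \<in> S" for A f
    using act_square_supp that unfolding S_def by blast

  \<comment> \<open>Extend the form from \<open>V'\<close> to all matrices, with a definite form on a complement.\<close>
  interpret B: herm_space cscale B by (rule B)
  have posV': "0 \<le> Re (B f f)" if "f \<in> V'" for f
    using pos(2)[of f] pos(1) that frob_nonneg[of n f] unfolding V'_def
    by (meson mult_nonneg_nonneg less_imp_le order_trans)
  have nullV': "f = 0" if "f \<in> V'" "Re (B f f) = 0" for f
  proof -
    have "\<epsilon> * frob n f \<le> 0" using pos(2)[of f] that unfolding V'_def by simp
    then have "frob n f = 0" using pos(1) frob_nonneg[of n f] by (simp add: mult_le_0_iff)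
    then show ?thesis using that V'S frob_zero_iff unfolding S_def by blast
  qed
  have "set us' \<subseteq> V'" unfolding V'_def by (rule cfun.span_superset)
  then obtain q m where "\<And>i. i < m \<Longrightarrow> q i \<in> cfun.span (set us')"
    "\<And>u x. u \<in> cfun.span (set us') \<Longrightarrow> x \<in> V' \<Longrightarrow> B (u - B.proj q m u) x = 0"
    using B.gram_schmidt[OF V' posV'] by metis
  then have q: "\<And>i. i < m \<Longrightarrow> q i \<in> V'"
    "\<And>u x. u \<in> V' \<Longrightarrow> x \<in> V' \<Longrightarrow> B (u - B.proj q m u) x = 0"
    unfolding V'_def by blast+
  define P where "P = B.proj q m"
  have PV': "P f \<in> V'" for f unfolding P_def by (rule B.proj_in_subspace[OF V' q(1)])
  have P_id: "P f = f" if "f \<in> V'" for f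
  proof -
    have "f - P f \<in> V'" using that PV' by (intro cfun.subspace_diff V')
    then have "f - P f = 0" using q(2)[OF that, of "f - P f"] by (intro nullV') (simp_all add: P_def)
    then show ?thesis by simp
  qed
  interpret fr: herm_space cscale "frob_ip n" by (rule herm_space_frob_ip)
  define G where "G f g = B (P f) (P g) + frob_ip n (f - P f) (g - P g)" for f g
  have P_lin: "P (f + g) = P f + P g" "P (cscale a f) = cscale a (P f)" for f g a
    unfolding P_def by (rule B.proj_linear)+
  interpret G: herm_space cscale G
  proof
    fix f g h :: "nat \<times> nat \<Rightarrow> complex" and a
    have "f + g - P (f + g) = (f - P f) + (g - P g)" unfolding P_lin by simp
    then show "G (f + g) h = G f h + G g h"
      unfolding G_def P_lin by (simp only: B.add_left fr.add_left ac_simps)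
    have "cscale a f - P (cscale a f) = cscale a (f - P f)"
      unfolding P_lin by (simp only: cfun.scale_right_diff_distrib)
    then show "G (cscale a f) h = a * G f h"
      unfolding G_def P_lin by (simp only: B.scale_left fr.scale_left distrib_left)
    show "G g f = cnj (G f g)"
      unfolding G_def complex_cnj_add by (simp only: B.sym[of "P g" "P f"] fr.sym[of "g - P g" "f - P f"])
  qed
  have G_V': "G f g = B f g" if "f \<in> V'" "g \<in> V'" for f g
    using P_id that by (simp add: G_def fr.zero_left)
  have posG: "0 \<le> Re (G f f)" for f
    using posV'[OF PV', of f] frob_nonneg[of n "f - P f"] by (simp add: G_def frob_ip_diag)
  have nullG: "f = 0" if "f \<in> S" "G f f = 0" for f
  proof -
    have "Re (B (P f) (P f)) + frob n (f - P f) = 0" using that(2) by (simp add: G_def frob_ip_diag complex_eq_iff)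
    then have "Re (B (P f) (P f)) = 0" "frob n (f - P f) = 0"
      using posV'[OF PV', of f] frob_nonneg[of n "f - P f"] by linarith+
    moreover have "f - P f \<in> S" using that(1) PV' V'S by (intro cfun.subspace_diff S) auto
    ultimately have "P f = 0" "f - P f = 0"
      using nullV'[OF PV'] frob_zero_iff[of "f - P f" n] unfolding S_def by blast+
    then show ?thesis by simp
  qed

  \<comment> \<open>A \<open>G\<close>-orthonormal basis of the matrices whose first \<open>p\<close> members span \<open>V\<close>.\<close>
  have usV: "set us \<subseteq> V" unfolding V_def by (rule cfun.span_superset)
  have usS: "set us \<subseteq> S" using usV VV' V'S by blast
  obtain b0 p where "G.orthonormal b0 p" "\<And>i. i < p \<Longrightarrow> b0 i \<in> cfun.span (set us)"
    "\<And>u x. u \<in> cfun.span (set us) \<Longrightarrow> x \<in> S \<Longrightarrow> G (u - G.proj b0 p u) x = 0"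
    using G.gram_schmidt[OF S posG usS] by metis
  then have b0: "G.orthonormal b0 p" "\<And>i. i < p \<Longrightarrow> b0 i \<in> V"
    "\<And>u x. u \<in> V \<Longrightarrow> x \<in> S \<Longrightarrow> G (u - G.proj b0 p u) x = 0"
    unfolding V_def by blast+
  have units_S: "set (matrix_units n) \<subseteq> S"
    unfolding S_def span_matrix_units[symmetric] by (rule cfun.span_superset)
  have b0S: "b0 i \<in> S" if "i < p" for i using b0(2) that VV' V'S by blast
  obtain b l where b: "p \<le> l" "\<forall>i<p. b i = b0 i" "G.orthonormal b l"
    "\<forall>i<l. b i \<in> cfun.span (b0 ` {..<p} \<union> set (matrix_units n))"
    "\<forall>u \<in> cfun.span (b0 ` {..<p} \<union> set (matrix_units n)). \<forall>x\<in>S. G (u - G.proj b l u) x = 0"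
    using G.gram_schmidt_extend[of S b0 p "matrix_units n"] S units_S posG b0(1) b0S by metis
  have "cfun.span (b0 ` {..<p} \<union> set (matrix_units n)) = S"
  proof
    show "cfun.span (b0 ` {..<p} \<union> set (matrix_units n)) \<subseteq> S"
      using b0S units_S by (intro cfun.span_minimal S) auto
    show "S \<subseteq> cfun.span (b0 ` {..<p} \<union> set (matrix_units n))"
      unfolding S_def span_matrix_units[symmetric] by (intro cfun.span_mono) auto
  qed
  with b have bS: "\<And>i. i < l \<Longrightarrow> b i \<in> S"
    and b_res: "\<And>u x. u \<in> S \<Longrightarrow> x \<in> S \<Longrightarrow> G (u - G.proj b l u) x = 0" by auto
  have expand: "G.proj b l f = f" if f: "f \<in> S" for f
  proof -
    have "f - G.proj b l f \<in> S" using f bS by (intro cfun.subspace_diff S G.proj_in_subspace) auto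
    then have "f - G.proj b l f = 0" using nullG b_res[OF f] by blast
    then show ?thesis by simp
  qed
  have expandV: "G.proj b p f = f" if f: "f \<in> V" for f
  proof -
    have pr: "G.proj b p f = G.proj b0 p f" using b(2) by (intro G.proj_cong) auto
    have fS: "f \<in> S" using f VV' V'S by blast
    then have "f - G.proj b0 p f \<in> S" using b0S by (intro cfun.subspace_diff S G.proj_in_subspace) auto
    then have "f - G.proj b0 p f = 0" using nullG b0(3)[OF f] by blast
    then show ?thesis unfolding pr by simp
  qed
  have bON: "G (b i) (b j) = (if i = j then 1 else 0)" if "i < l" "j < l" for i j
    using b(3) that by (simp add: G.orthonormal_def)
  have bV: "b i \<in> V" if "i < p" for i using b(2) b0(2) that by simp
  have coeff_V: "G f (b j) = 0" if f: "f \<in> V" and j: "p \<le> j" "j < l" for f j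
  proof -
    have "G (G.proj b p f) (b j) = (\<Sum>i<p. G f (b i) * G (b i) (b j))"
      unfolding G.proj_def by (simp only: G.sum_left G.scale_left)
    also have "\<dots> = 0" using j b(1) by (intro sum.neutral) (auto simp: bON)
    finally show ?thesis by (simp only: expandV[OF f])
  qed
  have parseval: "G f g = (\<Sum>i<l. G f (b i) * cnj (G g (b i)))" if "f \<in> S" for f g
  proof -
    have "G f g = G (G.proj b l f) g" by (simp only: expand[OF that])
    also have "\<dots> = (\<Sum>i<l. G f (b i) * G (b i) g)"
      unfolding G.proj_def by (simp only: G.sum_left G.scale_left)
    finally show ?thesis by (simp only: G.sym[of "b _" g])
  qed
  have l: "0 < l"
  proof (rule ccontr)
    assume "\<not> 0 < l"
    then have "G.proj b l (hd (matrix_units n)) = 0" by (simp add: G.proj_def)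
    moreover have mem: "(\<lambda>q'. if q' = (0, 0) then 1 else 0) \<in> set (matrix_units n)"
      using n by (auto simp: matrix_units_def)
    ultimately have "(\<lambda>q'. if q' = (0 :: nat, 0 :: nat) then 1 else 0 :: complex) = 0"
      using expand[of "\<lambda>q'. if q' = (0, 0) then 1 else 0"] units_S \<open>\<not> 0 < l\<close>
      by (auto simp: G.proj_def)
    from fun_cong[OF this, of "(0, 0)"] show False by simp
  qed

  \<comment> \<open>Left multiplication by \<open>Y k\<close> in coordinates, and its truncation to \<open>V\<close>.\<close>
  define J where "J f = vec l (\<lambda>i. G f (b i))" for f
  define \<pi> where "\<pi> A = mat l l (\<lambda>(i, j). G (act A (b j)) (b i))" for A
  have \<pi>c: "\<pi> A \<in> carrier_mat l l" for A by (simp add: \<pi>_def)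
  have act_coeff: "G (act A f) (b i) = (\<Sum>j<l. G f (b j) * G (act A (b j)) (b i))"
    if "f \<in> S" for A f i
  proof -
    have "act A f = act A (G.proj b l f)" by (simp only: expand[OF that])
    also have "\<dots> = (\<Sum>j<l. cscale (G f (b j)) (act A (b j)))"
      unfolding G.proj_def by (simp only: act_sum act_cscale)
    finally show ?thesis by (simp only: G.sum_left G.scale_left)
  qed
  have \<pi>_scalar: "\<pi> (a \<cdot>\<^sub>m 1\<^sub>m n) = a \<cdot>\<^sub>m 1\<^sub>m l" for a
  proof (rule eq_matI)
    fix i j assume "i < dim_row (a \<cdot>\<^sub>m 1\<^sub>m l)" "j < dim_col (a \<cdot>\<^sub>m 1\<^sub>m l)"
    then have ij: "i < l" "j < l" by auto
    have "act (a \<cdot>\<^sub>m 1\<^sub>m n) (b j) = cscale a (b j)"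
      using bS[OF ij(2)] unfolding S_def by (rule act_smult_one)
    then show "\<pi> (a \<cdot>\<^sub>m 1\<^sub>m n) $$ (i, j) = (a \<cdot>\<^sub>m 1\<^sub>m l) $$ (i, j)"
      using ij by (simp add: \<pi>_def G.scale_left bON)
  qed (auto simp: \<pi>_def)
  have \<pi>_add: "\<pi> (A + A') = \<pi> A + \<pi> A'" if "A \<in> carrier_mat n n" "A' \<in> carrier_mat n n" for A A'
    by (rule eq_matI) (auto simp: \<pi>_def act_add_mat[OF that] G.add_left)
  have \<pi>_mult: "\<pi> (A * A') = \<pi> A * \<pi> A'" if "A \<in> carrier_mat n n" "A' \<in> carrier_mat n n" for A A'
  proof (rule eq_matI)
    fix i j assume "i < dim_row (\<pi> A * \<pi> A')" "j < dim_col (\<pi> A * \<pi> A')"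
    then have ij: "i < l" "j < l" by (auto simp: \<pi>_def)
    have "\<pi> (A * A') $$ (i, j) = G (act A (act A' (b j))) (b i)"
      using ij by (simp add: \<pi>_def act_mult_mat[OF that])
    also have "\<dots> = (\<Sum>k<l. G (act A' (b j)) (b k) * G (act A (b k)) (b i))"
      by (rule act_coeff[OF actS[OF that(2) bS[OF ij(2)]]])
    also have "\<dots> = (\<pi> A * \<pi> A') $$ (i, j)"
      using ij by (simp add: \<pi>_def scalar_prod_def atLeast0LessThan mult.commute)
    finally show "\<pi> (A * A') $$ (i, j) = (\<pi> A * \<pi> A') $$ (i, j)" .
  qed (auto simp: \<pi>_def)
  define T1 where "T1 k = \<pi> (Y k)" for k
  define T0 where "T0 k = mat l l (\<lambda>(i, j). if j < p then T1 k $$ (i, j) else 0)" for k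
  have T1: "T1 \<in> mat_tuples l" and T0: "T0 \<in> mat_tuples l"
    by (auto simp: mat_tuples_def T1_def T0_def \<pi>c)
  have T1_def': "eval_star l T1 e \<noteq> None" if e: "e \<in> star_of ` es" for e
  proof -
    obtain e' where e': "e' \<in> es" "e = star_of e'" using e by blast
    then obtain E where "eval_expr n Y e' = Some E" using es(2) by blast
    then have "eval_expr l (\<lambda>k. \<pi> (Y k)) e' = Some (\<pi> E)"
      by (intro eval_expr_hom[of Y n \<pi> l]) (auto simp: Yc \<pi>c \<pi>_scalar \<pi>_add \<pi>_mult)
    then show ?thesis using e'(2) by (simp add: eval_star_star_of T1_def[abs_def])
  qed
  have norm_J: "(cvec_norm (J f))\<^sup>2 = Re (G f f)" if "f \<in> S" for f
  proof -
    have "complex_of_real ((cvec_norm (J f))\<^sup>2) = (\<Sum>i<l. G f (b i) * cnj (G f (b i)))"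
      unfolding cvec_norm_square of_real_sum by (simp only: complex_norm_square) (simp add: J_def)
    then have "complex_of_real ((cvec_norm (J f))\<^sup>2) = G f f"
      by (rule trans[OF _ parseval[symmetric, OF that]])
    then show ?thesis by (metis Re_complex_of_real)
  qed
  have "strict_contraction (T0 k)" for k
    unfolding strict_contraction_def
  proof (intro exI[of _ c] conjI contr ballI)
    fix v :: "complex vec" assume "v \<in> carrier_vec (dim_col (T0 k))"
    then have v: "v \<in> carrier_vec l" by (simp add: T0_def)
    define f where "f = (\<Sum>j<p. cscale (v $ j) (b j))"
    have f: "f \<in> V" unfolding f_def by (intro cfun.subspace_sum cfun.subspace_scale V bV) auto
    then have fV': "f \<in> V'" and fS: "f \<in> S" using VV' V'S by auto
    have af: "act (Y k) f \<in> V'" using shift f unfolding V_def V'_def by blast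
    then have afS: "act (Y k) f \<in> S" using V'S by blast
    have "T0 k *\<^sub>v v = J (act (Y k) f)"
    proof (rule eq_vecI)
      fix i assume "i < dim_vec (J (act (Y k) f))"
      then have i: "i < l" by (simp add: J_def)
      have "(T0 k *\<^sub>v v) $ i = (\<Sum>j<l. (if j < p then T1 k $$ (i, j) else 0) * v $ j)"
        using i v by (simp add: T0_def scalar_prod_def atLeast0LessThan)
      also have "\<dots> = (\<Sum>j<p. T1 k $$ (i, j) * v $ j)"
        using b(1) by (intro sum.mono_neutral_cong_right) auto
      also have "\<dots> = (\<Sum>j<p. v $ j * G (act (Y k) (b j)) (b i))"
        using i b(1) by (intro sum.cong) (auto simp: T1_def \<pi>_def)
      also have "\<dots> = G (act (Y k) f) (b i)"
        unfolding f_def by (simp only: act_sum act_cscale G.sum_left G.scale_left)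
      finally show "(T0 k *\<^sub>v v) $ i = J (act (Y k) f) $ i" using i by (simp add: J_def)
    qed (simp add: T0_def J_def)
    then have "(cvec_norm (T0 k *\<^sub>v v))\<^sup>2 = Re (B (act (Y k) f) (act (Y k) f))"
      using norm_J[OF afS] G_V'[OF af af] by simp
    also have "\<dots> \<le> c\<^sup>2 * Re (B f f)" using contr(3) f unfolding V_def by blast
    also have "B f f = G f f" using G_V'[OF fV' fV'] by simp
    also have "Re (G f f) = (\<Sum>j<p. (cmod (v $ j))\<^sup>2)"
    proof -
      have "G.orthonormal b p" using b(1,3) by (auto simp: G.orthonormal_def)
      then show ?thesis unfolding f_def by (simp only: G.orthonormal_comb Re_complex_of_real)
    qed
    also have "c\<^sup>2 * (\<Sum>j<p. (cmod (v $ j))\<^sup>2) \<le> c\<^sup>2 * (cvec_norm v)\<^sup>2"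
      unfolding cvec_norm_square using v b(1) by (intro mult_left_mono sum_mono2) auto
    finally have "(cvec_norm (T0 k *\<^sub>v v))\<^sup>2 \<le> (c * cvec_norm v)\<^sup>2" by (simp add: power_mult_distrib)
    then show "cvec_norm (T0 k *\<^sub>v v) \<le> c * cvec_norm v"
      by (rule power2_le_imp_le) (intro mult_nonneg_nonneg contr cvec_norm_nonneg)
  qed
  then have "infinite {s. (\<forall>i. strict_contraction (line T0 T1 s i)) \<and>
      (\<forall>e\<in>star_of ` es. eval_star l (line T0 T1 s) e \<noteq> None)}"
    using es(1) T1_def' by (intro line_generic T0 T1) auto
  then obtain s where s: "\<And>i. strict_contraction (line T0 T1 s i)"
    "\<And>e. e \<in> star_of ` es \<Longrightarrow> eval_star l (line T0 T1 s) e \<noteq> None"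
    using not_finite_existsD by blast
  define T where "T = line T0 T1 s"
  have T: "T \<in> mat_tuples l" unfolding T_def by (rule line_tuple[OF T0 T1])
  then have Tc: "T k \<in> carrier_mat l l" for k by (simp add: mat_tuples_def)
  have T_es: "eval_expr l T e \<noteq> None" if "e \<in> es" for e
    using s(2)[of "star_of e"] that by (simp add: T_def eval_star_star_of)

  have JT: "T k *\<^sub>v J f = J (act (Y k) f)" if f: "f \<in> V" for k f
  proof (rule eq_vecI)
    fix i assume "i < dim_vec (J (act (Y k) f))"
    then have i: "i < l" by (simp add: J_def)
    have fS: "f \<in> S" using f VV' V'S by blast
    have "(T k *\<^sub>v J f) $ i = (\<Sum>j<l. T k $$ (i, j) * G f (b j))"
      using i Tc[of k] by (simp add: J_def scalar_prod_def atLeast0LessThan)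
    also have "\<dots> = (\<Sum>j<l. G f (b j) * G (act (Y k) (b j)) (b i))"
    proof (intro sum.cong refl)
      fix j assume "j \<in> {..<l}"
      then have j: "j < l" by simp
      show "T k $$ (i, j) * G f (b j) = G f (b j) * G (act (Y k) (b j)) (b i)"
      proof (cases "j < p")
        case True
        then have "T k $$ (i, j) = T1 k $$ (i, j)"
          using i j mat_tuples_dim[OF T1] by (simp add: T_def line_def T0_def)
        then show ?thesis using i j by (simp add: T1_def \<pi>_def)
      qed (use coeff_V[OF f _ j] in simp)
    qed
    also have "\<dots> = G (act (Y k) f) (b i)" by (rule act_coeff[OF fS, symmetric])
    finally show "(T k *\<^sub>v J f) $ i = J (act (Y k) f) $ i" using i by (simp add: J_def)
  qed (use Tc[of k] in \<open>simp add: J_def\<close>)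

  define x where "x = J (entries (1\<^sub>m n))"
  have eval_x: "E' *\<^sub>v x = J (entries E)"
    if e: "e \<in> es" "eval_expr n Y e = Some E" "eval_expr l T e = Some E'" for e E E'
  proof -
    have E: "E \<in> carrier_mat n n" using e(2) Yc by (rule eval_expr_carrier[rotated])
    have one: "1 \<cdot>\<^sub>m 1\<^sub>m n = (1\<^sub>m n :: complex mat)" by (rule eq_matI) auto
    have "E' *\<^sub>v J (entries (1\<^sub>m n)) = J (entries (E * 1\<^sub>m n))"
    proof (rule eval_expr_intertwine[where J = "\<lambda>F. J (entries F)" and f = "Const 1", OF Yc Tc _ _ _ e(2,3)])
      show "eval_expr n Y (Const 1) = Some (1\<^sub>m n)" by (simp add: one)
      fix g H k assume g: "g \<in> set (var_args e (Const 1))" "eval_expr n Y g = Some H"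
      have H: "H \<in> carrier_mat n n" using g(2) Yc by (rule eval_expr_carrier[rotated])
      have "entries H \<in> V" unfolding V_def using args[OF e(1) g] .
      then have "T k *\<^sub>v J (entries H) = J (act (Y k) (entries H))" by (rule JT)
      then show "T k *\<^sub>v J (entries H) = J (entries (Y k * H))"
        by (simp only: act_entries[OF Yc H])
    next
      fix F F' :: "complex mat" assume F: "F \<in> carrier_mat n n" "F' \<in> carrier_mat n n"
      show "J (entries (F + F')) = J (entries F) + J (entries F')"
        unfolding entries_add[OF F] J_def by (intro eq_vecI) (auto simp: G.add_left)
    next
      fix a and F :: "complex mat"
      show "J (entries (a \<cdot>\<^sub>m F)) = a \<cdot>\<^sub>v J (entries F)"
        unfolding entries_smult J_def by (intro eq_vecI) (auto simp: G.scale_left)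
    qed (simp add: J_def)
    then show ?thesis using E by (simp add: x_def)
  qed
  have "(E' *\<^sub>v x) \<bullet>c (F' *\<^sub>v x) = B (entries E) (entries F)"
    if e: "e \<in> es" "eval_expr n Y e = Some E" "eval_expr l T e = Some E'"
      and f: "f \<in> es" "eval_expr n Y f = Some F" "eval_expr l T f = Some F'" for e f E F E' F'
  proof -
    have E: "entries E \<in> V'" and F: "entries F \<in> V'"
      using vals[OF e(1,2)] vals[OF f(1,2)] by (simp_all add: V'_def)
    have "(E' *\<^sub>v x) \<bullet>c (F' *\<^sub>v x) = J (entries E) \<bullet>c J (entries F)"
      by (simp only: eval_x[OF e] eval_x[OF f])
    also have "\<dots> = (\<Sum>i<l. G (entries E) (b i) * cnj (G (entries F) (b i)))"
      by (simp add: J_def scalar_prod_def atLeast0LessThan)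
    also have "\<dots> = G (entries E) (entries F)" using E V'S by (intro parseval[symmetric]) auto
    also have "\<dots> = B (entries E) (entries F)" by (rule G_V'[OF E F])
    finally show ?thesis .
  qed
  moreover have "x \<in> carrier_vec l" by (simp add: x_def J_def)
  ultimately show ?thesis
    using l T T_es s(1) unfolding T_def[symmetric] by blast
qed

section \<open>Functions on a common domain\<close>

text \<open>
  Induction on the number of generators. If a function \<open>h0\<close> in the larger span vanishes at the points
  found so far, adding one point where it is nonzero removes the one new dimension.
\<close>

lemma finite_determining_set:
  fixes T :: "('p \<Rightarrow> complex) set"
  assumes "finite T"
  shows "\<exists>P. finite P \<and> (\<forall>h\<in>cfun.span T. (\<forall>p\<in>P. h p = 0) \<longrightarrow> h = 0)"
  using assms
proof (induction T rule: finite_induct)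
  case empty
  have "h = 0" if "h \<in> cfun.span {}" for h :: "'p \<Rightarrow> complex"
    using that unfolding cfun.span_empty by (rule singletonD)
  then show ?case by blast
next
  case (insert f T)
  then obtain P where P: "finite P" and P_all: "\<forall>h\<in>cfun.span T. (\<forall>p\<in>P. h p = 0) \<longrightarrow> h = 0"
    by (elim exE conjE)
  have P0: "h = 0" if "h \<in> cfun.span T" "\<And>p. p \<in> P \<Longrightarrow> h p = 0" for h
    using P_all that by blast
  show ?case
  proof (cases "\<exists>h\<in>cfun.span (insert f T). (\<forall>p\<in>P. h p = 0) \<and> h \<noteq> 0")
    case False
    then show ?thesis using P by blast
  next
    case True
    then obtain h0 where h0: "h0 \<in> cfun.span (insert f T)" "\<And>p. p \<in> P \<Longrightarrow> h0 p = 0" "h0 \<noteq> 0" by blast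
    then obtain p0 where p0: "h0 p0 \<noteq> 0" by (auto simp: fun_eq_iff)
    obtain k0 where k0: "h0 - cscale k0 f \<in> cfun.span T"
      using h0(1) by (auto simp: cfun.span_breakdown_eq)
    have "k0 \<noteq> 0"
    proof
      assume "k0 = 0"
      then have "h0 \<in> cfun.span T" using k0 by simp
      then have "h0 = 0" by (rule P0) (rule h0(2))
      then show False using h0(3) by simp
    qed
    have "h = 0" if h: "h \<in> cfun.span (insert f T)" "\<And>p. p \<in> insert p0 P \<Longrightarrow> h p = 0" for h
    proof -
      obtain k where k: "h - cscale k f \<in> cfun.span T"
        using h(1) by (auto simp: cfun.span_breakdown_eq)
      have "h - cscale (k / k0) h0 = (h - cscale k f) - cscale (k / k0) (h0 - cscale k0 f)"
        using \<open>k0 \<noteq> 0\<close> by (auto simp: fun_eq_iff algebra_simps)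
      also have "\<dots> \<in> cfun.span T" by (intro cfun.span_diff cfun.span_scale k k0)
      finally have "h - cscale (k / k0) h0 \<in> cfun.span T" .
      then have eq: "h - cscale (k / k0) h0 = 0" by (rule P0) (use h(2) h0(2) in simp)
      have "k = 0" using fun_cong[OF eq, of p0] h(2)[of p0] p0 \<open>k0 \<noteq> 0\<close> by simp
      then show ?thesis using eq by simp
    qed
    then show ?thesis using P by (intro exI[of _ "insert p0 P"]) blast
  qed
qed

text \<open>
  The matrix product of the adjoint of \<open>f\<close> with \<open>g\<close>.
\<close>

definition adj_prod :: "nat \<Rightarrow> (nat \<times> nat \<Rightarrow> complex) \<Rightarrow> (nat \<times> nat \<Rightarrow> complex) \<Rightarrow> nat \<times> nat \<Rightarrow> complex" where
  "adj_prod n f g = (\<lambda>(i, j). if i < n \<and> j < n then \<Sum>c<n. cnj (f (c, i)) * g (c, j) else 0)"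

lemma adj_prod_add_right: "adj_prod n f (g + g') = adj_prod n f g + adj_prod n f g'"
  by (auto simp: adj_prod_def fun_eq_iff algebra_simps sum.distrib)

lemma adj_prod_add_left: "adj_prod n (f + f') g = adj_prod n f g + adj_prod n f' g"
  by (auto simp: adj_prod_def fun_eq_iff algebra_simps sum.distrib)

lemma adj_prod_cscale_right: "adj_prod n f (cscale c g) = cscale c (adj_prod n f g)"
  by (auto simp: adj_prod_def fun_eq_iff algebra_simps sum_distrib_left)

lemma adj_prod_cscale_left: "adj_prod n (cscale c f) g = cscale (cnj c) (adj_prod n f g)"
  by (auto simp: adj_prod_def fun_eq_iff algebra_simps sum_distrib_left)

lemma adj_prod_zero: "adj_prod n 0 g = 0" "adj_prod n f 0 = 0"
  by (auto simp: adj_prod_def fun_eq_iff)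

lemma adj_prod_adjoint: "adj_prod n g f (j, i) = cnj (adj_prod n f g (i, j))"
  by (auto simp: adj_prod_def cnj_sum mult.commute)

lemma adj_prod_entries:
  assumes "A \<in> carrier_mat n n" "B \<in> carrier_mat n n"
  shows "adj_prod n (entries A) (entries B) = entries (mat_adjoint A * B)"
  using assms
  by (auto simp: adj_prod_def entries_def fun_eq_iff scalar_prod_def atLeast0LessThan intro!: sum.cong)

type_synonym 'd point = "nat \<times> ('d \<Rightarrow> complex mat)"

definition at_point :: "'d point \<Rightarrow> ('d point \<times> nat \<times> nat \<Rightarrow> complex) \<Rightarrow> nat \<times> nat \<Rightarrow> complex" where
  "at_point pt f = (\<lambda>q. f (pt, q))"

lemma at_point_linear:
  "at_point pt (f + g) = at_point pt f + at_point pt g"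
  "at_point pt (f - g) = at_point pt f - at_point pt g"
  "at_point pt (cscale c f) = cscale c (at_point pt f)"
  "at_point pt 0 = 0"
  by (auto simp: at_point_def fun_eq_iff)

lemma at_point_sum: "at_point pt (\<Sum>a\<in>A. f a) = (\<Sum>a\<in>A. at_point pt (f a))"
  by (auto simp: at_point_def fun_eq_iff sum_fun_apply)

lemma fun_eq_at_pointI: "(\<And>pt. at_point pt f = at_point pt g) \<Longrightarrow> f = g"
  by (auto simp: at_point_def fun_eq_iff)

definition hprod :: "('d point \<times> nat \<times> nat \<Rightarrow> complex) \<Rightarrow> ('d point \<times> nat \<times> nat \<Rightarrow> complex) \<Rightarrow>
    'd point \<times> nat \<times> nat \<Rightarrow> complex" where
  "hprod f g = (\<lambda>(pt, q). adj_prod (fst pt) (at_point pt f) (at_point pt g) q)"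

lemma at_point_hprod: "at_point pt (hprod f g) = adj_prod (fst pt) (at_point pt f) (at_point pt g)"
  by (auto simp: at_point_def hprod_def)

lemma hprod_linear:
  "hprod f (g + g') = hprod f g + hprod f g'"
  "hprod (f + f') g = hprod f g + hprod f' g"
  "hprod f (cscale c g) = cscale c (hprod f g)"
  "hprod (cscale c f) g = cscale (cnj c) (hprod f g)"
  "hprod f 0 = 0" "hprod 0 g = 0"
  by (rule fun_eq_at_pointI, simp only: at_point_hprod at_point_linear adj_prod_add_left adj_prod_add_right
      adj_prod_cscale_left adj_prod_cscale_right adj_prod_zero)+

text \<open>
  On a set of points that is closed under direct sums, expressions defined everywhere are treated as
  functions; linear algebra then applies to them directly.
\<close>

locale common_domain =
  fixes D :: "'d::finite point set"
  assumes D_pos: "(n, X) \<in> D \<Longrightarrow> 0 < n"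
    and D_tuple: "(n, X) \<in> D \<Longrightarrow> X \<in> mat_tuples n"
    and D_sum: "(n, X) \<in> D \<Longrightarrow> (m, Y) \<in> D \<Longrightarrow> (n + m, \<lambda>i. block_sum (X i) (Y i)) \<in> D"
    and D_nonempty: "D \<noteq> {}"
begin

definition good :: "'d nc_expr \<Rightarrow> bool" where
  "good e \<longleftrightarrow> (\<forall>(n, X)\<in>D. eval_expr n X e \<noteq> None)"

lemma goodD: "good e \<Longrightarrow> (n, X) \<in> D \<Longrightarrow> \<exists>E. eval_expr n X e = Some E \<and> E \<in> carrier_mat n n"
  using eval_expr_carrier[of X n e] D_tuple[of n X] unfolding good_def mat_tuples_def by fastforce

lemma good_Const: "good (Const c)"
  by (simp add: good_def)

lemma good_Sym: "good (Sym k)"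
  by (simp add: good_def)

lemma good_Add: "good a \<Longrightarrow> good b \<Longrightarrow> good (Add a b)"
  by (fastforce simp: good_def)

lemma good_Mult: "good a \<Longrightarrow> good b \<Longrightarrow> good (Mult a b)"
  by (fastforce simp: good_def)

lemma good_nc_dom: "good e \<Longrightarrow> nc_dom e \<noteq> {}"
  using D_nonempty D_pos D_tuple unfolding good_def nc_dom_def by fastforce

lemma good_var_args: "good e \<Longrightarrow> good f \<Longrightarrow> g \<in> set (var_args e f) \<Longrightarrow> good g"
  using var_args_defined unfolding good_def by blast

text \<open>
  The value at a point outside \<open>D\<close> is zero, which makes equality on \<open>D\<close> equality of functions.
\<close>

definition val :: "'d nc_expr \<Rightarrow> 'd point \<times> nat \<times> nat \<Rightarrow> complex" where
  "val e = (\<lambda>(pt, q). if pt \<in> D then entries (the (eval_expr (fst pt) (snd pt) e)) q else 0)"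

lemma at_point_val: "at_point pt (val e) = (if pt \<in> D then entries (the (eval_expr (fst pt) (snd pt) e)) else 0)"
  by (auto simp: at_point_def val_def fun_eq_iff)

lemma val_zero: "val (Const 0) = 0"
  by (auto simp: val_def entries_def fun_eq_iff)

lemma val_lincomb:
  assumes "good u" "good e"
  shows "val (Add (Mult (Const c) u) e) = cscale c (val u) + val e"
proof (rule fun_eq_at_pointI)
  fix pt :: "'d point"
  obtain n X where pt: "pt = (n, X)" by (cases pt)
  show "at_point pt (val (Add (Mult (Const c) u) e)) = at_point pt (cscale c (val u) + val e)"
  proof (cases "pt \<in> D")
    case True
    obtain U E where U: "eval_expr n X u = Some U" "U \<in> carrier_mat n n"
      and E: "eval_expr n X e = Some E" "E \<in> carrier_mat n n"
      using goodD assms True pt by blast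
    have "(c \<cdot>\<^sub>m 1\<^sub>m n) * U = c \<cdot>\<^sub>m U"
      using U mult_smult_assoc_mat[of "1\<^sub>m n" n n U n c] by simp
    moreover have "entries (c \<cdot>\<^sub>m U + E) = cscale c (entries U) + entries E"
      using U E by (simp only: entries_add[of "c \<cdot>\<^sub>m U" n n E] smult_carrier_mat entries_smult)
    ultimately show ?thesis
      unfolding at_point_linear at_point_val using True pt U E by (simp only: fst_conv snd_conv if_True) simp
  next
    case False
    then show ?thesis unfolding at_point_linear at_point_val by (auto simp: fun_eq_iff)
  qed
qed

definition shift :: "'d \<Rightarrow> ('d point \<times> nat \<times> nat \<Rightarrow> complex) \<Rightarrow> 'd point \<times> nat \<times> nat \<Rightarrow> complex" where
  "shift k f = (\<lambda>(pt, q). if pt \<in> D then act (snd pt k) (at_point pt f) q else 0)"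

lemma at_point_shift: "at_point pt (shift k f) = (if pt \<in> D then act (snd pt k) (at_point pt f) else 0)"
  by (auto simp: at_point_def shift_def fun_eq_iff)

lemma shift_linear:
  "shift k (f + g) = shift k f + shift k g"
  "shift k (cscale c f) = cscale c (shift k f)"
  "shift k 0 = 0"
  by (rule fun_eq_at_pointI, simp add: at_point_shift at_point_linear act_add act_cscale act_zero)+

lemma val_shift:
  assumes "good e"
  shows "val (Mult (Sym k) e) = shift k (val e)"
proof (rule fun_eq_at_pointI)
  fix pt :: "'d point"
  obtain n X where pt: "pt = (n, X)" by (cases pt)
  show "at_point pt (val (Mult (Sym k) e)) = at_point pt (shift k (val e))"
  proof (cases "pt \<in> D")
    case True
    obtain E where E: "eval_expr n X e = Some E" "E \<in> carrier_mat n n"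
      using goodD assms True pt by blast
    have "X k \<in> carrier_mat n n" using D_tuple True pt by (auto simp: mat_tuples_def)
    then show ?thesis
      unfolding at_point_shift at_point_val using True pt E by (simp add: act_entries)
  qed (simp add: at_point_shift at_point_val)
qed

lemma span_val_expr:
  assumes "f \<in> cfun.span (val ` U)" "\<And>u. u \<in> U \<Longrightarrow> good u"
  shows "\<exists>e. good e \<and> val e = f"
  using assms(1)
proof (induction rule: cfun.span_induct_alt)
  case base
  then show ?case using good_Const val_zero by blast
next
  case (step c x y)
  then obtain u e where "u \<in> U" "x = val u" "good e" "val e = y" by blast
  then show ?case
    using val_lincomb[of u e c] assms(2) good_Add good_Mult good_Const by metis
qed

definition products :: "'d nc_expr set \<Rightarrow> ('d point \<times> nat \<times> nat \<Rightarrow> complex) set" where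
  "products U = (\<lambda>(u, v). hprod (val u) (val v)) ` (U \<times> U)"

lemma hprod_in_span:
  assumes "f \<in> cfun.span (val ` U)" "g \<in> cfun.span (val ` U)"
  shows "hprod f g \<in> cfun.span (products U)"
  using assms(1)
proof (induction rule: cfun.span_induct_alt)
  case base
  then show ?case by (simp only: hprod_linear cfun.span_zero)
next
  case (step c x f)
  from step(1) obtain u where u: "u \<in> U" "x = val u" by blast
  have "hprod (val u) g \<in> cfun.span (products U)"
    using assms(2)
  proof (induction rule: cfun.span_induct_alt)
    case base
    then show ?case by (simp only: hprod_linear cfun.span_zero)
  next
    case (step c y g)
    from step(1) obtain v where v: "v \<in> U" "y = val v" by blast
    have "hprod (val u) (val v) \<in> cfun.span (products U)"
      by (rule cfun.span_base) (use u v in \<open>auto simp: products_def\<close>)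
    then show ?case
      unfolding hprod_linear v(2) by (intro cfun.span_add cfun.span_scale step.IH)
  qed
  then show ?case
    unfolding hprod_linear u(2) by (intro cfun.span_add cfun.span_scale step.IH)
qed

lemma products_span_off_domain:
  assumes "h \<in> cfun.span (products U)" "pt \<notin> D \<or> \<not> (i < fst pt \<and> j < fst pt)"
  shows "h (pt, i, j) = 0"
  using assms(1)
proof (induction rule: cfun.span_induct_alt)
  case (step c x y)
  then have "x (pt, i, j) = 0"
    using assms(2) by (auto simp: products_def hprod_def adj_prod_def at_point_val)
  with step show ?case by simp
qed simp

text \<open>
  Hereditary functions respect direct sums; this property is linear, so it passes from the products
  to their span.
\<close>

lemma products_span_block_sum:
  assumes U: "\<And>u. u \<in> U \<Longrightarrow> good u" and X: "(n, X) \<in> D" and Y: "(m, Y) \<in> D"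
    and "h \<in> cfun.span (products U)"
  shows "(\<forall>i<n. \<forall>j<n. h ((n + m, \<lambda>k. block_sum (X k) (Y k)), i, j) = h ((n, X), i, j)) \<and>
    (\<forall>i<m. \<forall>j<m. h ((n + m, \<lambda>k. block_sum (X k) (Y k)), n + i, n + j) = h ((m, Y), i, j))"
  using assms(4)
proof (induction rule: cfun.span_induct_alt)
  case (step c x y)
  from step(1) obtain u v where uv: "u \<in> U" "v \<in> U" "x = hprod (val u) (val v)"
    by (auto simp: products_def)
  let ?Z = "\<lambda>k. block_sum (X k) (Y k)"
  have Z: "(n + m, ?Z) \<in> D" using D_sum X Y .
  obtain A A' B B' where A: "eval_expr n X u = Some A" "A \<in> carrier_mat n n"
    and A': "eval_expr m Y u = Some A'" "A' \<in> carrier_mat m m"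
    and B: "eval_expr n X v = Some B" "B \<in> carrier_mat n n"
    and B': "eval_expr m Y v = Some B'" "B' \<in> carrier_mat m m"
    using goodD U uv X Y by metis
  have cX: "X k \<in> carrier_mat n n" and cY: "Y k \<in> carrier_mat m m" for k
    using D_tuple[OF X] D_tuple[OF Y] by (auto simp: mat_tuples_def)
  have eu: "eval_expr (n + m) ?Z u = Some (block_sum A A')"
    and ev: "eval_expr (n + m) ?Z v = Some (block_sum B B')"
    by (rule eval_expr_block_sum[OF cX cY]; fact)+
  have "mat_adjoint (block_sum A A') * block_sum B B' = block_sum (mat_adjoint A * B) (mat_adjoint A' * B')"
    using A A' B B' by (simp add: block_sum_adjoint[of _ n _ m] block_sum_mult[of _ n _ m] mat_adjoint_carrier)
  then have 1: "at_point (n + m, ?Z) x = entries (block_sum (mat_adjoint A * B) (mat_adjoint A' * B'))"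
    unfolding uv(3) at_point_hprod at_point_val using Z A A' B B'
    by (simp add: eu ev adj_prod_entries block_sum_carrier)
  have 2: "at_point (n, X) x = entries (mat_adjoint A * B)" "at_point (m, Y) x = entries (mat_adjoint A' * B')"
    unfolding uv(3) at_point_hprod at_point_val using X Y A A' B B' by (simp_all add: adj_prod_entries)
  have "x ((n + m, ?Z), i, j) = x ((n, X), i, j)" if "i < n" "j < n" for i j
    using fun_cong[OF 1, of "(i, j)"] fun_cong[OF 2(1), of "(i, j)"] that A A' B B'
    by (simp add: at_point_def entries_def block_sum_def)
  moreover have "x ((n + m, ?Z), n + i, n + j) = x ((m, Y), i, j)" if "i < m" "j < m" for i j
    using fun_cong[OF 1, of "(n + i, n + j)"] fun_cong[OF 2(2), of "(i, j)"] that A A' B B'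
    by (simp add: at_point_def entries_def block_sum_def)
  ultimately show ?case using step.IH by simp
qed simp

text \<open>
  A function in the span that vanishes at a direct sum vanishes at each summand, so the direct sum of
  finitely many determining points is a single determining point.
\<close>

theorem determining_point:
  assumes "finite U" and U: "\<And>u. u \<in> U \<Longrightarrow> good u"
  shows "\<exists>pt\<in>D. \<forall>h\<in>cfun.span (products U). at_point pt h = 0 \<longrightarrow> h = 0"
proof -
  have "finite (products U)" using assms(1) by (simp add: products_def)
  then obtain P where P: "finite P" "\<And>h. h \<in> cfun.span (products U) \<Longrightarrow> (\<And>p. p \<in> P \<Longrightarrow> h p = 0) \<Longrightarrow> h = 0"
    using finite_determining_set by metis
  have "\<exists>pt\<in>D. \<forall>h\<in>cfun.span (products U). at_point pt h = 0 \<longrightarrow> (\<forall>p\<in>Q. at_point p h = 0)"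
    if "finite Q" "Q \<subseteq> D" for Q
    using that
  proof (induction Q rule: finite_induct)
    case empty
    then show ?case using D_nonempty by blast
  next
    case (insert p Q)
    then obtain pt where pt: "pt \<in> D" "\<And>h. h \<in> cfun.span (products U) \<Longrightarrow> at_point pt h = 0 \<Longrightarrow> \<forall>p\<in>Q. at_point p h = 0"
      by blast
    obtain n X m Y where X: "pt = (n, X)" and Y: "p = (m, Y)" by (cases pt, cases p)
    let ?Z = "(n + m, \<lambda>k. block_sum (X k) (Y k))"
    have XD: "(n, X) \<in> D" and YD: "(m, Y) \<in> D" using pt(1) insert.prems X Y by auto
    have "\<forall>p\<in>insert p Q. at_point p h = 0" if h: "h \<in> cfun.span (products U)" "at_point ?Z h = 0" for h
    proof -
      have Z0: "h (?Z, i, j) = 0" for i j using fun_cong[OF h(2), of "(i, j)"] by (simp add: at_point_def)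
      note blocks = products_span_block_sum[OF U XD YD h(1)]
      have "h ((n, X), i, j) = 0" for i j
        using blocks Z0 products_span_off_domain[OF h(1), of "(n, X)" i j] by (cases "i < n \<and> j < n") auto
      then have "at_point pt h = 0" by (auto simp: X at_point_def fun_eq_iff)
      moreover have "h ((m, Y), i, j) = 0" for i j
        using blocks Z0[of "n + i" "n + j"] products_span_off_domain[OF h(1), of "(m, Y)" i j]
        by (cases "i < m \<and> j < m") auto
      then have "at_point p h = 0" by (auto simp: Y at_point_def fun_eq_iff)
      ultimately show ?thesis using pt(2)[OF h(1)] by blast
    qed
    moreover have "?Z \<in> D" by (rule D_sum[OF XD YD])
    ultimately show ?case by blast
  qed
  from this[of "fst ` P \<inter> D"] P(1) obtain pt where pt: "pt \<in> D"
    "\<And>h. h \<in> cfun.span (products U) \<Longrightarrow> at_point pt h = 0 \<Longrightarrow> \<forall>p\<in>fst ` P \<inter> D. at_point p h = 0"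
    by blast
  have "h = 0" if h: "h \<in> cfun.span (products U)" "at_point pt h = 0" for h
  proof (rule P(2)[OF h(1)])
    fix p assume p: "p \<in> P"
    obtain x i j where x: "p = (x, i, j)" by (cases p)
    show "h p = 0"
    proof (cases "x \<in> D")
      case True
      then have "at_point x h = 0" using pt(2)[OF h] p x by force
      from fun_cong[OF this, of "(i, j)"] show ?thesis by (simp add: at_point_def x)
    qed (use products_span_off_domain[OF h(1)] x in simp)
  qed
  then show ?thesis using pt(1) by blast
qed

end

section \<open>Values of hereditary expressions\<close>

lemma entries_zero: "entries (0 \<cdot>\<^sub>m 1\<^sub>m n) = 0"
  by (auto simp: entries_def fun_eq_iff)

lemma eval_star_sum_expr:
  assumes X: "X \<in> mat_tuples n" and "\<And>e. e \<in> set es \<Longrightarrow> eval_star n X e \<noteq> None"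
  shows "\<exists>S. eval_star n X (sum_expr es) = Some S \<and> S \<in> carrier_mat n n \<and>
    entries S = sum_list (map (\<lambda>e. entries (the (eval_star n X e))) es)"
  using assms(2)
proof (induction es)
  case Nil
  show ?case
  proof (intro exI conjI)
    show "eval_star n X (sum_expr []) = Some (0 \<cdot>\<^sub>m 1\<^sub>m n)" by (simp add: sum_expr_def eval_star_def)
    show "entries (0 \<cdot>\<^sub>m 1\<^sub>m n) = sum_list (map (\<lambda>e. entries (the (eval_star n X e))) [])"
      by (simp only: entries_zero list.map sum_list.Nil)
  qed simp
next
  case (Cons e es)
  then obtain S where S: "eval_star n X (sum_expr es) = Some S" "S \<in> carrier_mat n n"
    "entries S = sum_list (map (\<lambda>e. entries (the (eval_star n X e))) es)" by auto
  obtain E where E: "eval_star n X e = Some E" using Cons.prems by fastforce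
  have cE: "E \<in> carrier_mat n n" by (rule eval_star_carrier[OF X E])
  have "eval_star n X (sum_expr (e # es)) = Some (E + S)"
    using E S(1) by (simp add: sum_expr_def eval_star_def)
  moreover have "entries (E + S) = sum_list (map (\<lambda>e. entries (the (eval_star n X e))) (e # es))"
    using entries_add[OF cE S(2)] by (simp only: S(3) list.map sum_list.Cons E option.sel)
  moreover have "E + S \<in> carrier_mat n n" using cE S(2) by simp
  ultimately show ?case by blast
qed

lemma eval_star_adj_mult:
  assumes X: "X \<in> mat_tuples n" and "eval_expr n X a = Some A" "eval_expr n X b = Some B"
  shows "eval_star n X (Mult (adj_expr (star_of a)) (star_of b)) = Some (mat_adjoint A * B)"
  using assms eval_star_adj_expr[OF X, of "star_of a"] eval_star_star_of[of n X a] eval_star_star_of[of n X b]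
  by (simp add: eval_star_def)

text \<open>
  The defect term is a difference of squares of functions in the span, \<open>R\<^sup>* R - (X\<^sub>k R)\<^sup>* (X\<^sub>k R)\<close>.
\<close>

lemma eval_star_defect:
  assumes X: "X \<in> mat_tuples n" and R: "eval_expr n X r = Some R"
  shows "\<exists>Q. eval_star n X (Mult (adj_expr (star_of r)) (Mult (defect_expr k) (star_of r))) = Some Q \<and>
    entries Q = adj_prod n (entries R) (entries R) - adj_prod n (entries (X k * R)) (entries (X k * R))"
proof -
  have cX: "X k \<in> carrier_mat n n" using X by (simp add: mat_tuples_def)
  have cR: "R \<in> carrier_mat n n"
    using eval_star_carrier[OF X, of "star_of r"] R by (simp add: eval_star_star_of)
  define W where "W = mat_adjoint (X k) * X k"
  have cW: "W \<in> carrier_mat n n" unfolding W_def by (rule mult_carrier_mat[OF mat_adjoint_carrier[OF cX] cX])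
  define Q where "Q = mat_adjoint R * ((1 \<cdot>\<^sub>m 1\<^sub>m n + (- 1) \<cdot>\<^sub>m 1\<^sub>m n * W) * R)"
  have "eval_star n X (Mult (adj_expr (star_of r)) (Mult (defect_expr k) (star_of r))) = Some Q"
    using R eval_star_adj_expr[OF X, of "star_of r"] eval_star_star_of[of n X r]
    by (simp add: eval_star_def defect_expr_def Q_def W_def)
  moreover have "Q = mat_adjoint R * R + (- 1) \<cdot>\<^sub>m (mat_adjoint (X k * R) * (X k * R))"
  proof -
    have 1: "(- 1) \<cdot>\<^sub>m 1\<^sub>m n * W = (- 1) \<cdot>\<^sub>m W"
      using cW mult_smult_assoc_mat[of "1\<^sub>m n" n n W n "- 1"] by simp
    have 2: "1 \<cdot>\<^sub>m 1\<^sub>m n = (1\<^sub>m n :: complex mat)" by (rule eq_matI) auto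
    have "(1 \<cdot>\<^sub>m 1\<^sub>m n + (- 1) \<cdot>\<^sub>m 1\<^sub>m n * W) * R = R + (- 1) \<cdot>\<^sub>m (W * R)"
      unfolding 1 2 using cW cR
      by (subst add_mult_distrib_mat[of _ n n _ _ n]) (simp_all add: mult_smult_assoc_mat[of W n n R n])
    moreover have "mat_adjoint R * (R + (- 1) \<cdot>\<^sub>m (W * R)) =
        mat_adjoint R * R + (- 1) \<cdot>\<^sub>m (mat_adjoint R * (W * R))"
      using cW cR mat_adjoint_carrier[OF cR]
      by (subst mult_add_distrib_mat[of _ n n _ n]) (simp_all add: mult_smult_distrib[of _ n n "W * R" n])
    moreover have "mat_adjoint R * (W * R) = mat_adjoint (X k * R) * (X k * R)"
    proof -
      have "mat_adjoint (X k * R) = mat_adjoint R * mat_adjoint (X k)"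
        by (rule mat_adjoint_mult[OF cX cR])
      then show ?thesis
        using cX cR mat_adjoint_carrier[OF cX] mat_adjoint_carrier[OF cR] unfolding W_def
        by (simp add: assoc_mult_mat[of _ n n _ n _ n])
    qed
    ultimately show ?thesis by (simp add: Q_def)
  qed
  moreover have "entries (mat_adjoint R * R + (- 1) \<cdot>\<^sub>m (mat_adjoint (X k * R) * (X k * R))) =
      adj_prod n (entries R) (entries R) - adj_prod n (entries (X k * R)) (entries (X k * R))"
  proof -
    have c1: "mat_adjoint R * R \<in> carrier_mat n n" using cR mat_adjoint_carrier[OF cR] by simp
    have c2: "X k * R \<in> carrier_mat n n" using cX cR by simp
    have c3: "(- 1) \<cdot>\<^sub>m (mat_adjoint (X k * R) * (X k * R)) \<in> carrier_mat n n"
      using c2 mat_adjoint_carrier[OF c2] by simp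
    have neg: "f + cscale (- 1) g = f - g" for f g :: "nat \<times> nat \<Rightarrow> complex"
      by (auto simp: fun_eq_iff)
    show ?thesis
      unfolding entries_add[OF c1 c3] entries_smult adj_prod_entries[OF cR cR] adj_prod_entries[OF c2 c2] by (rule neg)
  qed
  ultimately show ?thesis by blast
qed

text \<open>
  Polarization: a quadratic form with real values comes from a Hermitian matrix.
\<close>

lemma psd_hermitian:
  assumes A: "psd n A" and ij: "i < n" "j < n"
  shows "A $$ (j, i) = cnj (A $$ (i, j))"
proof -
  have cA: "A \<in> carrier_mat n n" using A by (simp add: psd_def)
  have q: "Im (\<alpha> * cnj \<alpha> * A $$ (i, i) + \<beta> * cnj \<alpha> * A $$ (i, j) + \<alpha> * cnj \<beta> * A $$ (j, i) + \<beta> * cnj \<beta> * A $$ (j, j)) = 0"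
    for \<alpha> \<beta>
  proof -
    define v where "v = vec n (\<lambda>k. (if k = i then \<alpha> else 0) + (if k = j then \<beta> else 0))"
    have Av: "(A *\<^sub>v v) $ k = A $$ (k, i) * \<alpha> + A $$ (k, j) * \<beta>" if "k < n" for k
    proof -
      have "(A *\<^sub>v v) $ k = (\<Sum>l<n. A $$ (k, l) * v $ l)"
        using that cA by (simp add: v_def scalar_prod_def atLeast0LessThan)
      also have "\<dots> = (\<Sum>l<n. (if l = i then A $$ (k, l) * \<alpha> else 0) + (if l = j then A $$ (k, l) * \<beta> else 0))"
        by (intro sum.cong refl) (auto simp: v_def algebra_simps)
      finally show ?thesis using ij by (simp add: sum.distrib)
    qed
    have "(A *\<^sub>v v) \<bullet>c v = (\<Sum>k<n. (A $$ (k, i) * \<alpha> + A $$ (k, j) * \<beta>) * cnj (v $ k))"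
      using cA Av by (auto simp: scalar_prod_def atLeast0LessThan v_def intro!: sum.cong)
    also have "\<dots> = (\<Sum>k<n. (if k = i then (A $$ (k, i) * \<alpha> + A $$ (k, j) * \<beta>) * cnj \<alpha> else 0) +
        (if k = j then (A $$ (k, i) * \<alpha> + A $$ (k, j) * \<beta>) * cnj \<beta> else 0))"
      by (intro sum.cong) (auto simp: v_def algebra_simps)
    also have "\<dots> = (A $$ (i, i) * \<alpha> + A $$ (i, j) * \<beta>) * cnj \<alpha> + (A $$ (j, i) * \<alpha> + A $$ (j, j) * \<beta>) * cnj \<beta>"
      using ij by (simp add: sum.distrib)
    finally have eq: "(A *\<^sub>v v) \<bullet>c v = \<alpha> * cnj \<alpha> * A $$ (i, i) + \<beta> * cnj \<alpha> * A $$ (i, j) + \<alpha> * cnj \<beta> * A $$ (j, i) + \<beta> * cnj \<beta> * A $$ (j, j)"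
      by (simp add: algebra_simps)
    have "0 \<le> (A *\<^sub>v v) \<bullet>c v" using A by (simp add: psd_def v_def)
    then show ?thesis unfolding eq[symmetric] by (simp add: less_eq_complex_def)
  qed
  show ?thesis
    using q[of 1 0] q[of 0 1] q[of 1 1] q[of 1 \<i>] by (simp add: complex_eq_iff)
qed

section \<open>Sum of squares or separating functional\<close>

lemma trace_adj_prod: "(\<Sum>i<n. adj_prod n g f (i, i)) = frob_ip n f g"
proof -
  have "(\<Sum>i<n. adj_prod n g f (i, i)) = (\<Sum>i<n. \<Sum>c<n. f (c, i) * cnj (g (c, i)))"
    by (simp add: adj_prod_def mult.commute)
  then show ?thesis unfolding frob_ip_def by (subst sum.swap)
qed

lemma cmod_adj_prod_le: "cmod (adj_prod n f f q) \<le> frob n f"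
proof -
  obtain i j where q: "q = (i, j)" by (cases q)
  show ?thesis
  proof (cases "i < n \<and> j < n")
    case True
    have "cmod (adj_prod n f f q) \<le> (\<Sum>c<n. cmod (f (c, i)) * cmod (f (c, j)))"
      using True by (simp add: q adj_prod_def norm_mult order_trans[OF norm_sum])
    also have "\<dots> \<le> (\<Sum>c<n. \<Sum>k<n. (cmod (f (c, k)))\<^sup>2)"
    proof (rule sum_mono)
      fix c
      define N where "N = (\<Sum>k<n. (cmod (f (c, k)))\<^sup>2)"
      have N: "0 \<le> N" by (simp add: N_def sum_nonneg)
      have le: "cmod (f (c, k)) \<le> sqrt N" if "k < n" for k
        unfolding N_def by (rule real_le_rsqrt, rule member_le_sum) (use that in auto)
      have "cmod (f (c, i)) * cmod (f (c, j)) \<le> sqrt N * sqrt N"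
        using True N by (intro mult_mono le) auto
      then show "cmod (f (c, i)) * cmod (f (c, j)) \<le> (\<Sum>k<n. (cmod (f (c, k)))\<^sup>2)"
        using N by (simp add: N_def)
    qed
    finally show ?thesis by (simp add: frob_def)
  next
    case False
    then have "adj_prod n f f q = 0" by (auto simp: q adj_prod_def)
    then show ?thesis by (simp add: frob_nonneg)
  qed
qed

lemma frob_act_le:
  assumes A: "A \<in> carrier_mat n n" and c: "\<And>v. v \<in> carrier_vec n \<Longrightarrow> cvec_norm (A *\<^sub>v v) \<le> c * cvec_norm v"
  shows "frob n (act A f) \<le> c\<^sup>2 * frob n f"
proof -
  have col: "(\<Sum>i<n. (cmod (act A f (i, j)))\<^sup>2) \<le> c\<^sup>2 * (\<Sum>i<n. (cmod (f (i, j)))\<^sup>2)" for j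
  proof -
    define v where "v = vec n (\<lambda>i. f (i, j))"
    have "(cvec_norm (A *\<^sub>v v))\<^sup>2 \<le> (c * cvec_norm v)\<^sup>2"
      by (rule power_mono[OF c cvec_norm_nonneg]) (simp add: v_def)
    moreover have "(A *\<^sub>v v) $ i = act A f (i, j)" if "i < n" for i
      using A that by (simp add: v_def act_def scalar_prod_def atLeast0LessThan)
    ultimately show ?thesis
      using A by (simp add: cvec_norm_square power_mult_distrib v_def)
  qed
  have "frob n (act A f) = (\<Sum>j<n. \<Sum>i<n. (cmod (act A f (i, j)))\<^sup>2)"
    unfolding frob_def by (rule sum.swap)
  also have "\<dots> \<le> (\<Sum>j<n. c\<^sup>2 * (\<Sum>i<n. (cmod (f (i, j)))\<^sup>2))" by (intro sum_mono col)
  also have "\<dots> = c\<^sup>2 * (\<Sum>j<n. \<Sum>i<n. (cmod (f (i, j)))\<^sup>2)" by (simp add: sum_distrib_left)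
  also have "(\<Sum>j<n. \<Sum>i<n. (cmod (f (i, j)))\<^sup>2) = frob n f" unfolding frob_def by (rule sum.swap)
  finally show ?thesis .
qed

lemma uniform_contraction_constant:
  fixes Y :: "'d::finite \<Rightarrow> complex mat"
  assumes Y: "Y \<in> mat_tuples n" and "\<And>k. strict_contraction (Y k)"
  obtains c where "0 \<le> c" "c < 1" "\<And>k f. frob n (act (Y k) f) \<le> c\<^sup>2 * frob n f"
proof -
  have cY: "Y k \<in> carrier_mat n n" for k using Y by (simp add: mat_tuples_def)
  have "\<exists>c. 0 \<le> c \<and> c < 1 \<and> (\<forall>v \<in> carrier_vec n. cvec_norm (Y k *\<^sub>v v) \<le> c * cvec_norm v)" for k
    using assms(2)[of k] cY[of k] unfolding strict_contraction_def by auto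
  then obtain c where c: "\<And>k. 0 \<le> c k" "\<And>k. c k < 1"
    "\<And>k v. v \<in> carrier_vec n \<Longrightarrow> cvec_norm (Y k *\<^sub>v v) \<le> c k * cvec_norm v" by metis
  define M where "M = Max (range c)"
  have M: "c k \<le> M" for k by (simp add: M_def)
  have "frob n (act (Y k) f) \<le> M\<^sup>2 * frob n f" for k f
  proof -
    have "frob n (act (Y k) f) \<le> (c k)\<^sup>2 * frob n f" by (rule frob_act_le[OF cY c(3)])
    also have "\<dots> \<le> M\<^sup>2 * frob n f" by (intro mult_right_mono power_mono M c frob_nonneg)
    finally show ?thesis .
  qed
  moreover have "M < 1" using c(2) by (simp add: M_def)
  moreover have "0 \<le> M" using c(1) M order_trans by blast
  ultimately show ?thesis using that by blast
qed

text \<open>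
  The two kinds of generators: \<open>None\<close> stands for \<open>s\<^sup>* s\<close>, and \<open>Some k\<close> for \<open>r\<^sup>* (1 - X\<^sub>k\<^sup>* X\<^sub>k) r\<close>.
\<close>

primrec quad :: "nat \<Rightarrow> ('d \<Rightarrow> complex mat) \<Rightarrow> 'd option \<Rightarrow> (nat \<times> nat \<Rightarrow> complex) \<Rightarrow> (nat \<times> nat \<Rightarrow> complex) \<Rightarrow>
    nat \<times> nat \<Rightarrow> complex" where
  "quad n Y None = adj_prod n"
| "quad n Y (Some k) = (\<lambda>f g. adj_prod n f g - adj_prod n (act (Y k) f) (act (Y k) g))"

lemma quad_linear:
  "quad n Y \<kappa> (f + f') g p = quad n Y \<kappa> f g p + quad n Y \<kappa> f' g p"
  "quad n Y \<kappa> f (g + g') p = quad n Y \<kappa> f g p + quad n Y \<kappa> f g' p"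
  "quad n Y \<kappa> (cscale a f) g p = cnj a * quad n Y \<kappa> f g p"
  "quad n Y \<kappa> f (cscale a g) p = a * quad n Y \<kappa> f g p"
  "quad n Y \<kappa> 0 g p = 0" "quad n Y \<kappa> f 0 p = 0"
proof -
  show "quad n Y \<kappa> (f + f') g p = quad n Y \<kappa> f g p + quad n Y \<kappa> f' g p"
    by (cases \<kappa>; simp only: quad.simps act_add adj_prod_add_left; simp)
  show "quad n Y \<kappa> f (g + g') p = quad n Y \<kappa> f g p + quad n Y \<kappa> f g' p"
    by (cases \<kappa>; simp only: quad.simps act_add adj_prod_add_right; simp)
  show "quad n Y \<kappa> (cscale a f) g p = cnj a * quad n Y \<kappa> f g p"
    by (cases \<kappa>; simp only: quad.simps act_cscale adj_prod_cscale_left; simp add: algebra_simps)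
  show "quad n Y \<kappa> f (cscale a g) p = a * quad n Y \<kappa> f g p"
    by (cases \<kappa>; simp only: quad.simps act_cscale adj_prod_cscale_right; simp add: algebra_simps)
  show "quad n Y \<kappa> 0 g p = 0" "quad n Y \<kappa> f 0 p = 0"
    by (cases \<kappa>; simp only: quad.simps act_zero adj_prod_zero; simp)+
qed

lemma quad_sum:
  "quad n Y \<kappa> (\<Sum>i\<in>A. cscale (x i) (e i)) (\<Sum>j\<in>A'. cscale (y j) (e' j)) p =
    (\<Sum>i\<in>A. \<Sum>j\<in>A'. cnj (x i) * y j * quad n Y \<kappa> (e i) (e' j) p)"
proof -
  have r: "quad n Y \<kappa> f (\<Sum>j\<in>A'. cscale (y j) (e' j)) p = (\<Sum>j\<in>A'. y j * quad n Y \<kappa> f (e' j) p)" for f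
    by (induction A' rule: infinite_finite_induct)
      (simp_all only: sum.infinite sum.empty sum.insert quad_linear not_False_eq_True)
  have l: "quad n Y \<kappa> (\<Sum>i\<in>A. cscale (x i) (e i)) g p = (\<Sum>i\<in>A. cnj (x i) * quad n Y \<kappa> (e i) g p)" for g
    by (induction A rule: infinite_finite_induct)
      (simp_all only: sum.infinite sum.empty sum.insert quad_linear not_False_eq_True)
  show ?thesis unfolding l unfolding r by (simp only: sum_distrib_left mult.assoc)
qed

lemma frob_orthonormal_basis:
  assumes "set us \<subseteq> square_supp n"
  shows "\<exists>e p. (\<forall>i<p. e i \<in> cfun.span (set us)) \<and>
    (\<forall>x. frob n (\<Sum>i<p. cscale (x i) (e i)) = (\<Sum>i<p. (cmod (x i))\<^sup>2)) \<and>
    (\<forall>u \<in> cfun.span (set us). \<exists>x. u = (\<Sum>i<(p::nat). cscale (x i) (e i)))"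
proof -
  interpret F: herm_space cscale "frob_ip n" by (rule herm_space_frob_ip)
  have psd: "0 \<le> Re (frob_ip n f f)" for f by (simp add: frob_ip_diag frob_nonneg)
  have sub: "cfun.span (set us) \<subseteq> square_supp n"
    by (rule cfun.span_minimal[OF assms square_supp_subspace])
  obtain e p where e: "F.orthonormal e p" "\<And>i. i < p \<Longrightarrow> e i \<in> cfun.span (set us)"
    "\<And>u x. u \<in> cfun.span (set us) \<Longrightarrow> x \<in> square_supp n \<Longrightarrow> frob_ip n (u - F.proj e p u) x = 0"
    using F.gram_schmidt[OF square_supp_subspace psd assms] by metis
  have "frob n (\<Sum>i<p. cscale (x i) (e i)) = (\<Sum>i<p. (cmod (x i))\<^sup>2)" for x
    using F.orthonormal_comb[OF e(1), of x] by (simp only: frob_ip_diag of_real_eq_iff)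
  moreover have "u = F.proj e p u" if u: "u \<in> cfun.span (set us)" for u
  proof -
    have "u - F.proj e p u \<in> square_supp n"
      using u sub e(2) by (intro cfun.subspace_diff square_supp_subspace F.proj_in_subspace) auto
    then have "frob_ip n (u - F.proj e p u) (u - F.proj e p u) = 0" by (rule e(3)[OF u])
    then have "frob n (u - F.proj e p u) = 0" by (simp only: frob_ip_diag of_real_eq_0_iff)
    then have "u - F.proj e p u = 0"
      using \<open>u - F.proj e p u \<in> square_supp n\<close> frob_zero_iff by blast
    then show ?thesis by simp
  qed
  then have "\<exists>x. u = (\<Sum>i<p. cscale (x i) (e i))" if "u \<in> cfun.span (set us)" for u
    using that unfolding F.proj_def by (intro exI)
  ultimately show ?thesis using e(2) by (intro exI[of _ e] exI[of _ p] conjI allI ballI impI)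
qed

text \<open>
  Coordinates with respect to Frobenius-orthonormal bases turn both kinds of generators into a cone of
  squares. The trace of a generator is at least \<open>1 - c\<^sup>2\<close> times the squared norm of its coordinates,
  where \<open>c < 1\<close> bounds the norms of all \<open>Y k\<close>; this is the bound needed for separation.
\<close>

theorem hereditary_alternative:
  fixes Y :: "'d::finite \<Rightarrow> complex mat" and h :: "nat \<times> nat \<Rightarrow> complex"
  assumes Y: "Y \<in> mat_tuples n" "\<And>k. strict_contraction (Y k)"
    and us: "\<And>\<kappa>. set (us \<kappa>) \<subseteq> square_supp n"
    and no_functional: "\<And>w. (\<And>\<kappa> f. f \<in> cfun.span (set (us \<kappa>)) \<Longrightarrow>
        0 \<le> Re (\<Sum>p\<in>{..<n} \<times> {..<n}. w p * quad n Y \<kappa> f f p)) \<Longrightarrow>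
      0 \<le> Re (\<Sum>p\<in>{..<n} \<times> {..<n}. w p * h p)"
  shows "\<exists>K f. (\<forall>k<K. \<forall>\<kappa>. f k \<kappa> \<in> cfun.span (set (us \<kappa>))) \<and>
    (\<forall>i<n. \<forall>j<n. h (i, j) = (\<Sum>k<K. \<Sum>\<kappa>\<in>UNIV. quad n Y \<kappa> (f (k :: nat) \<kappa>) (f k \<kappa>) (i, j)))"
proof -
  define I where "I = {..<n} \<times> {..<n}"
  obtain c where c: "0 \<le> c" "c < 1" "\<And>k f. frob n (act (Y k) f) \<le> c\<^sup>2 * frob n f"
    using uniform_contraction_constant[OF Y] by blast
  define Q where "Q \<kappa> e p \<longleftrightarrow> (\<forall>i<p. e i \<in> cfun.span (set (us \<kappa>))) \<and>
      (\<forall>x. frob n (\<Sum>i<p. cscale (x i) (e i)) = (\<Sum>i<p. (cmod (x i))\<^sup>2)) \<and>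
      (\<forall>u \<in> cfun.span (set (us \<kappa>)). \<exists>x. u = (\<Sum>i<p. cscale (x i) (e i)))" for \<kappa> e and p :: nat
  have "\<exists>e p. Q \<kappa> e p" for \<kappa>
    unfolding Q_def by (rule frob_orthonormal_basis[OF us])
  then obtain e p where Q: "\<And>\<kappa>. Q \<kappa> (e \<kappa>) (p \<kappa>)" by metis
  have e: "\<And>\<kappa> i. i < p \<kappa> \<Longrightarrow> e \<kappa> i \<in> cfun.span (set (us \<kappa>))"
    "\<And>\<kappa> x. frob n (\<Sum>i<p \<kappa>. cscale (x i) (e \<kappa> i)) = (\<Sum>i<p \<kappa>. (cmod (x i))\<^sup>2)"
    "\<And>\<kappa> u. u \<in> cfun.span (set (us \<kappa>)) \<Longrightarrow> \<exists>x. u = (\<Sum>i<p \<kappa>. cscale (x i) (e \<kappa> i))"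
    using Q unfolding Q_def by blast+
  define A where "A = Sigma (UNIV :: 'd option set) (\<lambda>\<kappa>. {..<p \<kappa>})"
  have A: "finite A" by (simp add: A_def)
  define \<Psi> where "\<Psi> a b q = (if fst a = fst b then quad n Y (fst a) (e (fst a) (snd a)) (e (fst b) (snd b)) q else 0)"
    for a b :: "'d option \<times> nat" and q
  define comb where "comb x \<kappa> = (\<Sum>i<p \<kappa>. cscale (x (\<kappa>, i)) (e \<kappa> i))" for x :: "'d option \<times> nat \<Rightarrow> complex" and \<kappa>
  have comb_span: "comb x \<kappa> \<in> cfun.span (set (us \<kappa>))" for x \<kappa>
    unfolding comb_def by (intro cfun.span_sum cfun.span_scale e(1)) simp
  have form: "(\<Sum>a\<in>A. \<Sum>b\<in>A. cnj (x a) * x b * \<Psi> a b q) = (\<Sum>\<kappa>\<in>UNIV. quad n Y \<kappa> (comb x \<kappa>) (comb x \<kappa>) q)"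
    for x q
  proof -
    have inner: "(\<Sum>b\<in>A. cnj (x (\<kappa>, i)) * x b * \<Psi> (\<kappa>, i) b q) =
        (\<Sum>j<p \<kappa>. cnj (x (\<kappa>, i)) * x (\<kappa>, j) * quad n Y \<kappa> (e \<kappa> i) (e \<kappa> j) q)" for \<kappa> i
    proof -
      have "(\<Sum>b\<in>A. cnj (x (\<kappa>, i)) * x b * \<Psi> (\<kappa>, i) b q) =
          (\<Sum>\<kappa>'\<in>UNIV. \<Sum>j<p \<kappa>'. cnj (x (\<kappa>, i)) * x (\<kappa>', j) * \<Psi> (\<kappa>, i) (\<kappa>', j) q)"
        unfolding A_def by (subst sum.Sigma) (auto simp: case_prod_unfold)
      also have "\<dots> = (\<Sum>\<kappa>'\<in>UNIV. if \<kappa>' = \<kappa> then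
          (\<Sum>j<p \<kappa>. cnj (x (\<kappa>, i)) * x (\<kappa>, j) * quad n Y \<kappa> (e \<kappa> i) (e \<kappa> j) q) else 0)"
        by (intro sum.cong refl) (auto simp: \<Psi>_def)
      finally show ?thesis by simp
    qed
    have "(\<Sum>a\<in>A. \<Sum>b\<in>A. cnj (x a) * x b * \<Psi> a b q) =
        (\<Sum>\<kappa>\<in>UNIV. \<Sum>i<p \<kappa>. \<Sum>b\<in>A. cnj (x (\<kappa>, i)) * x b * \<Psi> (\<kappa>, i) b q)"
      by (subst (1) A_def, subst sum.Sigma) (auto simp: case_prod_unfold)
    then show ?thesis unfolding inner comb_def quad_sum .
  qed
  have trace: "(1 - c\<^sup>2) * frob n f \<le> Re (\<Sum>i<n. quad n Y \<kappa> f f (i, i))" for \<kappa> f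
  proof (cases \<kappa>)
    case None
    have "0 \<le> c\<^sup>2 * frob n f" using frob_nonneg[of n f] by simp
    then show ?thesis using None by (simp add: trace_adj_prod frob_ip_diag algebra_simps del: Re_sum)
  next
    case (Some k)
    have "(\<Sum>i<n. quad n Y \<kappa> f f (i, i)) = frob_ip n f f - frob_ip n (act (Y k) f) (act (Y k) f)"
      using Some by (simp add: sum_subtractf trace_adj_prod)
    then have "Re (\<Sum>i<n. quad n Y \<kappa> f f (i, i)) = frob n f - frob n (act (Y k) f)"
      by (simp add: frob_ip_diag del: Re_sum)
    then show ?thesis using c(3)[of k f] by (simp add: algebra_simps del: Re_sum)
  qed
  define \<tau> where "\<tau> q = (if fst q = snd q then 1 else 0 :: complex)" for q :: "nat \<times> nat"
  have \<tau>_sum: "(\<Sum>q\<in>I. \<tau> q * F q) = (\<Sum>i<n. F (i, i))" for F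
  proof -
    have "(\<Sum>q\<in>I. \<tau> q * F q) = (\<Sum>i<n. \<Sum>j<n. \<tau> (i, j) * F (i, j))"
      unfolding I_def sum.cartesian_product by (simp add: case_prod_unfold)
    also have "\<dots> = (\<Sum>i<n. \<Sum>j<n. if j = i then F (i, j) else 0)"
      by (intro sum.cong refl) (auto simp: \<tau>_def)
    finally show ?thesis by simp
  qed
  have "\<exists>K d. \<forall>q\<in>I. h q = (\<Sum>k<K. \<Sum>a\<in>A. \<Sum>b\<in>A. cnj (d k a) * d (k :: nat) b * \<Psi> a b q)"
  proof (rule cone_of_squares_separation[OF A, where \<eta> = "1 - c\<^sup>2" and \<tau> = \<tau>])
    show "finite I" by (simp add: I_def)
    show "0 < 1 - c\<^sup>2" using c(1,2) by (simp add: power_less_one_iff)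
    fix x
    have "(\<Sum>q\<in>I. \<tau> q * (\<Sum>a\<in>A. \<Sum>b\<in>A. cnj (x a) * x b * \<Psi> a b q)) =
        (\<Sum>\<kappa>\<in>UNIV. \<Sum>i<n. quad n Y \<kappa> (comb x \<kappa>) (comb x \<kappa>) (i, i))"
      unfolding \<tau>_sum form by (rule sum.swap)
    moreover have "(\<Sum>\<kappa>\<in>UNIV. (1 - c\<^sup>2) * frob n (comb x \<kappa>)) \<le>
        (\<Sum>\<kappa>\<in>UNIV. Re (\<Sum>i<n. quad n Y \<kappa> (comb x \<kappa>) (comb x \<kappa>) (i, i)))"
      by (intro sum_mono trace)
    moreover have "(\<Sum>\<kappa>\<in>UNIV. (1 - c\<^sup>2) * frob n (comb x \<kappa>)) = (1 - c\<^sup>2) * (\<Sum>a\<in>A. (cmod (x a))\<^sup>2)"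
    proof -
      have "(\<Sum>a\<in>A. (cmod (x a))\<^sup>2) = (\<Sum>\<kappa>\<in>UNIV. \<Sum>i<p \<kappa>. (cmod (x (\<kappa>, i)))\<^sup>2)"
        unfolding A_def by (subst sum.Sigma) (auto simp: case_prod_unfold)
      then show ?thesis by (simp only: comb_def e(2) sum_distrib_left)
    qed
    ultimately show "(1 - c\<^sup>2) * (\<Sum>a\<in>A. (cmod (x a))\<^sup>2) \<le>
        Re (\<Sum>q\<in>I. \<tau> q * (\<Sum>a\<in>A. \<Sum>b\<in>A. cnj (x a) * x b * \<Psi> a b q))"
      by simp
  next
    fix w assume w: "\<And>x. 0 \<le> Re (\<Sum>q\<in>I. w q * (\<Sum>a\<in>A. \<Sum>b\<in>A. cnj (x a) * x b * \<Psi> a b q))"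
    show "0 \<le> Re (\<Sum>q\<in>I. w q * h q)"
      unfolding I_def
    proof (rule no_functional)
      fix \<kappa> f assume f: "f \<in> cfun.span (set (us \<kappa>))"
      obtain y where y: "f = (\<Sum>i<p \<kappa>. cscale (y i) (e \<kappa> i))" using e(3)[OF f] by blast
      define x where "x a = (if fst a = \<kappa> then y (snd a) else 0)" for a
      have "comb x \<kappa>' = (if \<kappa>' = \<kappa> then f else 0)" for \<kappa>'
      proof (cases "\<kappa>' = \<kappa>")
        case False
        then have "comb x \<kappa>' = (\<Sum>i<p \<kappa>'. 0)"
          unfolding comb_def by (intro sum.cong refl) (simp add: x_def cfun.scale_zero_left)
        then show ?thesis using False by (simp only: sum.neutral_const if_False)
      qed (simp add: comb_def x_def y)
      then have "(\<Sum>a\<in>A. \<Sum>b\<in>A. cnj (x a) * x b * \<Psi> a b q) =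
          (\<Sum>\<kappa>'\<in>UNIV. if \<kappa>' = \<kappa> then quad n Y \<kappa> f f q else 0)" for q
        unfolding form by (intro sum.cong refl) (simp only: quad_linear split: if_split, simp add: quad_linear)
      then show "0 \<le> Re (\<Sum>q\<in>{..<n} \<times> {..<n}. w q * quad n Y \<kappa> f f q)"
        using w[of x] by (simp add: I_def)
    qed
  qed
  then obtain K d where d: "\<And>q. q \<in> I \<Longrightarrow> h q = (\<Sum>k<K. \<Sum>a\<in>A. \<Sum>b\<in>A. cnj (d k a) * d (k :: nat) b * \<Psi> a b q)"
    by blast
  show ?thesis
  proof (intro exI[of _ K] exI[of _ "\<lambda>k. comb (d k)"] conjI allI impI)
    show "comb (d k) \<kappa> \<in> cfun.span (set (us \<kappa>))" for k \<kappa> by (rule comb_span)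
    fix i j assume "i < n" "j < n"
    then show "h (i, j) = (\<Sum>k<K. \<Sum>\<kappa>\<in>UNIV. quad n Y \<kappa> (comb (d k) \<kappa>) (comb (d k) \<kappa>) (i, j))"
      using d[of "(i, j)"] by (simp add: I_def form)
  qed
qed

lemma adjoint_inner_product:
  fixes A :: "complex mat"
  assumes A: "A \<in> carrier_mat l l" and u: "u \<in> carrier_vec l" and x: "x \<in> carrier_vec l"
  shows "(mat_adjoint A *\<^sub>v u) \<bullet>c x = u \<bullet>c (A *\<^sub>v x)"
proof -
  have "(mat_adjoint A *\<^sub>v u) \<bullet>c x = (\<Sum>i<l. (\<Sum>k<l. cnj (A $$ (k, i)) * u $ k) * cnj (x $ i))"
    using A u x by (auto simp: scalar_prod_def atLeast0LessThan intro!: sum.cong)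
  also have "\<dots> = (\<Sum>i<l. \<Sum>k<l. u $ k * cnj (A $$ (k, i) * x $ i))"
    unfolding sum_distrib_right by (intro sum.cong refl) simp
  also have "\<dots> = (\<Sum>k<l. \<Sum>i<l. u $ k * cnj (A $$ (k, i) * x $ i))" by (rule sum.swap)
  also have "\<dots> = (\<Sum>k<l. u $ k * cnj (\<Sum>i<l. A $$ (k, i) * x $ i))"
    by (simp add: sum_distrib_left cnj_sum)
  also have "\<dots> = u \<bullet>c (A *\<^sub>v x)"
    using A u x by (auto simp: scalar_prod_def atLeast0LessThan intro!: sum.cong)
  finally show ?thesis .
qed

lemma quadratic_form_entries:
  fixes A :: "complex mat"
  assumes A: "A \<in> carrier_mat l l" and x: "x \<in> carrier_vec l"
  shows "(A *\<^sub>v x) \<bullet>c x = (\<Sum>i<l. \<Sum>j<l. entries A (i, j) * (x $ j * cnj (x $ i)))"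
proof -
  have "(A *\<^sub>v x) \<bullet>c x = (\<Sum>i<l. (\<Sum>j<l. A $$ (i, j) * x $ j) * cnj (x $ i))"
    using A x by (auto simp: scalar_prod_def atLeast0LessThan intro!: sum.cong)
  also have "\<dots> = (\<Sum>i<l. \<Sum>j<l. entries A (i, j) * (x $ j * cnj (x $ i)))"
    unfolding sum_distrib_right using A by (intro sum.cong refl) (auto simp: entries_def)
  finally show ?thesis .
qed

lemma quadratic_form_hereditary:
  fixes A B :: "nat \<Rightarrow> complex mat"
  assumes S: "S \<in> carrier_mat l l" and x: "x \<in> carrier_vec l"
    and A: "\<And>i. i < m \<Longrightarrow> A i \<in> carrier_mat l l" and B: "\<And>i. i < m \<Longrightarrow> B i \<in> carrier_mat l l"
    and ent: "entries S = (\<Sum>i<m. entries (mat_adjoint (A i) * B i))"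
  shows "(S *\<^sub>v x) \<bullet>c x = (\<Sum>i<m. (B i *\<^sub>v x) \<bullet>c (A i *\<^sub>v x))"
proof -
  let ?t = "\<lambda>i p j. entries (mat_adjoint (A i) * B i) (p, j) * (x $ j * cnj (x $ p))"
  have "(S *\<^sub>v x) \<bullet>c x = (\<Sum>p<l. \<Sum>j<l. \<Sum>i<m. ?t i p j)"
    unfolding quadratic_form_entries[OF S x] ent sum_fun_apply sum_distrib_right ..
  also have "\<dots> = (\<Sum>p<l. \<Sum>i<m. \<Sum>j<l. ?t i p j)" by (intro sum.cong refl sum.swap)
  also have "\<dots> = (\<Sum>i<m. \<Sum>p<l. \<Sum>j<l. ?t i p j)" by (rule sum.swap)
  also have "\<dots> = (\<Sum>i<m. (B i *\<^sub>v x) \<bullet>c (A i *\<^sub>v x))"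
  proof (intro sum.cong refl)
    fix i assume "i \<in> {..<m}"
    then have cA: "A i \<in> carrier_mat l l" and cB: "B i \<in> carrier_mat l l" using A B by auto
    have "(\<Sum>p<l. \<Sum>j<l. ?t i p j) = ((mat_adjoint (A i) * B i) *\<^sub>v x) \<bullet>c x"
      by (rule quadratic_form_entries[symmetric, OF mult_carrier_mat[OF mat_adjoint_carrier[OF cA] cB] x])
    also have "(mat_adjoint (A i) * B i) *\<^sub>v x = mat_adjoint (A i) *\<^sub>v (B i *\<^sub>v x)"
      by (rule assoc_mult_mat_vec[OF mat_adjoint_carrier[OF cA] cB x])
    also have "\<dots> \<bullet>c x = (B i *\<^sub>v x) \<bullet>c (A i *\<^sub>v x)"
      by (rule adjoint_inner_product[OF cA mult_mat_vec_carrier[OF cB x] x])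
    finally show "(\<Sum>p<l. \<Sum>j<l. ?t i p j) = (B i *\<^sub>v x) \<bullet>c (A i *\<^sub>v x)" .
  qed
  finally show ?thesis .
qed

text \<open>
  The functional yields the form \<open>F f g = L (g\<^sup>* f)\<close>, symmetrized so that it is Hermitian. Adding
  \<open>\<epsilon>\<close> times the Frobenius inner product makes it positive definite and the multiplications strictly
  contractive, and leaves the value that corresponds to \<open>\<Sum> a\<^sub>i\<^sup>* b\<^sub>i\<close> negative. The symmetrization does not
  change that value since the sum is Hermitian at \<open>Y\<close>.
\<close>

theorem negative_functional_point:
  fixes Y :: "'d::finite \<Rightarrow> complex mat" and a b :: "nat \<Rightarrow> 'd nc_expr"
    and us us' :: "(nat \<times> nat \<Rightarrow> complex) list" and w :: "nat \<times> nat \<Rightarrow> complex" and m :: nat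
  defines "es \<equiv> a ` {..<m} \<union> b ` {..<m}"
  assumes n: "0 < n" and Y: "Y \<in> mat_tuples n" "\<And>k. strict_contraction (Y k)"
    and A: "\<And>i. i < m \<Longrightarrow> eval_expr n Y (a i) = Some (A i)"
    and B: "\<And>i. i < m \<Longrightarrow> eval_expr n Y (b i) = Some (B i)"
    and us': "set us' \<subseteq> square_supp n" and us: "cfun.span (set us) \<subseteq> cfun.span (set us')"
    and args: "\<And>e g G. e \<in> es \<Longrightarrow> g \<in> set (var_args e (Const 1)) \<Longrightarrow> eval_expr n Y g = Some G \<Longrightarrow>
      entries G \<in> cfun.span (set us)"
    and vals: "\<And>e E. e \<in> es \<Longrightarrow> eval_expr n Y e = Some E \<Longrightarrow> entries E \<in> cfun.span (set us')"
    and shift: "\<And>k f. f \<in> cfun.span (set us) \<Longrightarrow> act (Y k) f \<in> cfun.span (set us')"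
    and w: "\<And>f. f \<in> cfun.span (set us') \<Longrightarrow> 0 \<le> Re (\<Sum>p\<in>{..<n} \<times> {..<n}. w p * quad n Y None f f p)"
      "\<And>k f. f \<in> cfun.span (set us) \<Longrightarrow> 0 \<le> Re (\<Sum>p\<in>{..<n} \<times> {..<n}. w p * quad n Y (Some k) f f p)"
    and herm: "\<And>i j. i < n \<Longrightarrow> j < n \<Longrightarrow> (\<Sum>k<m. adj_prod n (entries (A k)) (entries (B k)) (j, i)) =
      cnj (\<Sum>k<m. adj_prod n (entries (A k)) (entries (B k)) (i, j))"
    and neg: "Re (\<Sum>p\<in>{..<n} \<times> {..<n}. w p * (\<Sum>k<m. adj_prod n (entries (A k)) (entries (B k)) p)) < 0"
  shows "\<exists>l T x. 0 < l \<and> T \<in> mat_tuples l \<and> (\<forall>k. strict_contraction (T k)) \<and> x \<in> carrier_vec l \<and>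
    (\<forall>e\<in>es. eval_expr l T e \<noteq> None) \<and>
    Re (\<Sum>i<m. (the (eval_expr l T (b i)) *\<^sub>v x) \<bullet>c (the (eval_expr l T (a i)) *\<^sub>v x)) < 0"
proof -
  define I where "I = {..<n} \<times> {..<n}"
  define L where "L F = (\<Sum>p\<in>I. w p * F p)" for F :: "nat \<times> nat \<Rightarrow> complex"
  have L_lin: "L (F + G) = L F + L G" "L (cscale c F) = c * L F" "L (F - G) = L F - L G" for F G c
    by (simp_all add: L_def algebra_simps sum.distrib sum_distrib_left sum_subtractf)
  have L_sum: "L (\<Sum>k<M. F k) = (\<Sum>k<M. L (F k))" for F and M :: nat
    by (induction M) (simp_all only: sum.lessThan_Suc L_lin, simp add: L_def)
  obtain c where c: "0 \<le> c" "c < 1" "\<And>k f. frob n (act (Y k) f) \<le> c\<^sup>2 * frob n f"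
    using uniform_contraction_constant[OF Y] by blast
  define X where "X = (\<Sum>i<m. frob_ip n (entries (B i)) (entries (A i)))"
  define h where "h = (\<Sum>k<m. adj_prod n (entries (A k)) (entries (B k)))"
  have Lh: "Re (L h) < 0"
    using neg by (simp add: L_def h_def I_def sum_fun_apply del: Re_sum)
  \<comment> \<open>Half of the negative value is spent on making the form definite.\<close>
  define \<epsilon> where "\<epsilon> = - Re (L h) / (2 * (\<bar>Re X\<bar> + 1))"
  have \<epsilon>: "\<epsilon> > 0" unfolding \<epsilon>_def by (rule divide_pos_pos) (use Lh in auto)
  have \<epsilon>X: "\<epsilon> * Re X \<le> - Re (L h) / 2"
  proof -
    have "\<epsilon> * Re X \<le> \<epsilon> * (\<bar>Re X\<bar> + 1)" using \<epsilon> by (intro mult_left_mono) auto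
    also have "\<dots> = - Re (L h) / 2" by (simp add: \<epsilon>_def field_simps)
    finally show ?thesis .
  qed
  define F where "F f g = (L (adj_prod n g f) + cnj (L (adj_prod n f g))) / 2 + complex_of_real \<epsilon> * frob_ip n f g" for f g
  interpret fr: herm_space cscale "frob_ip n" by (rule herm_space_frob_ip)
  have F: "herm_space cscale F"
  proof
    fix f g k :: "nat \<times> nat \<Rightarrow> complex" and t
    show "F (f + g) k = F f k + F g k"
      by (simp only: F_def adj_prod_add_left adj_prod_add_right L_lin fr.add_left complex_cnj_add) (simp add: field_simps)
    show "F (cscale t f) g = t * F f g"
      by (simp only: F_def adj_prod_cscale_left adj_prod_cscale_right L_lin fr.scale_left complex_cnj_mult complex_cnj_cnj)
        (simp add: field_simps)
    show "F g f = cnj (F f g)"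
      by (simp add: F_def fr.sym[of g f] add.commute)
  qed
  have F_diag: "Re (F f f) = Re (L (adj_prod n f f)) + \<epsilon> * frob n f" for f
    by (simp add: F_def frob_ip_diag)
  define C where "C = (\<Sum>p\<in>I. cmod (w p)) + \<epsilon>"
  have C: "\<epsilon> \<le> C" by (simp add: C_def sum_nonneg)
  have F_le: "Re (F f f) \<le> C * frob n f" for f
  proof -
    have "Re (L (adj_prod n f f)) \<le> cmod (L (adj_prod n f f))" by (rule complex_Re_le_cmod)
    also have "\<dots> \<le> (\<Sum>p\<in>I. cmod (w p) * frob n f)"
      unfolding L_def
      by (rule order_trans[OF norm_sum]) (auto simp: norm_mult intro!: sum_mono mult_left_mono cmod_adj_prod_le)
    also have "\<dots> = (\<Sum>p\<in>I. cmod (w p)) * frob n f" by (simp only: sum_distrib_right)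
    finally show ?thesis by (simp add: F_diag C_def algebra_simps)
  qed
  have pos: "\<epsilon> * frob n f \<le> Re (F f f)" if "f \<in> cfun.span (set us')" for f
  proof -
    have "0 \<le> Re (L (adj_prod n f f))" using w(1)[OF that] by (simp only: L_def I_def quad.simps)
    then show ?thesis by (simp add: F_diag)
  qed
  \<comment> \<open>The gap \<open>\<epsilon> (1 - c\<^sup>2)\<close> is measured in the Frobenius norm; dividing by \<open>C\<close> measures it in the form itself.\<close>
  define \<delta> where "\<delta> = \<epsilon> * (1 - c\<^sup>2) / C"
  have c2: "c\<^sup>2 < 1" using c(1,2) by (simp add: power_less_one_iff)
  have \<delta>: "0 < \<delta>" "\<delta> \<le> 1"
  proof -
    show "0 < \<delta>" using \<epsilon> C c2 by (simp add: \<delta>_def)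
    have "\<epsilon> * (1 - c\<^sup>2) \<le> \<epsilon> * 1" using \<epsilon> by (intro mult_left_mono) auto
    then have "\<epsilon> * (1 - c\<^sup>2) \<le> C" using C by linarith
    then show "\<delta> \<le> 1" using \<epsilon> C by (simp add: \<delta>_def)
  qed
  have contr: "Re (F (act (Y k) f) (act (Y k) f)) \<le> (sqrt (1 - \<delta>))\<^sup>2 * Re (F f f)"
    if f: "f \<in> cfun.span (set us)" for k f
  proof -
    have "0 \<le> Re (L (quad n Y (Some k) f f))" using w(2)[OF f, of k] by (simp only: L_def I_def)
    then have "Re (L (adj_prod n (act (Y k) f) (act (Y k) f))) \<le> Re (L (adj_prod n f f))"
      by (simp only: quad.simps L_lin) simp
    moreover have "\<epsilon> * frob n (act (Y k) f) \<le> \<epsilon> * (c\<^sup>2 * frob n f)"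
      using c(3)[of k f] \<epsilon> by (intro mult_left_mono) auto
    ultimately have "Re (F (act (Y k) f) (act (Y k) f)) \<le> Re (F f f) - \<epsilon> * (1 - c\<^sup>2) * frob n f"
      by (simp add: F_diag algebra_simps)
    also have "\<delta> * Re (F f f) \<le> \<delta> * (C * frob n f)" using \<delta> by (intro mult_left_mono F_le) auto
    then have "\<delta> * Re (F f f) \<le> \<epsilon> * (1 - c\<^sup>2) * frob n f" using \<epsilon> C by (simp add: \<delta>_def)
    then have "Re (F f f) - \<epsilon> * (1 - c\<^sup>2) * frob n f \<le> (1 - \<delta>) * Re (F f f)" by (simp add: algebra_simps)
    also have "1 - \<delta> = (sqrt (1 - \<delta>))\<^sup>2" using \<delta> by simp
    finally show ?thesis .
  qed
  have fin: "finite es" by (simp add: es_def)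
  have defd: "eval_expr n Y e \<noteq> None" if "e \<in> es" for e using that A B by (auto simp: es_def)
  have "\<exists>l T x. 0 < l \<and> T \<in> mat_tuples l \<and> (\<forall>k. strict_contraction (T k)) \<and> x \<in> carrier_vec l \<and>
    (\<forall>e\<in>es. eval_expr l T e \<noteq> None) \<and>
    (\<forall>e\<in>es. \<forall>f\<in>es. \<forall>E F' E' F''. eval_expr n Y e = Some E \<longrightarrow> eval_expr n Y f = Some F' \<longrightarrow>
      eval_expr l T e = Some E' \<longrightarrow> eval_expr l T f = Some F'' \<longrightarrow>
      (E' *\<^sub>v x) \<bullet>c (F'' *\<^sub>v x) = F (entries E) (entries F'))"
    by (rule contractive_model[where us = us and us' = us' and \<epsilon> = \<epsilon> and c = "sqrt (1 - \<delta>)"])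
      (use n Y(1) fin defd F us' us args vals shift \<epsilon> pos contr \<delta> in auto)
  then obtain l T x where T: "0 < l" "T \<in> mat_tuples l" "\<forall>k. strict_contraction (T k)" "x \<in> carrier_vec l"
    "\<forall>e\<in>es. eval_expr l T e \<noteq> None"
    and ip_all: "\<forall>e\<in>es. \<forall>f\<in>es. \<forall>E F' E' F''. eval_expr n Y e = Some E \<longrightarrow> eval_expr n Y f = Some F' \<longrightarrow>
      eval_expr l T e = Some E' \<longrightarrow> eval_expr l T f = Some F'' \<longrightarrow>
      (E' *\<^sub>v x) \<bullet>c (F'' *\<^sub>v x) = F (entries E) (entries F')"
    by (elim exE conjE) (rule that)
  have ip: "(E' *\<^sub>v x) \<bullet>c (F'' *\<^sub>v x) = F (entries E) (entries F')"
    if "e \<in> es" "f \<in> es" "eval_expr n Y e = Some E" "eval_expr n Y f = Some F'"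
      "eval_expr l T e = Some E'" "eval_expr l T f = Some F''" for e f E F' E' F''
    using ip_all that by blast
  have "(the (eval_expr l T (b i)) *\<^sub>v x) \<bullet>c (the (eval_expr l T (a i)) *\<^sub>v x) = F (entries (B i)) (entries (A i))"
    if i: "i < m" for i
  proof -
    have ab: "a i \<in> es" "b i \<in> es" using i by (auto simp: es_def)
    then obtain A' B' where "eval_expr l T (a i) = Some A'" "eval_expr l T (b i) = Some B'" using T(5) by blast
    then show ?thesis using ip[OF ab(2,1) B[OF i] A[OF i]] by simp
  qed
  then have "(\<Sum>i<m. (the (eval_expr l T (b i)) *\<^sub>v x) \<bullet>c (the (eval_expr l T (a i)) *\<^sub>v x)) =
      (\<Sum>i<m. F (entries (B i)) (entries (A i)))" by simp
  also have "\<dots> = (L h + cnj (L (\<Sum>k<m. adj_prod n (entries (B k)) (entries (A k))))) / 2 + complex_of_real \<epsilon> * X"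
    unfolding h_def L_sum X_def
    by (simp add: F_def sum.distrib sum_distrib_left sum_divide_distrib cnj_sum add_divide_distrib)
  also have "L (\<Sum>k<m. adj_prod n (entries (B k)) (entries (A k))) = L h"
  proof -
    have "(\<Sum>k<m. adj_prod n (entries (B k)) (entries (A k)) (i, j)) = (\<Sum>k<m. adj_prod n (entries (A k)) (entries (B k)) (i, j))"
      if "i < n" "j < n" for i j
    proof -
      have "(\<Sum>k<m. adj_prod n (entries (B k)) (entries (A k)) (i, j)) =
          cnj (\<Sum>k<m. adj_prod n (entries (A k)) (entries (B k)) (j, i))"
        unfolding cnj_sum by (intro sum.cong refl adj_prod_adjoint)
      then show ?thesis using herm[OF that] by simp
    qed
    then show ?thesis
      unfolding L_def h_def by (intro sum.cong refl) (auto simp: I_def sum_fun_apply)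
  qed
  finally have "Re (\<Sum>i<m. (the (eval_expr l T (b i)) *\<^sub>v x) \<bullet>c (the (eval_expr l T (a i)) *\<^sub>v x)) =
      Re (L h) + \<epsilon> * Re X" by (simp del: Re_sum)
  also have "\<dots> < 0" using \<epsilon>X Lh by simp
  finally show ?thesis using T by blast
qed

section \<open>Hereditary sums of squares\<close>

lemma strict_dom_common_domain:
  fixes es :: "'d::finite nc_expr set"
  assumes "finite es" "\<And>e. e \<in> es \<Longrightarrow> nc_dom e \<noteq> {}"
  shows "common_domain (strict_dom (star_of ` es))"
proof
  fix n m and X Y :: "'d \<Rightarrow> complex mat"
  assume X: "(n, X) \<in> strict_dom (star_of ` es)"
  show "0 < n" "X \<in> mat_tuples n" using X by (auto simp: strict_dom_def)
  assume Y: "(m, Y) \<in> strict_dom (star_of ` es)"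
  have cX: "X k \<in> carrier_mat n n" and cY: "Y k \<in> carrier_mat m m" for k
    using X Y by (auto simp: strict_dom_def mat_tuples_def)
  have "strict_contraction (block_sum (X k) (Y k))" for k
    by (rule strict_contraction_block_sum[OF cX cY]) (use X Y in \<open>auto simp: strict_dom_def\<close>)
  moreover have "eval_star (n + m) (\<lambda>k. block_sum (X k) (Y k)) e \<noteq> None" if "e \<in> star_of ` es" for e
    using eval_star_block_sum[of X n Y m e] X Y that by (fastforce simp: strict_dom_def)
  moreover have "(\<lambda>k. block_sum (X k) (Y k)) \<in> mat_tuples (n + m)"
    by (rule block_sum_tuple) (use X Y in \<open>auto simp: strict_dom_def\<close>)
  ultimately show "(n + m, \<lambda>k. block_sum (X k) (Y k)) \<in> strict_dom (star_of ` es)"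
    using X by (auto simp: strict_dom_def)
next
  show "strict_dom (star_of ` es) \<noteq> {}"
    by (rule strict_dom_nonempty) (use assms star_dom_star_of in auto)
qed

lemma eval_star_sum_expr_map:
  assumes X: "X \<in> mat_tuples n"
    and G: "\<And>z. z \<in> set zs \<Longrightarrow> \<exists>Q. eval_star n X (G z) = Some Q \<and> entries Q = H z"
  shows "\<exists>S. eval_star n X (sum_expr (map G zs)) = Some S \<and> S \<in> carrier_mat n n \<and>
    entries S = sum_list (map H zs)"
proof -
  have 1: "map (\<lambda>e. entries (the (eval_star n X e))) (map G zs) = map H zs"
    unfolding map_map by (intro map_cong refl) (use G in fastforce)
  have 2: "eval_star n X e \<noteq> None" if "e \<in> set (map G zs)" for e
    using G that by fastforce
  show ?thesis using eval_star_sum_expr[OF X, of "map G zs", OF 2] unfolding 1 .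
qed

lemma sum_list_pairs:
  fixes F :: "'b \<times> 'd::finite \<Rightarrow> 'a::comm_monoid_add"
  assumes "distinct ds" "set ds = UNIV"
  shows "sum_list (map F (concat (map (\<lambda>k. map (\<lambda>d. (r k d, d)) ds) [0..<K]))) =
    (\<Sum>k<K. \<Sum>d\<in>UNIV. F (r k d, d))"
proof (induction K)
  case (Suc K)
  have "sum_list (map F (map (\<lambda>d. (r K d, d)) ds)) = (\<Sum>d\<in>UNIV. F (r K d, d))"
    unfolding map_map assms(2)[symmetric] using sum_list_distinct_conv_sum_set[OF assms(1)]
    by (simp add: o_def)
  then show ?case using Suc by simp
qed simp

text \<open>
  Vectors in the span of values at a point are values of functions in the span; this lifts a
  decomposition at one point to rational functions.
\<close>

lemma span_at_point:
  assumes "f \<in> cfun.span (at_point pt ` S)"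
  shows "\<exists>F \<in> cfun.span S. at_point pt F = f"
  using assms
proof (induction rule: cfun.span_induct_alt)
  case base
  show ?case by (rule bexI[of _ 0]) (simp_all only: at_point_linear cfun.span_zero)
next
  case (step c x y)
  then obtain u F where u: "u \<in> S" "x = at_point pt u" "F \<in> cfun.span S" "at_point pt F = y" by blast
  then have "cscale c u + F \<in> cfun.span S"
    by (intro cfun.span_add cfun.span_scale) (auto intro: cfun.span_base)
  moreover have "at_point pt (cscale c u + F) = cscale c x + y" using u by (simp only: at_point_linear)
  ultimately show ?case by blast
qed

lemma sum_UNIV_option: "(\<Sum>\<kappa>\<in>UNIV. F \<kappa>) = F None + (\<Sum>d\<in>UNIV. F (Some (d :: 'd::finite)))"
  by (simp add: UNIV_option_conv sum.reindex)

theorem theorem1: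
  fixes q :: "'d::finite star_expr set"
  assumes "hereditary q"
    and "nonneg_on_polydisc q"
  shows "\<exists>(K::nat) (L::nat) (r :: nat \<Rightarrow> 'd nc_expr) (k :: nat \<Rightarrow> 'd) (s :: nat \<Rightarrow> 'd nc_expr).
    (\<forall>i<K. nc_dom (r i) \<noteq> {}) \<and> (\<forall>j<L. nc_dom (s j) \<noteq> {}) \<and>
    q = star_class (Add
      (sum_expr (map (\<lambda>i. Mult (adj_expr (star_of (r i)))
                            (Mult (defect_expr (k i)) (star_of (r i)))) [0..<K]))
      (sum_expr (map (\<lambda>j. Mult (adj_expr (star_of (s j))) (star_of (s j))) [0..<L])))"
proof -
  obtain m a b where dom_ab: "\<forall>i<m. nc_dom (a i) \<noteq> {} \<and> nc_dom (b i) \<noteq> {}"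
    and q: "q = star_class (sum_expr
        (map (\<lambda>i. Mult (adj_expr (star_of (a i))) (star_of (b i))) [0..<(m::nat)]))"
    using assms(1) unfolding hereditary_def by blast
  define e0 where "e0 = sum_expr (map (\<lambda>i. Mult (adj_expr (star_of (a i))) (star_of (b i))) [0..<m])"
  define es where "es = a ` {..<m} \<union> b ` {..<m}"
  have es_fin: "finite es" by (simp add: es_def)
  have es_dom: "nc_dom e \<noteq> {}" if "e \<in> es" for e using that dom_ab by (auto simp: es_def)
  define D where "D = strict_dom (star_of ` es)"
  interpret common_domain D unfolding D_def by (rule strict_dom_common_domain[OF es_fin es_dom])
  have good_es: "good e" if "e \<in> es" for e
    using that unfolding good_def by (auto simp: D_def strict_dom_def eval_star_star_of)
  have good_ab: "good (a i)" "good (b i)" if "i < m" for i using that good_es by (auto simp: es_def)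
  have D_strict: "strict_contraction (X k)" if "(n, X) \<in> D" for n X k
    using that by (auto simp: D_def strict_dom_def)

  \<comment> \<open>\<open>U\<close> spans \<open>V\<close>, and \<open>U'\<close> spans \<open>V'\<close>.\<close>
  define U where "U = (\<Union>e\<in>es. set (var_args e (Const 1)))"
  define U' where "U' = U \<union> (\<lambda>(k, u). Mult (Sym k) u) ` (UNIV \<times> U) \<union> es"
  have U_fin: "finite U" using es_fin by (simp add: U_def)
  then have U'_fin: "finite U'" using es_fin by (simp add: U'_def)
  have U_good: "good u" if "u \<in> U" for u
    using that good_var_args[OF good_es good_Const] by (auto simp: U_def)
  have U'_good: "good u" if "u \<in> U'" for u
    using that U_good good_es good_Mult[OF good_Sym] by (auto simp: U'_def)
  have UU': "cfun.span (val ` U) \<subseteq> cfun.span (val ` U')"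
    by (intro cfun.span_mono image_mono) (auto simp: U'_def)
  have shift_span: "shift k f \<in> cfun.span (val ` U')" if "f \<in> cfun.span (val ` U)" for k f
    using that
  proof (induction rule: cfun.span_induct_alt)
    case base
    show ?case by (simp only: shift_linear cfun.span_zero)
  next
    case (step c x y)
    then obtain u where u: "u \<in> U" "x = val u" by blast
    have "shift k x = val (Mult (Sym k) u)" using val_shift[OF U_good[OF u(1)]] u(2) by simp
    moreover have "Mult (Sym k) u \<in> U'" using u(1) by (auto simp: U'_def)
    ultimately have "shift k x \<in> cfun.span (val ` U')" by (auto intro: cfun.span_base)
    then show ?case unfolding shift_linear by (intro cfun.span_add cfun.span_scale step.IH)
  qed

  obtain n Y where pt: "(n, Y) \<in> D"
    and determine: "\<And>h. h \<in> cfun.span (products U') \<Longrightarrow> at_point (n, Y) h = 0 \<Longrightarrow> h = 0"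
    using determining_point[OF U'_fin U'_good] by (metis surj_pair)
  have n: "0 < n" and Y: "Y \<in> mat_tuples n" using D_pos[OF pt] D_tuple[OF pt] .
  have Y_strict: "strict_contraction (Y k)" for k by (rule D_strict[OF pt])
  have at_val: "at_point (n, Y) (val e) = entries E" if "eval_expr n Y e = Some E" for e E
    using that pt by (simp add: at_point_val)

  define h0 where "h0 = (\<Sum>i<m. hprod (val (a i)) (val (b i)))"
  have h0_span: "h0 \<in> cfun.span (products U')"
    unfolding h0_def
    by (intro cfun.span_sum hprod_in_span cfun.span_base) (auto simp: U'_def es_def)
  have eval_e0: "\<exists>S. eval_star l X e0 = Some S \<and> S \<in> carrier_mat l l \<and>
      entries S = (\<Sum>i<m. entries (mat_adjoint (the (eval_expr l X (a i))) * the (eval_expr l X (b i))))"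
    if X: "X \<in> mat_tuples l" and dfd: "\<And>e. e \<in> es \<Longrightarrow> eval_expr l X e \<noteq> None" for l X
  proof -
    have "\<exists>S. eval_star l X e0 = Some S \<and> S \<in> carrier_mat l l \<and>
      entries S = sum_list (map (\<lambda>i. entries (mat_adjoint (the (eval_expr l X (a i))) * the (eval_expr l X (b i)))) [0..<m])"
      unfolding e0_def
    proof (rule eval_star_sum_expr_map[OF X])
      fix i assume "i \<in> set [0..<m]"
      then have "a i \<in> es" "b i \<in> es" by (auto simp: es_def)
      then obtain A B where "eval_expr l X (a i) = Some A" "eval_expr l X (b i) = Some B" using dfd by blast
      then show "\<exists>Q. eval_star l X (Mult (adj_expr (star_of (a i))) (star_of (b i))) = Some Q \<and>
          entries Q = entries (mat_adjoint (the (eval_expr l X (a i))) * the (eval_expr l X (b i)))"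
        using eval_star_adj_mult[OF X] by fastforce
    qed
    then show ?thesis by (simp only: interv_sum_list_conv_sum_set_nat set_upt atLeast0LessThan)
  qed
  have es_D: "eval_expr l X e \<noteq> None" if "(l, X) \<in> D" "e \<in> es" for l X e
    using good_es[OF that(2)] that(1) unfolding good_def by fast
  have eval_e0_D: "\<exists>S. eval_star l X e0 = Some S \<and> S \<in> carrier_mat l l \<and> entries S = at_point (l, X) h0"
    if X: "(l, X) \<in> D" for l X
  proof -
    obtain S where S: "eval_star l X e0 = Some S" "S \<in> carrier_mat l l"
      "entries S = (\<Sum>i<m. entries (mat_adjoint (the (eval_expr l X (a i))) * the (eval_expr l X (b i))))"
      using eval_e0[OF D_tuple[OF X] es_D[OF X]] by blast
    have "entries (mat_adjoint (the (eval_expr l X (a i))) * the (eval_expr l X (b i))) =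
        at_point (l, X) (hprod (val (a i)) (val (b i)))" if i: "i < m" for i
    proof -
      obtain A B where A: "eval_expr l X (a i) = Some A" "A \<in> carrier_mat l l"
        and B: "eval_expr l X (b i) = Some B" "B \<in> carrier_mat l l"
        using goodD[OF good_ab(1)[OF i] X] goodD[OF good_ab(2)[OF i] X] by blast
      then show ?thesis
        unfolding at_point_hprod at_point_val using X adj_prod_entries[OF A(2) B(2)] by simp
    qed
    then have "entries S = at_point (l, X) h0"
      unfolding S(3) h0_def at_point_sum by (intro sum.cong) auto
    with S show ?thesis by blast
  qed
  have e0_dom: "star_dom e0 \<noteq> {}"
    using eval_e0_D[OF pt] n Y by (auto simp: star_dom_def)
  then have e0_q: "e0 \<in> q"
    unfolding q e0_def[symmetric] star_class_def star_rel_def by auto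
  have psd_q: "psd l A" if "0 < l" "X \<in> mat_tuples l" "\<And>k. strict_contraction (X k)" "eval_star l X e0 = Some A" for l X A
    using strict_contraction_polydisc[OF that(1,2,3)] assms(2) e0_q that(4)
    unfolding nonneg_on_polydisc_def by blast

  define A where "A i = the (eval_expr n Y (a i))" for i
  define B where "B i = the (eval_expr n Y (b i))" for i
  have A: "eval_expr n Y (a i) = Some (A i)" "A i \<in> carrier_mat n n" if "i < m" for i
    using goodD[OF good_ab(1)[OF that] pt] by (auto simp: A_def)
  have B: "eval_expr n Y (b i) = Some (B i)" "B i \<in> carrier_mat n n" if "i < m" for i
    using goodD[OF good_ab(2)[OF that] pt] by (auto simp: B_def)
  define h where "h = at_point (n, Y) h0"
  have h_eq: "h p = (\<Sum>i<m. adj_prod n (entries (A i)) (entries (B i)) p)" for p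
  proof -
    have "h = (\<Sum>i<m. adj_prod n (entries (A i)) (entries (B i)))"
      unfolding h_def h0_def at_point_sum at_point_hprod
      by (intro sum.cong refl) (simp add: at_val[OF A(1)] at_val[OF B(1)])
    then show ?thesis by (simp only: sum_fun_apply)
  qed
  \<comment> \<open>Here positivity is used at \<open>Y\<close>, only to know that the value is Hermitian.\<close>
  have h_herm: "h (j, i) = cnj (h (i, j))" if ij: "i < n" "j < n" for i j
  proof -
    obtain S where S: "eval_star n Y e0 = Some S" "S \<in> carrier_mat n n" "entries S = h"
      using eval_e0_D[OF pt] unfolding h_def by blast
    have "psd n S" by (rule psd_q[OF n Y Y_strict S(1)])
    from psd_hermitian[OF this ij] show ?thesis using ij S(2) by (simp add: S(3)[symmetric] entries_def)
  qed

  obtain us0 where us0: "set us0 = at_point (n, Y) ` val ` U" using finite_list[of "at_point (n, Y) ` val ` U"] U_fin by auto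
  obtain us0' where us0': "set us0' = at_point (n, Y) ` val ` U'" using finite_list[of "at_point (n, Y) ` val ` U'"] U'_fin by auto
  define us where "us \<kappa> = (case \<kappa> of None \<Rightarrow> us0' | Some (k :: 'd) \<Rightarrow> us0)" for \<kappa>
  have supp': "set us0' \<subseteq> square_supp n"
  proof
    fix f assume "f \<in> set us0'"
    then obtain u where u: "u \<in> U'" "f = at_point (n, Y) (val u)" using us0' by auto
    obtain E where "eval_expr n Y u = Some E" "E \<in> carrier_mat n n" using goodD[OF U'_good[OF u(1)] pt] by blast
    then show "f \<in> square_supp n" using u(2) at_val entries_square_supp by simp
  qed
  have sub: "set us0 \<subseteq> set us0'" unfolding us0 us0' by (intro image_mono) (auto simp: U'_def)
  have supp: "set (us \<kappa>) \<subseteq> square_supp n" for \<kappa>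
    using supp' sub by (cases \<kappa>) (auto simp: us_def)
  have act_shift: "act (Y k) f \<in> cfun.span (set us0')" if f: "f \<in> cfun.span (set us0)" for k f
    using f
  proof (induction rule: cfun.span_induct_alt)
    case base
    show ?case by (simp only: act_zero cfun.span_zero)
  next
    case (step c x y)
    then obtain u where u: "u \<in> U" "x = at_point (n, Y) (val u)" using us0 by auto
    have "act (Y k) x = at_point (n, Y) (val (Mult (Sym k) u))"
      using pt by (simp add: u(2) val_shift[OF U_good[OF u(1)]] at_point_shift)
    moreover have "Mult (Sym k) u \<in> U'" using u(1) by (auto simp: U'_def)
    ultimately have "act (Y k) x \<in> cfun.span (set us0')" using us0' by (auto intro: cfun.span_base)
    then show ?case unfolding act_add act_cscale by (intro cfun.span_add cfun.span_scale step.IH)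
  qed

  have "\<exists>K f. (\<forall>k<K. \<forall>\<kappa>. f k \<kappa> \<in> cfun.span (set (us \<kappa>))) \<and>
    (\<forall>i<n. \<forall>j<n. h (i, j) = (\<Sum>k<K. \<Sum>\<kappa>\<in>UNIV. quad n Y \<kappa> (f (k :: nat) \<kappa>) (f k \<kappa>) (i, j)))"
  proof (rule hereditary_alternative[OF Y Y_strict supp], rule ccontr)
    fix w :: "nat \<times> nat \<Rightarrow> complex"
    \<comment> \<open>A separating functional would produce a point of the polydisc where the function is not positive.\<close>
    assume w: "\<And>\<kappa> f. f \<in> cfun.span (set (us \<kappa>)) \<Longrightarrow>
        0 \<le> Re (\<Sum>p\<in>{..<n} \<times> {..<n}. w p * quad n Y \<kappa> f f p)"
      and "\<not> 0 \<le> Re (\<Sum>p\<in>{..<n} \<times> {..<n}. w p * h p)"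
    then have neg: "Re (\<Sum>p\<in>{..<n} \<times> {..<n}. w p * h p) < 0" by (simp del: Re_sum)
    have "\<exists>l T x. 0 < l \<and> T \<in> mat_tuples l \<and> (\<forall>k. strict_contraction (T k)) \<and> x \<in> carrier_vec l \<and>
      (\<forall>e\<in>a ` {..<m} \<union> b ` {..<m}. eval_expr l T e \<noteq> None) \<and>
      Re (\<Sum>i<m. (the (eval_expr l T (b i)) *\<^sub>v x) \<bullet>c (the (eval_expr l T (a i)) *\<^sub>v x)) < 0"
    proof (rule negative_functional_point[OF n Y Y_strict A(1) B(1) supp', where us = us0 and w = w])
      show "cfun.span (set us0) \<subseteq> cfun.span (set us0')" by (rule cfun.span_mono[OF sub])
      show "0 \<le> Re (\<Sum>p\<in>{..<n} \<times> {..<n}. w p * quad n Y None f f p)" if "f \<in> cfun.span (set us0')" for f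
        using w[of f None] that by (simp add: us_def del: Re_sum)
      show "0 \<le> Re (\<Sum>p\<in>{..<n} \<times> {..<n}. w p * quad n Y (Some k) f f p)" if "f \<in> cfun.span (set us0)" for k f
        using w[of f "Some k"] that by (simp add: us_def del: Re_sum quad.simps)
      show "act (Y k) f \<in> cfun.span (set us0')" if "f \<in> cfun.span (set us0)" for k f
        by (rule act_shift[OF that])
      show "Re (\<Sum>p\<in>{..<n} \<times> {..<n}. w p * (\<Sum>k<m. adj_prod n (entries (A k)) (entries (B k)) p)) < 0"
        using neg by (simp only: h_eq)
      show "(\<Sum>k<m. adj_prod n (entries (A k)) (entries (B k)) (j, i)) =
          cnj (\<Sum>k<m. adj_prod n (entries (A k)) (entries (B k)) (i, j))" if "i < n" "j < n" for i j
        using h_herm[OF that] by (simp only: h_eq)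
      show "entries E \<in> cfun.span (set us0')" if "e \<in> a ` {..<m} \<union> b ` {..<m}" "eval_expr n Y e = Some E" for e E
      proof (rule cfun.span_base)
        have "e \<in> U'" using that(1) by (simp add: U'_def es_def)
        then show "entries E \<in> set us0'" unfolding us0' at_val[OF that(2), symmetric] by blast
      qed
      show "entries G \<in> cfun.span (set us0)"
        if "e \<in> a ` {..<m} \<union> b ` {..<m}" "g \<in> set (var_args e (Const 1))" "eval_expr n Y g = Some G" for e g G
      proof (rule cfun.span_base)
        have "g \<in> U" using that(1,2) unfolding U_def es_def by blast
        then show "entries G \<in> set us0" unfolding us0 at_val[OF that(3), symmetric] by blast
      qed
    qed
    then obtain l T x where T': "0 < l" "T \<in> mat_tuples l" "\<forall>k. strict_contraction (T k)" "x \<in> carrier_vec l"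
      "\<forall>e\<in>a ` {..<m} \<union> b ` {..<m}. eval_expr l T e \<noteq> None"
      and neg': "Re (\<Sum>i<m. (the (eval_expr l T (b i)) *\<^sub>v x) \<bullet>c (the (eval_expr l T (a i)) *\<^sub>v x)) < 0"
      by (elim exE conjE) (rule that)
    have T: "0 < l" "T \<in> mat_tuples l" "\<And>k. strict_contraction (T k)" "x \<in> carrier_vec l"
      "\<And>e. e \<in> es \<Longrightarrow> eval_expr l T e \<noteq> None"
      using T' unfolding es_def by blast+
    obtain S where S: "eval_star l T e0 = Some S" "S \<in> carrier_mat l l"
      "entries S = (\<Sum>i<m. entries (mat_adjoint (the (eval_expr l T (a i))) * the (eval_expr l T (b i))))"
      using eval_e0[OF T(2,5)] by blast
    have T_carrier: "the (eval_expr l T e) \<in> carrier_mat l l" if e: "e \<in> es" for e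
      using eval_star_carrier[OF T(2), of "star_of e"] T(5)[OF e] by (auto simp: eval_star_star_of)
    have "(S *\<^sub>v x) \<bullet>c x = (\<Sum>i<m. (the (eval_expr l T (b i)) *\<^sub>v x) \<bullet>c (the (eval_expr l T (a i)) *\<^sub>v x))"
      by (rule quadratic_form_hereditary[OF S(2) T(4) _ _ S(3)]; rule T_carrier) (auto simp: es_def)
    then have "Re ((S *\<^sub>v x) \<bullet>c x) < 0" using neg' by (simp only:)
    moreover have "0 \<le> (S *\<^sub>v x) \<bullet>c x" using psd_q[OF T(1,2,3) S(1)] T(4) by (simp add: psd_def)
    ultimately show False by (simp add: less_eq_complex_def)
  qed
  then obtain K f where f: "\<And>k \<kappa>. k < K \<Longrightarrow> f k \<kappa> \<in> cfun.span (set (us \<kappa>))"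
    "\<And>i j. i < n \<Longrightarrow> j < n \<Longrightarrow> h (i, j) = (\<Sum>k<K. \<Sum>\<kappa>\<in>UNIV. quad n Y \<kappa> (f (k :: nat) \<kappa>) (f k \<kappa>) (i, j))"
    by blast

  \<comment> \<open>Lift the vectors of the decomposition at \<open>Y\<close> to rational expressions.\<close>
  have "\<exists>s. good s \<and> val s \<in> cfun.span (val ` U') \<and> at_point (n, Y) (val s) = f k None" if "k < K" for k
  proof -
    have "f k None \<in> cfun.span (at_point (n, Y) ` val ` U')" using f(1)[OF that, of None] us0' by (simp add: us_def)
    then obtain F where F: "F \<in> cfun.span (val ` U')" "at_point (n, Y) F = f k None" using span_at_point by blast
    then obtain s where "good s" "val s = F" using span_val_expr U'_good by blast
    with F show ?thesis by blast
  qed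
  then obtain s where s: "\<And>k. k < K \<Longrightarrow> good (s k)" "\<And>k. k < K \<Longrightarrow> val (s k) \<in> cfun.span (val ` U')"
    "\<And>k. k < K \<Longrightarrow> at_point (n, Y) (val (s k)) = f k None" by metis
  have "\<exists>r. good r \<and> val r \<in> cfun.span (val ` U) \<and> at_point (n, Y) (val r) = f k (Some d)" if "k < K" for k d
  proof -
    have "f k (Some d) \<in> cfun.span (at_point (n, Y) ` val ` U)" using f(1)[OF that, of "Some d"] us0 by (simp add: us_def)
    then obtain F where F: "F \<in> cfun.span (val ` U)" "at_point (n, Y) F = f k (Some d)" using span_at_point by blast
    then obtain r where "good r" "val r = F" using span_val_expr U_good by blast
    with F show ?thesis by blast
  qed
  then obtain r where r: "\<And>k d. k < K \<Longrightarrow> good (r k d)" "\<And>k d. k < K \<Longrightarrow> val (r k d) \<in> cfun.span (val ` U)"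
    "\<And>k d. k < K \<Longrightarrow> at_point (n, Y) (val (r k d)) = f k (Some d)" by metis
  define h1 where "h1 = (\<Sum>k<K. \<Sum>d\<in>UNIV. hprod (val (r k d)) (val (r k d)) -
      hprod (shift d (val (r k d))) (shift d (val (r k d)))) + (\<Sum>k<K. hprod (val (s k)) (val (s k)))"
  have h1_span: "h1 \<in> cfun.span (products U')"
    unfolding h1_def
    by (intro cfun.span_add cfun.span_sum cfun.span_diff hprod_in_span shift_span s(2) subsetD[OF UU'] r(2)) auto
  \<comment> \<open>The two hereditary functions agree at the determining point, hence everywhere.\<close>
  have "h0 - h1 = 0"
  proof (rule determine)
    show span: "h0 - h1 \<in> cfun.span (products U')" by (intro cfun.span_diff h0_span h1_span)
    have "(h0 - h1) ((n, Y), i, j) = 0" for i j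
    proof (cases "i < n \<and> j < n")
      case True
      have "at_point (n, Y) h1 = (\<Sum>k<K. \<Sum>d\<in>UNIV. quad n Y (Some d) (f k (Some d)) (f k (Some d))) +
          (\<Sum>k<K. quad n Y None (f k None) (f k None))"
        unfolding h1_def at_point_linear at_point_sum at_point_hprod at_point_shift
        by (intro arg_cong2[where f = "(+)"] sum.cong refl) (use pt r(3) s(3) in simp_all)
      then have "at_point (n, Y) h1 (i, j) = (\<Sum>k<K. \<Sum>\<kappa>\<in>UNIV. quad n Y \<kappa> (f k \<kappa>) (f k \<kappa>) (i, j))"
        by (simp only: sum_UNIV_option sum.distrib sum_fun_apply plus_fun_apply add.commute)
      then have "at_point (n, Y) h1 (i, j) = h (i, j)" using f(2) True by simp
      then show ?thesis by (simp add: h_def at_point_def)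
    qed (use products_span_off_domain[OF span, of "(n, Y)" i j] in auto)
    then show "at_point (n, Y) (h0 - h1) = 0" by (auto simp: at_point_def fun_eq_iff)
  qed
  then have h01: "h0 = h1" by simp

  obtain ds :: "'d list" where ds: "distinct ds" "set ds = UNIV" using finite_distinct_list[of "UNIV :: 'd set"] by auto
  define rl where "rl = concat (map (\<lambda>k. map (\<lambda>d. (r k d, d)) ds) [0..<K])"
  define G where "G z = Mult (adj_expr (star_of (fst z))) (Mult (defect_expr (snd z)) (star_of (fst z)))"
    for z :: "'d nc_expr \<times> 'd"
  define e1 where "e1 = Add (sum_expr (map (\<lambda>i. G (rl ! i)) [0..<length rl]))
      (sum_expr (map (\<lambda>j. Mult (adj_expr (star_of (s j))) (star_of (s j))) [0..<K]))"
  have rl_good: "good (fst z)" if "z \<in> set rl" for z using that r(1) by (auto simp: rl_def)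
  have map_rl: "map (\<lambda>i. G (rl ! i)) [0..<length rl] = map G rl"
    by (rule nth_equalityI) auto
  have eval_e1: "\<exists>S. eval_star l X e1 = Some S \<and> S \<in> carrier_mat l l \<and> entries S = at_point (l, X) h1"
    if X: "(l, X) \<in> D" for l X
  proof -
    have Xt: "X \<in> mat_tuples l" by (rule D_tuple[OF X])
    have Xc: "X k \<in> carrier_mat l l" for k using Xt by (simp add: mat_tuples_def)
    have "\<exists>S. eval_star l X (sum_expr (map G rl)) = Some S \<and> S \<in> carrier_mat l l \<and>
        entries S = sum_list (map (\<lambda>z. at_point (l, X) (hprod (val (fst z)) (val (fst z)) -
          hprod (shift (snd z) (val (fst z))) (shift (snd z) (val (fst z))))) rl)"
    proof (rule eval_star_sum_expr_map[OF Xt])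
      fix z assume "z \<in> set rl"
      then obtain R where R: "eval_expr l X (fst z) = Some R" "R \<in> carrier_mat l l"
        using goodD[OF rl_good X] by blast
      have "at_point (l, X) (hprod (val (fst z)) (val (fst z)) -
          hprod (shift (snd z) (val (fst z))) (shift (snd z) (val (fst z)))) =
        adj_prod l (entries R) (entries R) - adj_prod l (entries (X (snd z) * R)) (entries (X (snd z) * R))"
        unfolding at_point_linear at_point_hprod at_point_shift at_point_val
        using X R by (simp only: fst_conv snd_conv if_True option.sel act_entries[OF Xc R(2)])
      then show "\<exists>Q. eval_star l X (G z) = Some Q \<and> entries Q = at_point (l, X) (hprod (val (fst z)) (val (fst z)) -
          hprod (shift (snd z) (val (fst z))) (shift (snd z) (val (fst z))))"
        using eval_star_defect[OF Xt R(1), of "snd z"] unfolding G_def by (simp only:)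
    qed
    then obtain S1 where S1: "eval_star l X (sum_expr (map G rl)) = Some S1" "S1 \<in> carrier_mat l l"
      "entries S1 = (\<Sum>k<K. \<Sum>d\<in>UNIV. at_point (l, X) (hprod (val (r k d)) (val (r k d)) -
          hprod (shift d (val (r k d))) (shift d (val (r k d)))))"
      unfolding rl_def sum_list_pairs[OF ds] by auto
    have "\<exists>S. eval_star l X (sum_expr (map (\<lambda>j. Mult (adj_expr (star_of (s j))) (star_of (s j))) [0..<K])) = Some S \<and>
        S \<in> carrier_mat l l \<and> entries S = sum_list (map (\<lambda>j. at_point (l, X) (hprod (val (s j)) (val (s j)))) [0..<K])"
    proof (rule eval_star_sum_expr_map[OF Xt])
      fix j assume "j \<in> set [0..<K]"
      then have "j < K" by simp
      then obtain R where R: "eval_expr l X (s j) = Some R" "R \<in> carrier_mat l l"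
        using goodD[OF s(1) X] by blast
      show "\<exists>Q. eval_star l X (Mult (adj_expr (star_of (s j))) (star_of (s j))) = Some Q \<and>
          entries Q = at_point (l, X) (hprod (val (s j)) (val (s j)))"
        unfolding eval_star_adj_mult[OF Xt R(1) R(1)] at_point_hprod at_point_val
        using X R adj_prod_entries[OF R(2) R(2)] by simp
    qed
    then obtain S2 where S2: "eval_star l X (sum_expr (map (\<lambda>j. Mult (adj_expr (star_of (s j))) (star_of (s j))) [0..<K])) = Some S2"
      "S2 \<in> carrier_mat l l" "entries S2 = (\<Sum>j<K. at_point (l, X) (hprod (val (s j)) (val (s j))))"
      unfolding interv_sum_list_conv_sum_set_nat set_upt atLeast0LessThan by blast
    have "eval_star l X e1 = Some (S1 + S2)"
      using S1(1) S2(1) unfolding e1_def map_rl by (simp add: eval_star_def)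
    moreover have "entries (S1 + S2) = at_point (l, X) h1"
      unfolding entries_add[OF S1(2) S2(2)] S1(3) S2(3) h1_def at_point_linear at_point_sum ..
    moreover have "S1 + S2 \<in> carrier_mat l l" using S1(2) S2(2) by simp
    ultimately show ?thesis by blast
  qed
  have entries_inj: "P = Q" if "P \<in> carrier_mat l l" "Q \<in> carrier_mat l l" "entries P = entries Q" for P Q :: "complex mat" and l
  proof (rule eq_matI)
    fix i j assume "i < dim_row Q" "j < dim_col Q"
    then show "P $$ (i, j) = Q $$ (i, j)"
      using fun_cong[OF that(3), of "(i, j)"] that(1,2) by (simp add: entries_def)
  qed (use that in auto)
  have "(e0, e1) \<in> star_rel"
  proof (rule star_relI[where es = "star_of ` es"])
    show "star_dom e0 \<noteq> {}" by (rule e0_dom)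
    show "star_dom e1 \<noteq> {}" using eval_e1[OF pt] n Y by (auto simp: star_dom_def)
    show "finite (star_of ` es)" using es_fin by simp
    show "star_dom e \<noteq> {}" if "e \<in> star_of ` es" for e using that es_dom star_dom_star_of by fastforce
    fix l X assume "(l, X) \<in> strict_dom (star_of ` es)"
    then have X: "(l, X) \<in> D" by (simp add: D_def)
    obtain S0 S1 where S: "eval_star l X e0 = Some S0" "S0 \<in> carrier_mat l l" "entries S0 = at_point (l, X) h0"
      "eval_star l X e1 = Some S1" "S1 \<in> carrier_mat l l" "entries S1 = at_point (l, X) h1"
      using eval_e0_D[OF X] eval_e1[OF X] by blast
    then have "S0 = S1" using entries_inj h01 by metis
    then show "eval_star l X e0 = eval_star l X e1" using S by simp
  qed
  then have q_e1: "q = star_class e1" using star_class_eqI q unfolding e0_def by blast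
  show ?thesis
  proof (rule exI[of _ "length rl"], rule exI[of _ K], rule exI[of _ "\<lambda>i. fst (rl ! i)"],
      rule exI[of _ "\<lambda>i. snd (rl ! i)"], rule exI[of _ s], intro conjI allI impI)
    show "nc_dom (fst (rl ! i)) \<noteq> {}" if "i < length rl" for i
      using good_nc_dom[OF rl_good] that nth_mem by blast
    show "nc_dom (s j) \<noteq> {}" if "j < K" for j by (rule good_nc_dom[OF s(1)[OF that]])
  qed (use q_e1 in \<open>simp only: e1_def G_def\<close>)
qed

end
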